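(* Let $\mathbb{P}$ be the distribution of a stationary IDp process with L\'evy measure $Q$. Then $\mathbb{P}$ can be written in a unique way as $$\mathbb{P} = \mathbb{P}_{Q_B} * \mathbb{P}_{Q_m} * \mathbb{P}_{Q_{wm}} * \mathbb{P}_{Q_{ne}},$$ where $Q_B, Q_m, Q_{wm}, Q_{ne}$ are L\'evy measures of stationary IDp processes such that: (i) $(\mathbb{R}^{\mathbb{Z}}, \mathcal{B}^{\otimes \mathbb{Z}}, Q_B, T)$ is dissipative; (ii) $(\mathbb{R}^{\mathbb{Z}}, \mathcal{B}^{\otimes \mathbb{Z}}, Q_m, T)$ is conservative of zero type; (iii) $(\mathbb{R}^{\mathbb{Z}}, \mathcal{B}^{\otimes \mathbb{Z}}, Q_{wm}, T)$ is of type $\mathbf{II}_\infty$ and of positive type; (iv) $(\mathbb{R}^{\mathbb{Z}}, \mathcal{B}^{\otimes \mathbb{Z}}, Q_{ne}, T)$ is of type $\mathbf{II}_1$.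
   Context: **Processes.** $T$ is the shift on $\mathbb{R}^{\mathbb{Z}}$, $T\{x_i\}_{i\in\mathbb{Z}}=\{x_{i+1}\}_{i\in\mathbb{Z}}$, and $\mathcal{B}$ is the Borel $\sigma$-algebra of $\mathbb{R}$. The convolution $\mathbb{P}_1*\mathbb{P}_2$ of two distributions on $(\mathbb{R}^{\mathbb{Z}},\mathcal{B}^{\otimes\mathbb{Z}})$ is the image of $\mathbb{P}_1\otimes\mathbb{P}_2$ under coordinatewise addition. A distribution $\mathbb{P}$ is infinitely divisible (ID) if for every integer $k\ge1$ there is $\mathbb{P}_k$ with $\mathbb{P}=\mathbb{P}_k^{*k}$. Let $\mathfrak{A}\subset\mathbb{R}^{\mathbb{Z}}$ be the set of sequences with finitely many nonzero coordinates. A stationary ID process $X$ has finite-dimensional characteristic functions (for $a\in\mathfrak{A}$) $$\mathbb{E}[\exp i\langle a,X\rangle]=\exp\Big[-\tfrac12\langle Ra,a\rangle+i\langle a,b_\infty\rangle+\int_{\mathbb{R}^{\mathbb{Z}}}(e^{i\langle a,x\rangle}-1-i\langle c(x),a\rangle)\,Q(dx)\Big],$$ where $R$ is the covariance function of a centered stationary Gaussian process, $b_\infty$ is the sequence constantly equal to $b\in\mathbb{R}$, $c(x)_i=-1$ if $x_i<-1$, $c(x)_i=x_i$ if $-1\le x_i\le1$, $c(x)_i=1$ if $x_i>1$, and $Q$ (the L\'evy measure) is a $\sigma$-finite shift-invariant measure on $\mathbb{R}^{\mathbb{Z}}$ with $Q\{0\}=0$ ($0$ the zero sequence) and $\int (x_0^2\wedge1)\,Q(dx)<\infty$.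 $\langle R,b,Q\rangle$ is the generating triplet; conversely any such triplet defines a stationary ID distribution. The process is IDp (Poissonian) if it has no Gaussian part; by convention, an IDp process of L\'evy measure $Q$ is one with generating triplet $\langle 0,0,Q\rangle$, and its distribution is denoted $\mathbb{P}_Q$. **Dynamical systems.** Let $(\Omega,\mathcal{F},\mu,T)$ be a $\sigma$-finite Lebesgue space with a bijective bimeasurable $\mu$-preserving map $T$. A set $A\in\mathcal{F}$ is wandering if the sets $T^{-n}A$, $n\in\mathbb{Z}$, are disjoint; $\mathfrak{D}$ is the (measurable) union of all wandering sets. The system is dissipative if $\mathfrak{D}=\Omega$ mod $\mu$, conservative if $\mathfrak{D}=\emptyset$ mod $\mu$. It is of type $\mathbf{II}_1$ if there is a $T$-invariant probability measure equivalent to $\mu$; of type $\mathbf{II}_\infty$ if there is no $T$-invariant probability measure absolutely continuous with respect to $\mu$ (dissipative systems are thus included in type $\mathbf{II}_\infty$). It is of zero type if $\mu(A\cap T^{-k}A)\to0$ as $k\to+\infty$ for all $A\in\mathcal{F}$ with $0<\mu(A)<\infty$; of positive type if $\limsup_{k\to\infty}\mu(A\cap T^{-k}A)>0$ for all $A\in\mathcal{F}$ with $\mu(A)>0$. The zero measure is considered to satisfy each of these properties (a component may be trivial). *)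

theory Defs
  imports "HOL-Probability.Probability"
begin

abbreviation seq_space :: "(int \<Rightarrow> real) measure"
  where "seq_space \<equiv> PiM UNIV (\<lambda>_. borel)"

definition shift :: "(int \<Rightarrow> real) \<Rightarrow> (int \<Rightarrow> real)"
  where "shift x = (\<lambda>i. x (i + 1))"

definition finite_seqs :: "(int \<Rightarrow> real) set"
  where "finite_seqs = {a. finite {i. a i \<noteq> 0}}"

text \<open>The pairing is only meaningful when its first argument is in \<^const>\<open>finite_seqs\<close>.\<close>

definition pairing :: "(int \<Rightarrow> real) \<Rightarrow> (int \<Rightarrow> real) \<Rightarrow> real"
  where "pairing a x = (\<Sum>i | a i \<noteq> 0. a i * x i)"

definition seq_law :: "(int \<Rightarrow> real) measure \<Rightarrow> bool"
  where "seq_law P \<longleftrightarrow> prob_space P \<and> sets P = sets seq_space"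

definition shift_invariant :: "(int \<Rightarrow> real) measure \<Rightarrow> bool"
  where "shift_invariant M \<longleftrightarrow> distr M seq_space shift = M"

definition seq_convolution ::
    "(int \<Rightarrow> real) measure \<Rightarrow> (int \<Rightarrow> real) measure \<Rightarrow> (int \<Rightarrow> real) measure"
    (infixl "\<^bold>*" 70)
  where "P1 \<^bold>* P2 = distr (P1 \<Otimes>\<^sub>M P2) seq_space (\<lambda>(x, y). \<lambda>i. x i + y i)"

primrec convolution_power ::
    "(int \<Rightarrow> real) measure \<Rightarrow> nat \<Rightarrow> (int \<Rightarrow> real) measure"
  where
    "convolution_power P 0 = return seq_space (\<lambda>_. 0)"
  | "convolution_power P (Suc k) = convolution_power P k \<^bold>* P"

definition infinitely_divisible :: "(int \<Rightarrow> real) measure \<Rightarrow> bool"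
  where "infinitely_divisible P \<longleftrightarrow>
    (\<forall>k\<ge>1. \<exists>Pk. seq_law Pk \<and> P = convolution_power Pk k)"

definition clip :: "(int \<Rightarrow> real) \<Rightarrow> (int \<Rightarrow> real)"
  where "clip x = (\<lambda>i. if x i < - 1 then - 1 else if x i \<le> 1 then x i else 1)"

definition levy_measure :: "(int \<Rightarrow> real) measure \<Rightarrow> bool"
  where "levy_measure Q \<longleftrightarrow>
    sets Q = sets seq_space \<and>
    sigma_finite_measure Q \<and>
    shift_invariant Q \<and>
    emeasure Q {\<lambda>_. 0} = 0 \<and>
    (\<integral>\<^sup>+ x. ennreal (min ((x 0)\<^sup>2) 1) \<partial>Q) < \<infinity>"

text \<open>
  A process is centered Gaussian if all its finite linear combinations have a (possibly
  degenerate) centered normal distribution. By stationarity its covariance function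
  depends only on the lag.
\<close>

definition stationary_gaussian_covariance :: "(int \<Rightarrow> real) \<Rightarrow> bool"
  where "stationary_gaussian_covariance R \<longleftrightarrow>
    (\<exists>G. seq_law G \<and> shift_invariant G \<and>
      (\<forall>a\<in>finite_seqs.
        (AE x in G. pairing a x = 0) \<or>
        (\<exists>\<sigma>>0. distributed G lborel (pairing a) (normal_density 0 \<sigma>))) \<and>
      (\<forall>k. R k = (\<integral>x. x 0 * x k \<partial>G)))"

definition covariance_operator :: "(int \<Rightarrow> real) \<Rightarrow> (int \<Rightarrow> real) \<Rightarrow> (int \<Rightarrow> real)"
  where "covariance_operator R a = (\<lambda>i. \<Sum>j | a j \<noteq> 0. R (i - j) * a j)"

definition has_generating_triplet ::
    "(int \<Rightarrow> real) measure \<Rightarrow> (int \<Rightarrow> real) \<Rightarrow> real \<Rightarrow> (int \<Rightarrow> real) measure \<Rightarrow> bool"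
  where "has_generating_triplet P R b Q \<longleftrightarrow>
    stationary_gaussian_covariance R \<and> levy_measure Q \<and>
    (\<forall>a\<in>finite_seqs.
      (CLINT x|P. iexp (pairing a x)) =
      exp (- (1/2) * complex_of_real (pairing a (covariance_operator R a))
           + \<i> * complex_of_real (pairing a (\<lambda>_. b))
           + (CLINT x|Q. iexp (pairing a x) - 1 - \<i> * complex_of_real (pairing a (clip x)))))"

text \<open>
  \<open>stationary_IDp P Q\<close> says that \<open>P\<close> is the law of the stationary IDp process with
  Levy measure \<open>Q\<close>. A law on the sequence space is determined by its finite-dimensional
  characteristic functions, so for each \<open>Q\<close> there is at most one such \<open>P\<close>.
\<close>

definition stationary_IDp :: "(int \<Rightarrow> real) measure \<Rightarrow> (int \<Rightarrow> real) measure \<Rightarrow> bool"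
  where "stationary_IDp P Q \<longleftrightarrow>
    seq_law P \<and> shift_invariant P \<and> infinitely_divisible P \<and>
    has_generating_triplet P (\<lambda>_. 0) 0 Q"

text \<open>
  The notions below are meant for a \<open>\<sigma>\<close>-finite measure \<open>M\<close> and a bijective, bimeasurable,
  measure-preserving map \<open>T\<close> of its space. For a Levy measure and the shift, these
  requirements hold.

  \<open>iterated_preimage M T n A\<close> is $T^{-n} A$ for an integer \<open>n\<close>; for negative \<open>n\<close> it is a
  forward image.
\<close>

definition iterated_preimage :: "'a measure \<Rightarrow> ('a \<Rightarrow> 'a) \<Rightarrow> int \<Rightarrow> 'a set \<Rightarrow> 'a set"
  where "iterated_preimage M T n A =
    (if 0 \<le> n then (T ^^ nat n) -` A \<inter> space M else (T ^^ nat (- n)) ` A)"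

definition wandering :: "'a measure \<Rightarrow> ('a \<Rightarrow> 'a) \<Rightarrow> 'a set \<Rightarrow> bool"
  where "wandering M T A \<longleftrightarrow>
    A \<in> sets M \<and> disjoint_family (\<lambda>n. iterated_preimage M T n A)"

text \<open>
  The union of all wandering sets has to be taken in the measure algebra: every
  non-periodic point forms a wandering singleton, so the set-theoretic union would contain
  all non-periodic points. The measurable union is the smallest measurable set, modulo null
  sets, that contains each member of the family modulo null sets.
\<close>

definition measurable_union :: "'a measure \<Rightarrow> 'a set set \<Rightarrow> 'a set \<Rightarrow> bool"
  where "measurable_union M \<A> D \<longleftrightarrow>
    D \<in> sets M \<and>
    (\<forall>A\<in>\<A>. emeasure M (A - D) = 0) \<and>
    (\<forall>E\<in>sets M. (\<forall>A\<in>\<A>. emeasure M (A - E) = 0) \<longrightarrow> emeasure M (D - E) = 0)"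

definition dissipative :: "'a measure \<Rightarrow> ('a \<Rightarrow> 'a) \<Rightarrow> bool"
  where "dissipative M T \<longleftrightarrow>
    (\<exists>D. measurable_union M {A. wandering M T A} D \<and> emeasure M (space M - D) = 0)"

definition conservative :: "'a measure \<Rightarrow> ('a \<Rightarrow> 'a) \<Rightarrow> bool"
  where "conservative M T \<longleftrightarrow>
    (\<exists>D. measurable_union M {A. wandering M T A} D \<and> emeasure M D = 0)"

definition invariant_probability :: "'a measure \<Rightarrow> ('a \<Rightarrow> 'a) \<Rightarrow> 'a measure \<Rightarrow> bool"
  where "invariant_probability M T \<nu> \<longleftrightarrow>
    prob_space \<nu> \<and> sets \<nu> = sets M \<and> distr \<nu> M T = \<nu>"

text \<open>
  The zero measure is by convention of type \<open>II\<^sub>1\<close>. It satisfies the other definitions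
  without a special clause.
\<close>

definition type_II_1 :: "'a measure \<Rightarrow> ('a \<Rightarrow> 'a) \<Rightarrow> bool"
  where "type_II_1 M T \<longleftrightarrow>
    emeasure M (space M) = 0 \<or>
    (\<exists>\<nu>. invariant_probability M T \<nu> \<and> absolutely_continuous M \<nu> \<and> absolutely_continuous \<nu> M)"

text \<open>\<^term>\<open>absolutely_continuous M \<nu>\<close> means that \<open>\<nu>\<close> is absolutely continuous with respect
  to \<open>M\<close>.\<close>

definition type_II_infinity :: "'a measure \<Rightarrow> ('a \<Rightarrow> 'a) \<Rightarrow> bool"
  where "type_II_infinity M T \<longleftrightarrow>
    \<not> (\<exists>\<nu>. invariant_probability M T \<nu> \<and> absolutely_continuous M \<nu>)"

definition zero_type :: "'a measure \<Rightarrow> ('a \<Rightarrow> 'a) \<Rightarrow> bool"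
  where "zero_type M T \<longleftrightarrow>
    (\<forall>A\<in>sets M. 0 < emeasure M A \<and> emeasure M A < \<infinity> \<longrightarrow>
      (\<lambda>k. emeasure M (A \<inter> iterated_preimage M T (int k) A)) \<longlonglongrightarrow> 0)"

definition positive_type :: "'a measure \<Rightarrow> ('a \<Rightarrow> 'a) \<Rightarrow> bool"
  where "positive_type M T \<longleftrightarrow>
    (\<forall>A\<in>sets M. 0 < emeasure M A \<longrightarrow>
      limsup (\<lambda>k. emeasure M (A \<inter> iterated_preimage M T (int k) A)) > 0)"

end

theory Submission
  imports Defs
begin

text \<open>
  Distributions on the sequence space are determined by their characteristic functionals, and
  Levy measures by their exponents: a second difference of the exponent in the direction of a
  coordinate \<open>j\<close> is \<open>-2\<close> times the characteristic functional of the finite measure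
  \<open>(1 - cos (s x\<^sub>j)) Q(dx)\<close>. Hence decompositions of \<open>P\<close> correspond exactly to decompositions of
  \<open>Q\<close> as a sum of invariant measures, once every Levy measure is known to have an IDp process.
  That process is an almost surely convergent sum of independent compensated compound Poisson
  processes.

  For uniqueness, measures from two different classes are mutually singular, so each part of
  one decomposition is dominated by the corresponding part of any other. The key point is that
  zero type forces \<open>\<mu>(T\<^sup>-\<^sup>k A \<inter> B) \<rightarrow> 0\<close> for all \<open>B\<close> of finite measure, by Bonferroni: many nearly
  disjoint sets of measure bounded below do not fit into \<open>B\<close>. For existence, the space is split
  successively along maximal invariant sets: the union of all wandering sets, of the supports
  of absolutely continuous invariant probabilities, and of all sets \<open>A\<close> of finite measure with
  \<open>\<mu>(A \<inter> T\<^sup>-\<^sup>k A) \<rightarrow> 0\<close>.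
\<close>

section \<open>Invertible measure-preserving systems\<close>

text \<open>The Levy measures may have infinite mass, so nothing can be cancelled: uniqueness rests
  on inequalities in both directions. The families of sets behind the splitting are uncountable and
  have a union only modulo null sets. Each is replaced by a countable subfamily that exhausts it,
  and saturating this subfamily along orbits gives a set that is exactly invariant, so that
  restricting the measure to it gives a system again. Existence of laws cannot be bypassed, since
  \<open>stationary_IDp\<close> asks for an actual infinitely divisible law for each part.
  Stationarity and convolution roots then come from uniqueness of characteristic functionals. The
  independent series is made to converge by cutting \<open>Q\<close> into finite pieces whose
  contribution to each fixed coordinate eventually decays like \<open>8^-n\<close>: the tail
  estimate at threshold \<open>2^-n\<close> costs a factor \<open>4^n\<close>, which leaves a
  summable bound for Borel-Cantelli.\<close>

definition zpower :: "('a \<Rightarrow> 'a) \<Rightarrow> int \<Rightarrow> 'a \<Rightarrow> 'a"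
  where "zpower T n = (if 0 \<le> n then T ^^ nat n else inv T ^^ nat (- n))"

lemma zpower_0 [simp]: "zpower T 0 = id"
  by (simp add: zpower_def)

lemma zpower_Suc:
  assumes "bij T"
  shows "zpower T (n + 1) = T \<circ> zpower T n"
proof -
  consider "0 \<le> n" | "n < 0" by linarith
  then show ?thesis
  proof cases
    case 1
    then show ?thesis by (simp add: zpower_def nat_add_distrib)
  next
    case 2
    then have *: "nat (- n) = Suc (nat (- (n + 1)))" by simp
    have "T \<circ> inv T = id" using assms by (simp add: bij_is_surj flip: surj_iff)
    then have "T \<circ> zpower T n = inv T ^^ nat (- (n + 1))"
      using 2 by (simp add: zpower_def * o_assoc del: nat_minus_as_int)
    also have "\<dots> = zpower T (n + 1)"
      using 2 by (auto simp: zpower_def)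
    finally show ?thesis ..
  qed
qed

lemma zpower_add:
  assumes "bij T"
  shows "zpower T (m + n) = zpower T m \<circ> zpower T n"
proof (induction m rule: int_induct[where k=0])
  case base
  then show ?case by simp
next
  case (step1 i)
  have "zpower T (i + 1 + n) = T \<circ> zpower T (i + n)"
    using zpower_Suc[OF assms, of "i + n"] by (simp add: algebra_simps)
  then show ?case using step1 zpower_Suc[OF assms, of i] by (simp add: o_assoc)
next
  case (step2 i)
  have inv: "inv T \<circ> T = id" using assms by (simp add: bij_is_inj)
  have pred: "zpower T (k - 1) = inv T \<circ> zpower T k" for k
    using zpower_Suc[OF assms, of "k - 1"] inv by (simp add: o_assoc)
  have "zpower T (i - 1 + n) = inv T \<circ> zpower T (i + n)"
    using pred[of "i + n"] by (simp add: algebra_simps)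
  then show ?case using step2 pred[of i] by (simp add: o_assoc)
qed

text \<open>Forward images for negative \<open>n\<close> are rewritten as preimages under powers of
  \<open>inv T\<close>. Preimages commute with all set operations, and their exponents add by
  \<open>zpower_add\<close>.\<close>

lemma iterated_preimage_eq:
  assumes "space M = UNIV" "bij T"
  shows "iterated_preimage M T n A = zpower T n -` A"
proof (cases "0 \<le> n")
  case False
  have "(T ^^ k) ` A = (inv T ^^ k) -` A" for k
  proof -
    have "inv (T ^^ k) = inv T ^^ k" using assms(2) by (simp add: inv_fn)
    moreover have "bij (T ^^ k)" using assms(2) by (simp add: bij_fn)
    ultimately show ?thesis by (metis bij_vimage_eq_inv_image bij_imp_bij_inv inv_inv_eq)
  qed
  with False show ?thesis by (simp add: iterated_preimage_def zpower_def)
qed (simp add: iterated_preimage_def zpower_def assms)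

lemma limsup_ennreal_eq_0_imp_tendsto_0:
  fixes u :: "nat \<Rightarrow> ennreal"
  assumes "\<not> limsup u > 0"
  shows "u \<longlonglongrightarrow> 0"
proof (rule order_tendstoI)
  fix a :: ennreal assume "0 < a"
  with assms have "limsup u < a" by (metis not_gr_zero)
  then show "\<forall>\<^sub>F n in sequentially. u n < a" by (rule Limsup_lessD)
qed simp

lemma emeasure_density_indicator:
  "E \<in> sets M \<Longrightarrow> A \<in> sets M \<Longrightarrow> emeasure (density M (indicator E)) A = emeasure M (A \<inter> E)"
  by (simp add: emeasure_density Int_commute flip: indicator_inter_arith)

text \<open>With \<open>space M = UNIV\<close> the bijection acts on the whole type, so
  \<open>inv T\<close> is its true inverse and preimages need no intersection with the space. The
  sequence space has this form.\<close>

locale invertible_system = sigma_finite_measure M for M :: "'a measure" +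
  fixes T :: "'a \<Rightarrow> 'a"
  assumes space_M [simp]: "space M = UNIV"
    and bij_T: "bij T"
    and measurable_T [measurable]: "T \<in> measurable M M"
    and measurable_inv_T [measurable]: "inv T \<in> measurable M M"
    and distr_T: "distr M M T = M"
begin

lemma measurable_zpower [measurable]: "zpower T n \<in> measurable M M"
proof -
  have "T ^^ k \<in> measurable M M" "inv T ^^ k \<in> measurable M M" for k
    by (induction k) (auto intro: measurable_comp measurable_T measurable_inv_T)
  then show ?thesis by (simp add: zpower_def)
qed

lemma sets_zpower [measurable (raw)]: "A \<in> sets M \<Longrightarrow> zpower T n -` A \<in> sets M"
  using measurable_sets[OF measurable_zpower] by simp

lemma emeasure_zpower [simp]:
  assumes "A \<in> sets M"
  shows "emeasure M (zpower T n -` A) = emeasure M A"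
proof -
  have T: "emeasure M (T -` B) = emeasure M B" if "B \<in> sets M" for B
    using that emeasure_distr[OF measurable_T that] by (simp add: distr_T)
  have step: "emeasure M (zpower T (n + 1) -` A) = emeasure M (zpower T n -` A)" for n
  proof -
    have "zpower T (n + 1) -` A = T -` (zpower T n -` A)"
      using zpower_add[OF bij_T, of n 1] by (auto simp: zpower_def)
    then show ?thesis using T sets_zpower[OF assms] by simp
  qed
  show ?thesis
  proof (induction n rule: int_induct[where k=0])
    case (step2 i)
    then show ?case using step[of "i - 1"] by simp
  qed (simp_all add: step)
qed

lemma vimage_zpower_add:
  "zpower T m -` (zpower T n -` A) = zpower T (n + m) -` A"
  by (auto simp: zpower_add[OF bij_T])

lemma iterated_preimage_zpower: "iterated_preimage M T n A = zpower T n -` A"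
  by (rule iterated_preimage_eq[OF space_M bij_T])

lemma wandering_iff:
  "wandering M T A \<longleftrightarrow> A \<in> sets M \<and> disjoint_family (\<lambda>n. zpower T n -` A)"
  unfolding wandering_def iterated_preimage_zpower ..

lemma invariant_zpower:
  assumes "T -` E = E"
  shows "zpower T n -` E = E"
proof (induction n rule: int_induct[where k=0])
  case (step1 i)
  then show ?case using zpower_add[OF bij_T, of i 1] assms by (auto simp: zpower_def)
next
  case (step2 i)
  have "zpower T 1 -` E = E" using assms by (simp add: zpower_def)
  then show ?case using step2 vimage_zpower_add[of "- 1" i E] vimage_zpower_add[of "-1" 1 E]
    by simp
qed simp

text \<open>The common power \<open>m\<close> is pulled out of the intersection, and its preimage
  preserves measure. Correlations therefore depend only on the time difference.\<close>

lemma emeasure_Int_zpower: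
  assumes [measurable]: "A \<in> sets M" "B \<in> sets M"
  shows "emeasure M (zpower T m -` A \<inter> zpower T n -` B) =
    emeasure M (A \<inter> zpower T (n - m) -` B)"
proof -
  have "zpower T m -` A \<inter> zpower T n -` B =
      zpower T m -` (A \<inter> zpower T (n - m) -` B)"
    by (simp add: vimage_zpower_add)
  then show ?thesis using emeasure_zpower[of "A \<inter> zpower T (n - m) -` B" m]
    by (simp only:) (simp add: sets_zpower)
qed

text \<open>Gives exact invariance, as \<open>restrict_to_invariant\<close> demands, rather than
  invariance modulo null sets. Being a countable union, it keeps measurability and null
  sets.\<close>

definition saturation :: "'a set \<Rightarrow> 'a set"
  where "saturation A = (\<Union>n. zpower T n -` A)"

lemma sets_saturation [measurable]: "A \<in> sets M \<Longrightarrow> saturation A \<in> sets M"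
  unfolding saturation_def by measurable

lemma saturation_superset: "A \<subseteq> saturation A"
  unfolding saturation_def by (rule subset_trans[OF _ UN_upper[of 0]]) auto

lemma saturation_invariant: "T -` saturation A = saturation A"
proof -
  have "T -` saturation A = zpower T 1 -` saturation A" by (simp add: zpower_def)
  also have "\<dots> = (\<Union>n. zpower T (n + 1) -` A)"
    by (simp add: saturation_def vimage_UN vimage_zpower_add)
  also have "\<dots> = saturation A"
    unfolding saturation_def
    by (intro set_eqI iffI; simp) (blast, metis diff_add_cancel)
  finally show ?thesis .
qed

text \<open>Restriction is expressed by an indicator density, not by a smaller space: all parts live
  on the same measurable space, stay in the locale and can be added up.\<close>

lemma restrict_to_invariant:
  assumes "E \<in> sets M" "T -` E = E"
  shows "invertible_system (density M (indicator E)) T"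
proof -
  let ?N = "density M (indicator E)"
  have em: "emeasure ?N A = emeasure M (A \<inter> E)" if "A \<in> sets M" for A
    using assms(1) that by (rule emeasure_density_indicator)
  have "distr ?N ?N T = ?N"
  proof (rule measure_eqI)
    fix A assume "A \<in> sets (distr ?N ?N T)"
    then have A [measurable]: "A \<in> sets M" by simp
    have [measurable]: "T \<in> measurable ?N ?N" by simp
    have "emeasure (distr ?N ?N T) A = emeasure M (T -` A \<inter> E)"
      using assms A by (simp add: emeasure_distr em measurable_sets[OF measurable_T, simplified])
    also have "\<dots> = emeasure M (zpower T 1 -` (A \<inter> E))"
      using assms(2) by (simp add: zpower_def)
    also have "\<dots> = emeasure ?N A" using assms A by (subst emeasure_zpower) (auto simp: em)
    finally show "emeasure (distr ?N ?N T) A = emeasure ?N A" .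
  qed simp
  moreover have "sigma_finite_measure ?N"
    using assms(1) by (subst sigma_finite_iff_density_finite) (auto simp: indicator_def)
  ultimately show ?thesis
    unfolding invertible_system_def invertible_system_axioms_def using bij_T by auto
qed

end

section \<open>Vanishing self-correlations imply vanishing correlations with sets of finite
  measure\<close>

text \<open>Induction on \<open>n\<close>: the set \<open>A n\<close> adds at least \<open>d\<close>
  and overlaps the earlier ones in at most \<open>n * e\<close>. Used to contradict
  \<open>real n * d\<close> exceeding the total mass.\<close>

lemma (in finite_measure) measure_UN_Bonferroni:
  assumes "\<And>i. i < n \<Longrightarrow> A i \<in> sets M"
    and "\<And>i. i < n \<Longrightarrow> d \<le> measure M (A i)"
    and "\<And>i j. i < j \<Longrightarrow> j < n \<Longrightarrow> measure M (A i \<inter> A j) \<le> e"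
    and "0 \<le> e"
  shows "real n * d \<le> measure M (\<Union>i<n. A i) + (real n)\<^sup>2 * e"
  using assms(1-3)
proof (induction n)
  case (Suc n)
  let ?U = "\<Union>i<n. A i"
  have U: "?U \<in> sets M" using Suc.prems by auto
  have "measure M (?U \<inter> A n) \<le> (\<Sum>i<n. measure M (A i \<inter> A n))"
  proof -
    have "?U \<inter> A n = (\<Union>i<n. A i \<inter> A n)" by auto
    moreover have "measure M (\<Union>i<n. A i \<inter> A n) \<le> (\<Sum>i<n. measure M (A i \<inter> A n))"
      using Suc.prems by (intro finite_measure_subadditive_finite) auto
    ultimately show ?thesis by simp
  qed
  also have "\<dots> \<le> real n * e"
    using Suc.prems(3) by (intro sum_bounded_above[where A="{..<n}", simplified]) auto
  finally have i: "measure M (?U \<inter> A n) \<le> real n * e" .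
  have "(\<Union>i<Suc n. A i) = ?U \<union> A n" by (auto simp: less_Suc_eq)
  moreover have "measure M (?U \<union> A n) + measure M (?U \<inter> A n) = measure M ?U + measure M (A n)"
    using finite_measure_Union'[OF U, of "A n"] finite_measure_Diff'[of "A n" "?U"] Suc.prems(1)[of n] U
    by (simp add: Int_commute)
  moreover have "real n * d \<le> measure M ?U + (real n)\<^sup>2 * e"
    using Suc.prems by (intro Suc.IH) auto
  moreover have "d \<le> measure M (A n)" using Suc.prems by auto
  \<comment> \<open>The step from \<open>n^2\<close> to \<open>(n + 1)^2\<close> provides
    \<open>2 * n * e + e\<close>, of which the overlap uses only \<open>n * e\<close>; this is the
    surplus.\<close>
  moreover have "0 \<le> real n * e + e" using assms(4) by simp
  ultimately show ?case using i by (simp add: algebra_simps power2_eq_square)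
qed simp

context invertible_system begin

text \<open>A statement about one set \<open>A\<close>, not about the system: hence it serves finite
  systems with \<open>B\<close> the whole space, and \<open>zero_type_part\<close>, where zero type
  is yet to be proved.\<close>

lemma mixing_tendsto:
  assumes A [measurable]: "A \<in> sets M" and B [measurable]: "B \<in> sets M"
    and fB: "emeasure M B < \<infinity>"
    and lim: "(\<lambda>k. emeasure M (A \<inter> zpower T (int k) -` A)) \<longlonglongrightarrow> 0"
  shows "(\<lambda>k. emeasure M (zpower T (int k) -` A \<inter> B)) \<longlonglongrightarrow> 0"
proof (rule limsup_ennreal_eq_0_imp_tendsto_0, rule notI)
  assume "0 < limsup (\<lambda>k. emeasure M (zpower T (int k) -` A \<inter> B))"
  then obtain c where c: "0 < c" "c < limsup (\<lambda>k. emeasure M (zpower T (int k) -` A \<inter> B))"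
    using dense by blast
  define N where "N = density M (indicator B)"
  have N: "emeasure N C = emeasure M (C \<inter> B)" if "C \<in> sets M" for C
    using that B by (simp add: N_def emeasure_density_indicator)
  interpret N: finite_measure N
    using fB N[of UNIV] sets.top[of M] by (intro finite_measureI) (auto simp: N_def emeasure_density_indicator)
  have setsN [simp]: "sets N = sets M" by (simp add: N_def)
  define b where "b = measure N UNIV"
  have "c \<le> emeasure N UNIV"
  proof (rule ccontr)
    assume "\<not> c \<le> emeasure N UNIV"
    then have "emeasure N UNIV < c" by simp
    moreover have "limsup (\<lambda>k. emeasure M (zpower T (int k) -` A \<inter> B)) \<le> emeasure N UNIV"
      using N[of UNIV] sets.top[of M]
      by (intro Limsup_bounded) (auto intro!: always_eventually emeasure_mono)
    ultimately show False using c(2) by (meson less_le_trans not_less_iff_gr_or_eq order.strict_trans)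
  qed
  then have cfin: "c < \<infinity>"
    by (metis N.emeasure_finite[of UNIV] infinity_ennreal_def le_less_trans less_top)
  define d where "d = enn2real c"
  have d: "0 < d" "ennreal d = c" using c(1) cfin by (auto simp: d_def enn2real_positive_iff)
  \<comment> \<open>The extra 1 pays for the Bonferroni error \<open>n^2 * e\<close>, which is 1 by
    the choice of \<open>e\<close>.\<close>
  obtain n :: nat where n: "real n * d > b + 1" using reals_Archimedean3[OF d(1)] by blast
  define e where "e = 1 / (real n)\<^sup>2"
  have "b \<ge> 0" by (simp add: b_def)
  then have n0: "n > 0" using n d by (cases n) auto
  then have e0: "e > 0" by (simp add: e_def)
  have "\<forall>\<^sub>F k in sequentially. emeasure M (A \<inter> zpower T (int k) -` A) < ennreal e"
    using lim e0 by (intro order_tendstoD) auto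
  then obtain K where K: "\<And>k. k \<ge> K \<Longrightarrow> emeasure M (A \<inter> zpower T (int k) -` A) < ennreal e"
    by (auto simp: eventually_sequentially)
  have freq: "\<exists>k\<ge>m. c < emeasure M (zpower T (int k) -` A \<inter> B)" for m
  proof (rule ccontr)
    assume "\<not> ?thesis"
    then have "\<forall>\<^sub>F k in sequentially. emeasure M (zpower T (int k) -` A \<inter> B) \<le> c"
      by (auto simp: eventually_sequentially not_less)
    then show False using Limsup_bounded c(2) by (metis leD)
  qed
  define g where "g m = (SOME k. k \<ge> m \<and> c < emeasure M (zpower T (int k) -` A \<inter> B))" for m
  have "g m \<ge> m \<and> c < emeasure M (zpower T (int (g m)) -` A \<inter> B)" for m
    unfolding g_def by (rule someI_ex) (rule freq)
  then have g: "g m \<ge> m" "c < emeasure M (zpower T (int (g m)) -` A \<inter> B)" for m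
    by blast+
  \<comment> \<open>Times at which the translate of \<open>A\<close> meets \<open>B\<close> in more
    than \<open>c\<close>, chosen with gaps larger than \<open>K\<close>, so that any two of the
    translates overlap in less than \<open>e\<close>.\<close>
  define h where "h i = ((\<lambda>m. g (m + K + 1)) ^^ i) 0" for i
  have hS: "h (Suc i) \<ge> h i + K + 1" for i using g(1)[of "h i + K + 1"] by (simp add: h_def)
  have hm: "h j \<ge> h i + K" if "i < j" for i j
    using that
  proof (induction j)
    case (Suc j)
    then show ?case using hS[of j] by (cases "i = j") auto
  qed simp
  \<comment> \<open>The index is \<open>Suc i\<close> because \<open>h 0 = 0\<close> is only the
    seed; the lower bound \<open>c\<close> is known for values of \<open>g\<close>.\<close>
  define C where "C i = zpower T (int (h (Suc i))) -` A" for i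
  have C [measurable]: "C i \<in> sets M" for i by (simp add: C_def sets_zpower)
  have "real n * d \<le> measure N (\<Union>i<n. C i) + (real n)\<^sup>2 * e"
  proof (rule N.measure_UN_Bonferroni)
    fix i
    have "c < emeasure N (C i)" using g(2) by (simp add: N C_def h_def sets_zpower)
    then show "d \<le> measure N (C i)"
      using d by (metis N.emeasure_eq_measure ennreal_le_iff less_imp_le measure_nonneg)
  next
    fix i j :: nat assume ij: "i < j"
    have le: "h (Suc i) + K \<le> h (Suc j)" using hm[of "Suc i" "Suc j"] ij by simp
    have "emeasure N (C i \<inter> C j) \<le> emeasure M (C i \<inter> C j)"
      by (subst N) (auto intro: emeasure_mono)
    also have "\<dots> = emeasure M (A \<inter> zpower T (int (h (Suc j) - h (Suc i))) -` A)"
      unfolding C_def using le by (subst emeasure_Int_zpower) (auto simp: of_nat_diff)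
    also have "\<dots> < ennreal e" using le by (intro K) simp
    finally show "measure N (C i \<inter> C j) \<le> e"
      using e0 by (simp add: N.emeasure_eq_measure ennreal_less_iff)
  qed (use e0 in auto)
  also have "measure N (\<Union>i<n. C i) \<le> b"
    unfolding b_def using sets.top[of N] by (intro N.finite_measure_mono) (auto simp: N_def)
  also have "(real n)\<^sup>2 * e = 1" using n0 by (simp add: e_def)
  finally show False using n by simp
qed

end

section \<open>Mutual singularity, and exhaustion of families of sets modulo null sets\<close>

definition mutually_singular :: "'a measure \<Rightarrow> 'a measure \<Rightarrow> bool"
  where "mutually_singular M N \<longleftrightarrow>
    (\<exists>E\<in>sets M. emeasure M (space M - E) = 0 \<and> emeasure N E = 0)"

lemma mutually_singular_sym:
  assumes "mutually_singular M N" "sets M = sets N"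
  shows "mutually_singular N M"
proof -
  from assms obtain E where "E \<in> sets M" "emeasure M (space M - E) = 0" "emeasure N E = 0"
    by (auto simp: mutually_singular_def)
  moreover from this(1) have "space N - (space N - E) = E" using sets.sets_into_space assms(2) by blast
  ultimately show ?thesis
    using assms(2) sets_eq_imp_space_eq[OF assms(2)] unfolding mutually_singular_def
    by (intro bexI[of _ "space N - E"]) auto
qed

text \<open>Lets an equivalent finite invariant measure stand in for a measure of type
  \<open>II_1\<close>: singularity is proved for the former and transferred.\<close>

lemma mutually_singular_absolutely_continuous:
  assumes "mutually_singular M N" "absolutely_continuous N K" "sets M = sets N"
  shows "mutually_singular M K"
  using assms unfolding mutually_singular_def absolutely_continuous_def null_sets_def by auto

text \<open>Pass to an equivalent finite measure \<open>N\<close> and maximize the measure of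
  countable unions. The supremum is attained, because countably many sequences merge into one;
  adding another member cannot increase it, so that member is covered up to a null set.\<close>

lemma (in sigma_finite_measure) countable_exhaustion:
  assumes "\<A> \<subseteq> sets M" "\<A> \<noteq> {}"
  obtains A :: "nat \<Rightarrow> 'a set"
  where "range A \<subseteq> \<A>" "\<And>B. B \<in> \<A> \<Longrightarrow> emeasure M (B - (\<Union>i. A i)) = 0"
proof -
  obtain h where h [measurable]: "h \<in> borel_measurable M" and fin: "integral\<^sup>N M h \<noteq> \<infinity>"
    and pos: "\<And>x. x \<in> space M \<Longrightarrow> 0 < h x \<and> h x < \<infinity>"
    using Ex_finite_integrable_function by auto
  define N where "N = density M h"
  interpret N: finite_measure N
    using fin by (intro finite_measureI) (simp add: N_def emeasure_density cong: nn_integral_cong)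
  have [simp]: "sets N = sets M" by (simp add: N_def)
  define \<F> where "\<F> = {f :: nat \<Rightarrow> 'a set. range f \<subseteq> \<A>}"
  define s where "s = (SUP f\<in>\<F>. emeasure N (\<Union>i. f i))"
  obtain B0 where B0: "B0 \<in> \<A>" using assms by auto
  then have "\<F> \<noteq> {}" by (auto simp: \<F>_def intro!: exI[of _ "\<lambda>_. B0"])
  then obtain g :: "nat \<Rightarrow> ennreal"
    where g: "range g \<subseteq> (\<lambda>f. emeasure N (\<Union>i. f i)) ` \<F>" and "s = Sup (range g)"
    unfolding s_def using ennreal_SUP_countable_SUP[of \<F> "\<lambda>f. emeasure N (\<Union>i. f i)"] by auto
  then have s: "s = (SUP n. g n)" by simp
  from g have "\<forall>n. \<exists>f\<in>\<F>. g n = emeasure N (\<Union>i. f i)" by auto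
  then obtain f where f: "\<And>n. f n \<in> \<F>" "\<And>n. g n = emeasure N (\<Union>i. f n i)" by metis
  \<comment> \<open>A near-optimal sequence for each \<open>n\<close>, all interleaved into a single
    sequence.\<close>
  define A where "A m = (case prod_decode m of (n, i) \<Rightarrow> f n i)" for m
  have rA: "range A \<subseteq> \<A>" using f(1) by (fastforce simp: A_def \<F>_def split: prod.split)
  then have Am: "A i \<in> sets M" for i using assms by auto
  then have U: "(\<Union>i. A i) \<in> sets M" by auto
  have "s \<le> emeasure N (\<Union>i. A i)"
    unfolding s
  proof (rule SUP_least)
    fix n
    have "f n i = A (prod_encode (n, i))" for i by (simp add: A_def)
    then have "(\<Union>i. f n i) \<subseteq> (\<Union>i. A i)" by auto
    then show "g n \<le> emeasure N (\<Union>i. A i)" using U by (simp add: f emeasure_mono)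
  qed
  have "emeasure M (B - (\<Union>i. A i)) = 0" if B: "B \<in> \<A>" for B
  proof -
    have Bm: "B \<in> sets M" using B assms by auto
    \<comment> \<open>The competitor: the optimal sequence with \<open>B\<close> put in front.
      Finiteness of \<open>N\<close> then allows the cancellation that makes the new part
      null.\<close>
    have "(case_nat B A) \<in> \<F>" using B rA by (auto simp: \<F>_def image_subset_iff split: nat.split)
    then have "emeasure N (\<Union>i. case_nat B A i) \<le> s" unfolding s_def by (rule SUP_upper)
    moreover have "(\<Union>i. case_nat B A i) = (\<Union>i. A i) \<union> (B - (\<Union>i. A i))"
    proof -
      have "(\<exists>i. x \<in> case_nat B A i) \<longleftrightarrow> x \<in> B \<or> (\<exists>i. x \<in> A i)" for x
        by (metis not0_implies_Suc old.nat.simps(4,5))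
      then show ?thesis by blast
    qed
    ultimately have "emeasure N (\<Union>i. A i) + emeasure N (B - (\<Union>i. A i)) \<le> emeasure N (\<Union>i. A i)"
      using \<open>s \<le> _\<close> U Bm by (subst plus_emeasure) auto
    then have "emeasure N (B - (\<Union>i. A i)) = 0"
      using ennreal_add_left_cancel_le[of "emeasure N (\<Union>i. A i)" "emeasure N (B - (\<Union>i. A i))" 0]
        N.emeasure_finite[of "\<Union>i. A i"] by simp
    then have "(\<integral>\<^sup>+x. h x * indicator (B - (\<Union>i. A i)) x \<partial>M) = 0"
      using U Bm by (simp add: N_def emeasure_density)
    then have "AE x in M. h x * indicator (B - (\<Union>i. A i)) x = 0"
      using U Bm by (subst (asm) nn_integral_0_iff_AE) auto
    then have "AE x in M. x \<notin> B - (\<Union>i. A i)"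
      using AE_space
    proof eventually_elim
      case (elim x)
      then show ?case using pos[of x] by (auto simp: indicator_def)
    qed
    then show ?thesis using U Bm AE_iff_null_sets[of "B - (\<Union>i. A i)" M] by auto
  qed
  with rA show ?thesis using that by blast
qed

text \<open>\<open>S\<close> carries the part of \<open>M\<close> singular to \<open>N\<close>.\<close>

lemma (in sigma_finite_measure) singular_part:
  assumes "sets N = sets M"
  obtains S where "S \<in> sets M" "emeasure N S = 0"
    "\<And>A. A \<in> sets M \<Longrightarrow> emeasure N A = 0 \<Longrightarrow> emeasure M (A - S) = 0"
proof -
  obtain A :: "nat \<Rightarrow> 'a set" where A: "range A \<subseteq> null_sets N"
    "\<And>B. B \<in> null_sets N \<Longrightarrow> emeasure M (B - (\<Union>i. A i)) = 0"
    by (rule countable_exhaustion[of "null_sets N"]) (use assms in \<open>auto simp: null_sets_def\<close>)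
  then have "(\<Union>i. A i) \<in> null_sets N" by (intro null_sets_UN) auto
  with A that assms show ?thesis by (auto simp: null_sets_def)
qed

section \<open>Null wandering sets, and singularity between the classes\<close>

context invertible_system begin

lemma null_saturation:
  assumes "A \<in> sets M" "emeasure M A = 0"
  shows "emeasure M (saturation A) = 0"
proof -
  have "(\<Union>n. zpower T n -` A) \<in> null_sets M"
    using assms by (intro null_sets_UN) (auto simp: null_sets_def sets_zpower)
  then show ?thesis by (simp add: saturation_def null_sets_def)
qed

lemma zero_type_iff:
  "zero_type M T \<longleftrightarrow> (\<forall>A\<in>sets M. emeasure M A < \<infinity> \<longrightarrow>
    (\<lambda>k. emeasure M (A \<inter> zpower T (int k) -` A)) \<longlonglongrightarrow> 0)"
proof -
  have "(\<lambda>k. emeasure M (A \<inter> zpower T (int k) -` A)) \<longlonglongrightarrow> 0"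
    if "A \<in> sets M" "\<not> 0 < emeasure M A" for A
  proof -
    have "emeasure M (A \<inter> zpower T (int k) -` A) \<le> emeasure M A" for k
      using that by (intro emeasure_mono) auto
    then have "(\<lambda>k. emeasure M (A \<inter> zpower T (int k) -` A)) = (\<lambda>_. 0)"
      using that by (auto simp: fun_eq_iff)
    then show ?thesis by simp
  qed
  then show ?thesis unfolding zero_type_def iterated_preimage_zpower by blast
qed

text \<open>Contrapositive form, with a limit in place of the limsup, so that
  \<open>mixing_tendsto\<close> and comparison of correlations apply directly.\<close>

lemma positive_type_iff:
  "positive_type M T \<longleftrightarrow> (\<forall>A\<in>sets M.
    (\<lambda>k. emeasure M (A \<inter> zpower T (int k) -` A)) \<longlonglongrightarrow> 0 \<longrightarrow> emeasure M A = 0)"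
proof -
  have "u \<longlonglongrightarrow> 0 \<longleftrightarrow> \<not> limsup u > 0" for u :: "nat \<Rightarrow> ennreal"
    using limsup_ennreal_eq_0_imp_tendsto_0 lim_imp_Limsup[of sequentially u 0] by auto
  then show ?thesis
    unfolding positive_type_def iterated_preimage_zpower by (metis not_gr_zero)
qed

text \<open>With \<open>B\<close> the whole space, \<open>mixing_tendsto\<close> sends the constant
  sequence \<open>emeasure M A\<close> to 0: a form of Poincare recurrence.\<close>

lemma finite_imp_positive_type:
  assumes "emeasure M UNIV < \<infinity>"
  shows "positive_type M T"
  unfolding positive_type_iff
proof (intro ballI impI)
  fix A assume A: "A \<in> sets M" "(\<lambda>k. emeasure M (A \<inter> zpower T (int k) -` A)) \<longlonglongrightarrow> 0"
  have "(\<lambda>k. emeasure M (zpower T (int k) -` A \<inter> UNIV)) \<longlonglongrightarrow> 0"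
    using A assms sets.top[of M] by (intro mixing_tendsto) auto
  then have "(\<lambda>k::nat. emeasure M A) \<longlonglongrightarrow> 0" using A by simp
  then show "emeasure M A = 0" by (simp add: LIMSEQ_const_iff)
qed

lemma conservativeI:
  assumes "\<And>W. wandering M T W \<Longrightarrow> emeasure M W = 0"
  shows "conservative M T"
  unfolding conservative_def measurable_union_def
  using assms by (intro exI[of _ "{}"]) auto

lemma conservative_wandering_null:
  assumes "conservative M T" "wandering M T W"
  shows "emeasure M W = 0"
proof -
  obtain D where D: "D \<in> sets M" "emeasure M (W - D) = 0" "emeasure M D = 0"
    using assms by (auto simp: conservative_def measurable_union_def)
  have W: "W \<in> sets M" using assms by (simp add: wandering_def)
  have "emeasure M W \<le> emeasure M ((W - D) \<union> D)" using W D by (intro emeasure_mono) auto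
  also have "\<dots> \<le> emeasure M (W - D) + emeasure M D" using W D by (intro emeasure_subadditive) auto
  finally show ?thesis using D by simp
qed

lemma positive_type_wandering_null:
  assumes "positive_type M T" "wandering M T W"
  shows "emeasure M W = 0"
proof -
  have W: "W \<in> sets M" "disjoint_family (\<lambda>n. zpower T n -` W)"
    using assms by (auto simp: wandering_iff)
  have "W \<inter> zpower T (int k) -` W = {}" if "k \<ge> 1" for k
    using disjoint_family_onD[OF W(2), of 0 "int k"] that by simp
  then have "\<forall>\<^sub>F k in sequentially. emeasure M (W \<inter> zpower T (int k) -` W) = 0"
    by (auto simp: eventually_sequentially intro!: exI[of _ 1])
  then show ?thesis using assms(1) W(1) unfolding positive_type_iff by (blast intro: tendsto_eventually)
qed

text \<open>Both disjuncts of \<open>type_II_1\<close> give an equivalent finite invariant measure,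
  as the zero measure serves for itself. Asking for a finite measure instead of a probability spares
  later proofs the case split.\<close>

lemma type_II_1_cases:
  assumes "type_II_1 M T"
  obtains \<nu> where "invertible_system \<nu> T" "positive_type \<nu> T" "sets \<nu> = sets M"
    "absolutely_continuous M \<nu>" "absolutely_continuous \<nu> M" "emeasure \<nu> UNIV < \<infinity>"
proof -
  note result = that
  have case_null: thesis if null: "emeasure M UNIV = 0"
  proof -
    have "emeasure M UNIV < \<infinity>" using null by simp
    with finite_imp_positive_type[OF this] show thesis
      by (intro result[of M] invertible_system_axioms) (auto simp: absolutely_continuous_def)
  qed
  show thesis
  proof (cases "emeasure M UNIV = 0")
    case False
    then obtain \<nu> where \<nu>: "invariant_probability M T \<nu>"
      "absolutely_continuous M \<nu>" "absolutely_continuous \<nu> M"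
      using assms by (auto simp: type_II_1_def)
    then have sets: "sets \<nu> = sets M" by (simp add: invariant_probability_def)
    interpret \<nu>: prob_space \<nu> using \<nu> by (simp add: invariant_probability_def)
    have sp: "space \<nu> = UNIV" using sets_eq_imp_space_eq[OF sets] by simp
    have [measurable_cong]: "sets \<nu> = sets M" by (rule sets)
    have inv: "distr \<nu> \<nu> T = \<nu>"
      using \<nu>(1) sets distr_cong[of \<nu> \<nu> \<nu> M T T] by (simp add: invariant_probability_def)
    interpret \<nu>: invertible_system \<nu> T
      by unfold_locales (use sp bij_T inv in \<open>auto\<close>)
    have "emeasure \<nu> UNIV < \<infinity>" using \<nu>.emeasure_space_1 sp by simp
    then show thesis
      using \<nu> sets by (intro result[of \<nu>] \<nu>.finite_imp_positive_type \<nu>.invertible_system_axioms)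
  qed (rule case_null)
qed

lemma type_II_1_wandering_null:
  assumes "type_II_1 M T" "wandering M T W"
  shows "emeasure M W = 0"
proof -
  obtain \<nu> where \<nu>: "invertible_system \<nu> T" "positive_type \<nu> T" "sets \<nu> = sets M"
    "absolutely_continuous \<nu> M"
    using type_II_1_cases[OF assms(1)] by blast
  interpret \<nu>: invertible_system \<nu> T by fact
  have "wandering \<nu> T W" using assms(2) \<nu>(3) by (simp add: wandering_iff \<nu>.wandering_iff)
  then have "emeasure \<nu> W = 0" by (rule \<nu>.positive_type_wandering_null[OF \<nu>(2)])
  then show ?thesis
    using \<nu> assms(2) by (auto simp: absolutely_continuous_def null_sets_def wandering_def)
qed

lemma wandering_exhaustion:
  obtains A :: "nat \<Rightarrow> 'a set"
  where "\<And>i. wandering M T (A i)" "\<And>W. wandering M T W \<Longrightarrow> emeasure M (W - (\<Union>i. A i)) = 0"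
proof -
  have "{A. wandering M T A} \<subseteq> sets M" by (auto simp: wandering_def)
  moreover have "{} \<in> {A. wandering M T A}" by (simp add: wandering_iff disjoint_family_on_def)
  ultimately show ?thesis using countable_exhaustion[of "{A. wandering M T A}"] that
    by (smt (verit) empty_iff mem_Collect_eq range_subsetD)
qed

text \<open>Wandering sets carry \<open>M\<close> and are null for \<open>N\<close>. The exhaustion
  is essential, since null sets of \<open>N\<close> only survive countable unions.\<close>

lemma dissipative_singular:
  assumes "dissipative M T" "sets N = sets M" "\<And>W. wandering M T W \<Longrightarrow> emeasure N W = 0"
  shows "mutually_singular M N"
proof -
  obtain A :: "nat \<Rightarrow> 'a set" where A: "\<And>i. wandering M T (A i)"
    "\<And>W. wandering M T W \<Longrightarrow> emeasure M (W - (\<Union>i. A i)) = 0"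
    using wandering_exhaustion by blast
  define E where "E = (\<Union>i. A i)"
  have E: "E \<in> sets M" using A by (auto simp: E_def wandering_def)
  obtain D where D: "D \<in> sets M" "emeasure M (UNIV - D) = 0" "emeasure M (D - E) = 0"
    using assms(1) A E by (auto simp: dissipative_def measurable_union_def E_def)
  have "emeasure M (UNIV - E) \<le> emeasure M ((UNIV - D) \<union> (D - E))"
    using E D sets.top[of M] by (intro emeasure_mono) auto
  also have "\<dots> \<le> emeasure M (UNIV - D) + emeasure M (D - E)"
    using E D sets.top[of M] by (intro emeasure_subadditive) auto
  finally have "emeasure M (UNIV - E) = 0" using D by simp
  moreover have "(\<Union>i. A i) \<in> null_sets N"
    using A assms by (intro null_sets_UN) (auto simp: null_sets_def wandering_def)
  ultimately show ?thesis using E by (auto simp: mutually_singular_def null_sets_def E_def)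
qed

text \<open>Where \<open>N\<close> has a bounded density with respect to \<open>M\<close>, its
  correlations are at most a multiple of those of \<open>M\<close> and so vanish in the limit;
  positive type makes such sets null for \<open>N\<close>. What remains is the singular
  part.\<close>

lemma zero_type_singular_positive_type:
  assumes "invertible_system N T" "sets N = sets M" "zero_type M T" "positive_type N T"
  shows "mutually_singular M N"
proof -
  interpret N: invertible_system N T by fact
  have sets [measurable_cong]: "sets N = sets M" by fact
  obtain S where S: "S \<in> sets M" "emeasure M S = 0"
    "\<And>A. A \<in> sets M \<Longrightarrow> emeasure M A = 0 \<Longrightarrow> emeasure N (A - S) = 0"
    using N.singular_part[of M] sets by metis
  define K where "K = density N (indicator (- S))"
  have S': "- S \<in> sets M" using S(1) sets.compl_sets[of S M] by (simp add: Compl_eq_Diff_UNIV)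
  have K: "emeasure K A = emeasure N (A - S)" if "A \<in> sets M" for A
    using S' that sets by (simp add: K_def emeasure_density_indicator Diff_eq)
  have setsK: "sets K = sets M" using sets by (simp add: K_def)
  have "absolutely_continuous M K"
    using S(3) K setsK by (auto simp: absolutely_continuous_def null_sets_def)
  then obtain f where f [measurable]: "f \<in> borel_measurable M" and fK: "density M f = K"
    using Radon_Nikodym[of K] setsK by auto
  interpret K: sigma_finite_measure K
    unfolding K_def using S' sets by (subst N.sigma_finite_iff_density_finite) (auto simp: indicator_def)
  have ffin: "AE x in M. f x \<noteq> \<infinity>"
    using K.sigma_finite_measure_axioms sigma_finite_iff_density_finite[OF f] by (simp add: fK)
  obtain C :: "nat \<Rightarrow> 'a set" where C: "range C \<subseteq> sets M" "(\<Union>i. C i) = UNIV" "\<And>i. emeasure M (C i) \<noteq> \<infinity>"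
    using sigma_finite by auto
  have [measurable]: "C i \<in> sets M" for i using C by auto
  \<comment> \<open>Finite \<open>M\<close>-measure for zero type, density at most \<open>n\<close>
    for the comparison, and disjointness from \<open>S\<close> so that \<open>N\<close> agrees with
    its absolutely continuous part \<open>K\<close>.\<close>
  define B where "B i n = (C i \<inter> {x. f x \<le> of_nat n}) - S" for i n :: nat
  have [measurable]: "{x. f x \<le> of_nat n} \<in> sets M" for n
    using measurable_sets[OF f, of "{..of_nat n}"] by (simp add: vimage_def)
  have B [measurable]: "B i n \<in> sets M" for i n unfolding B_def using S(1) by measurable
  have bound: "emeasure N A \<le> of_nat n * emeasure M A" if A: "A \<in> sets M" "A \<subseteq> B i n" for A i n
  proof -
    have "A - S = A" using A by (auto simp: B_def)
    then have "emeasure N A = emeasure K A" using K A by simp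
    also have "\<dots> = (\<integral>\<^sup>+x. f x * indicator A x \<partial>M)" using A by (simp add: emeasure_density flip: fK)
    also have "\<dots> \<le> (\<integral>\<^sup>+x. of_nat n * indicator A x \<partial>M)"
      using A by (intro nn_integral_mono) (auto simp: B_def indicator_def)
    also have "\<dots> = of_nat n * emeasure M A" using A by (simp add: nn_integral_cmult_indicator)
    finally show ?thesis .
  qed
  have null: "emeasure N (B i n) = 0" for i n
  proof -
    have "emeasure M (B i n) \<le> emeasure M (C i)" by (intro emeasure_mono) (auto simp: B_def)
    also have "\<dots> < \<infinity>" using C(3) by (simp add: less_top)
    finally have "(\<lambda>k. emeasure M (B i n \<inter> zpower T (int k) -` B i n)) \<longlonglongrightarrow> 0"
      using assms(3) B unfolding zero_type_iff by blast
    then have "(\<lambda>k. of_nat n * emeasure M (B i n \<inter> zpower T (int k) -` B i n)) \<longlonglongrightarrow> of_nat n * 0"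
      by (intro ennreal_tendsto_cmult) (auto simp: of_nat_less_top)
    then have "(\<lambda>k. of_nat n * emeasure M (B i n \<inter> zpower T (int k) -` B i n)) \<longlonglongrightarrow> 0" by simp
    \<comment> \<open>The intersection lies inside \<open>B i n\<close>, so \<open>bound\<close>
      applies to it although the translate of \<open>B i n\<close> may leave that set.\<close>
    then have "(\<lambda>k. emeasure N (B i n \<inter> zpower T (int k) -` B i n)) \<longlonglongrightarrow> 0"
      by (rule tendsto_sandwich[OF _ _ tendsto_const, rotated 2])
         (auto intro!: always_eventually bound[where i=i and n=n] sets.Int B sets_zpower)
    then show ?thesis using assms(4) B sets unfolding N.positive_type_iff by blast
  qed
  have "emeasure M {x. f x = \<infinity>} = 0"
    using ffin AE_iff_measurable[of "{x. f x = \<infinity>}" M "\<lambda>x. f x \<noteq> \<infinity>"] measurable_sets[OF f, of "{\<infinity>}"]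
    by (auto simp: vimage_def)
  then have inf: "emeasure N ({x. f x = \<infinity>} - S) = 0"
    using S(3) measurable_sets[OF f, of "{\<infinity>}"] by (auto simp: vimage_def)
  \<comment> \<open>Off \<open>S\<close>, only points with infinite density escape the sets
    \<open>B i n\<close>. They are null for \<open>M\<close>, hence null for \<open>N\<close>
    outside \<open>S\<close>.\<close>
  have "- S \<subseteq> (\<Union>i n. B i n) \<union> ({x. f x = \<infinity>} - S)"
  proof
    fix x assume "x \<in> - S"
    moreover obtain i where "x \<in> C i" using C(2) by blast
    moreover have "\<exists>n::nat. f x \<le> of_nat n" if "f x \<noteq> \<infinity>"
      using ennreal_Ex_less_of_nat[of "f x"] that by (auto simp: less_top intro: less_imp_le)
    ultimately show "x \<in> (\<Union>i n. B i n) \<union> ({x. f x = \<infinity>} - S)" by (auto simp: B_def)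
  qed
  moreover have "(\<Union>i n. B i n) \<union> ({x. f x = \<infinity>} - S) \<in> null_sets N"
    using null inf B sets S(1) measurable_sets[OF f, of "{\<infinity>}"]
    by (intro null_sets.Un null_sets_UN) (auto simp: null_sets_def vimage_def)
  ultimately have "emeasure N (- S) = 0"
    using null_sets_subset S' sets by (metis null_setsD1)
  moreover have "UNIV - (- S) = S" by auto
  ultimately show ?thesis unfolding mutually_singular_def using S S' by (intro bexI[of _ "- S"]) auto
qed

lemma zero_type_singular_type_II_1:
  assumes "invertible_system N T" "sets N = sets M" "zero_type M T" "type_II_1 N T"
  shows "mutually_singular M N"
proof -
  interpret N: invertible_system N T by fact
  obtain \<nu> where \<nu>: "invertible_system \<nu> T" "positive_type \<nu> T" "sets \<nu> = sets N"
    "absolutely_continuous \<nu> N"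
    using N.type_II_1_cases[OF assms(4)] by blast
  then have "mutually_singular M \<nu>"
    using zero_type_singular_positive_type[of \<nu>] assms by simp
  then show ?thesis using \<nu> assms by (auto intro: mutually_singular_absolutely_continuous)
qed

text \<open>The part of \<open>\<nu>\<close> absolutely continuous with respect to \<open>M\<close>,
  if nonzero, can be normalized to an invariant probability, which type
  \<open>II_\<infinity>\<close> forbids.\<close>

lemma type_II_infinity_singular_type_II_1:
  assumes "invertible_system N T" "sets N = sets M" "type_II_infinity M T" "type_II_1 N T"
  shows "mutually_singular M N"
proof -
  interpret N: invertible_system N T by fact
  obtain \<nu> where \<nu>: "invertible_system \<nu> T" "sets \<nu> = sets N"
    "absolutely_continuous \<nu> N" "emeasure \<nu> UNIV < \<infinity>"
    using N.type_II_1_cases[OF assms(4)] by blast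
  interpret \<nu>: invertible_system \<nu> T by fact
  have sets [measurable_cong]: "sets \<nu> = sets M" using \<nu> assms by simp
  obtain S0 where S0: "S0 \<in> sets M" "emeasure M S0 = 0"
    "\<And>A. A \<in> sets M \<Longrightarrow> emeasure M A = 0 \<Longrightarrow> emeasure \<nu> (A - S0) = 0"
    using \<nu>.singular_part[of M] sets by metis
  \<comment> \<open>Cutting \<open>\<nu>\<close> along \<open>S0\<close> need not give an invariant
    measure. The saturation is invariant and still null for \<open>M\<close>, so the part of
    \<open>\<nu>\<close> off it stays absolutely continuous.\<close>
  define S where "S = saturation S0"
  have Sm: "S \<in> sets M" and SM: "emeasure M S = 0" and Sinv: "T -` S = S"
    unfolding S_def using null_saturation S0 by (auto simp: saturation_invariant sets_saturation)
  have ac: "emeasure \<nu> (A - S) = 0" if "A \<in> sets M" "emeasure M A = 0" for A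
  proof -
    have "emeasure \<nu> (A - S) \<le> emeasure \<nu> (A - S0)"
      using saturation_superset[of S0] S0 that sets by (intro emeasure_mono) (auto simp: S_def)
    then show ?thesis using S0(3) that by simp
  qed
  have S': "- S \<in> sets M" using Sm sets.compl_sets[of S M] by (simp add: Compl_eq_Diff_UNIV)
  define K where "K = density \<nu> (indicator (- S))"
  have K: "emeasure K A = emeasure \<nu> (A - S)" if "A \<in> sets M" for A
    using S' that sets by (simp add: K_def emeasure_density_indicator Diff_eq)
  have setsK: "sets K = sets M" using sets by (simp add: K_def)
  interpret K: invertible_system K T
    unfolding K_def using S' Sinv sets by (intro \<nu>.restrict_to_invariant) auto
  have "emeasure \<nu> (- S) = 0"
  proof (rule ccontr)
    assume pos: "emeasure \<nu> (- S) \<noteq> 0"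
    define c where "c = emeasure \<nu> (- S)"
    have cfin: "c \<noteq> \<infinity>"
      using \<nu>(4) emeasure_mono[of "- S" UNIV \<nu>] sets.top[of \<nu>] by (auto simp: c_def top_unique)
    define \<kappa> where "\<kappa> = scale_measure (1 / c) K"
    have "emeasure K UNIV = c" using K[of UNIV] sets.top[of M] by (simp add: c_def Compl_eq_Diff_UNIV)
    then have "prob_space \<kappa>"
      using cfin pos
      by (intro prob_spaceI) (simp add: \<kappa>_def space_scale_measure c_def ennreal_divide_times ennreal_divide_self less_top[symmetric])
    moreover have T\<kappa>: "T \<in> measurable \<kappa> M"
    proof -
      have "sets \<kappa> = sets M" by (simp add: \<kappa>_def setsK)
      then show ?thesis using measurable_T measurable_cong_sets[of \<kappa> M M M] by blast
    qed
    moreover have "distr \<kappa> M T = \<kappa>"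
    proof (rule measure_eqI)
      fix A assume "A \<in> sets (distr \<kappa> M T)"
      then have A: "A \<in> sets M" by simp
      have "emeasure K (T -` A) = emeasure K A"
        using K.emeasure_zpower[of A 1] A setsK by (simp add: zpower_def)
      then show "emeasure (distr \<kappa> M T) A = emeasure \<kappa> A"
        using emeasure_distr[OF T\<kappa> A] setsK sets_eq_imp_space_eq[OF setsK]
        by (simp add: \<kappa>_def space_scale_measure)
    qed (simp add: \<kappa>_def setsK)
    ultimately have "invariant_probability M T \<kappa>"
      by (simp add: invariant_probability_def \<kappa>_def setsK)
    moreover have "absolutely_continuous M \<kappa>"
      using ac K by (auto simp: absolutely_continuous_def null_sets_def \<kappa>_def setsK)
    ultimately show False using assms(3) by (auto simp: type_II_infinity_def)
  qed
  moreover have "UNIV - (- S) = S" by auto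
  ultimately have "mutually_singular M \<nu>"
    unfolding mutually_singular_def using SM S' by (intro bexI[of _ "- S"]) auto
  then show ?thesis using \<nu> sets by (auto intro: mutually_singular_absolutely_continuous)
qed

end

section \<open>Splitting a system into four invariant parts\<close>

lemma type_II_infinity_mono:
  assumes "type_II_infinity M T" "absolutely_continuous M N" "sets N = sets M"
  shows "type_II_infinity N T"
proof -
  have "invariant_probability M T \<nu> \<and> absolutely_continuous M \<nu>"
    if "invariant_probability N T \<nu>" "absolutely_continuous N \<nu>" for \<nu>
    using that assms distr_cong[of \<nu> \<nu> M N T T]
    by (auto simp: invariant_probability_def absolutely_continuous_def)
  then show ?thesis using assms(1) by (auto simp: type_II_infinity_def)
qed

lemma emeasure_density_eq_0_iff:
  assumes [measurable]: "f \<in> borel_measurable M" "A \<in> sets M"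
  shows "emeasure (density M f) A = 0 \<longleftrightarrow> emeasure M (A \<inter> {x\<in>space M. f x > 0}) = 0"
proof -
  have "emeasure (density M f) A = 0 \<longleftrightarrow> (AE x in M. f x * indicator A x = 0)"
    by (simp add: emeasure_density nn_integral_0_iff_AE)
  also have "\<dots> \<longleftrightarrow> (AE x in M. x \<notin> A \<inter> {x\<in>space M. f x > 0})"
    by (intro AE_cong) (auto simp: indicator_def)
  also have "\<dots> \<longleftrightarrow> emeasure M (A \<inter> {x\<in>space M. f x > 0}) = 0"
    by (subst AE_iff_null_sets[symmetric]) (auto simp: null_sets_def)
  finally show ?thesis .
qed

context invertible_system begin

lemma sets_Compl [measurable]: "A \<in> sets M \<Longrightarrow> - A \<in> sets M"
  using sets.compl_sets[of A M] by (simp add: Compl_eq_Diff_UNIV)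

lemma wandering_zpower:
  assumes "wandering M T A"
  shows "wandering M T (zpower T n -` A)"
proof -
  have "disjoint_family (\<lambda>m. zpower T (n + m) -` A)"
    using assms unfolding wandering_iff disjoint_family_on_def by auto
  then show ?thesis using assms by (simp add: wandering_iff vimage_zpower_add sets_zpower)
qed

text \<open>Translates of wandering sets are wandering, so the saturation of a countable exhausting
  family is again a countable union of wandering sets. This gives minimality in
  \<open>measurable_union\<close> for the restricted measure.\<close>

lemma dissipative_part:
  obtains D where "D \<in> sets M" "T -` D = D" "dissipative (density M (indicator D)) T"
    "\<And>W. wandering M T W \<Longrightarrow> emeasure M (W - D) = 0"
proof -
  obtain A :: "nat \<Rightarrow> 'a set" where A: "\<And>i. wandering M T (A i)"
    "\<And>W. wandering M T W \<Longrightarrow> emeasure M (W - (\<Union>i. A i)) = 0"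
    using wandering_exhaustion by blast
  define D where "D = saturation (\<Union>i. A i)"
  have Am: "A i \<in> sets M" for i using A by (auto simp: wandering_def)
  then have D: "D \<in> sets M" "T -` D = D"
    unfolding D_def by (auto simp: saturation_invariant intro!: sets_saturation)
  have null: "emeasure M (W - D) = 0" if W: "wandering M T W" for W
  proof -
    have "emeasure M (W - D) \<le> emeasure M (W - (\<Union>i. A i))"
      using W Am saturation_superset[of "\<Union>i. A i"]
      by (intro emeasure_mono) (auto simp: D_def wandering_def)
    then show ?thesis using A(2)[OF W] by simp
  qed
  let ?N = "density M (indicator D)"
  interpret N: invertible_system ?N T by (rule restrict_to_invariant[OF D])
  have em: "emeasure ?N B = emeasure M (B \<inter> D)" if "B \<in> sets M" for B
    using D(1) that by (rule emeasure_density_indicator)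
  have "emeasure ?N (D - E) = 0"
    if E: "E \<in> sets M" "\<And>W. wandering ?N T W \<Longrightarrow> emeasure ?N (W - E) = 0" for E
  proof -
    have w: "wandering ?N T (zpower T n -` A i)" for n i
      using wandering_zpower[OF A(1)] by (simp add: wandering_iff N.wandering_iff)
    have "(\<Union>n i. zpower T n -` A i - E) \<in> null_sets ?N"
      using E w Am by (intro null_sets_UN) (auto simp: null_sets_def sets_zpower)
    moreover have "(\<Union>n i. zpower T n -` A i - E) = D - E"
      by (auto simp: D_def saturation_def)
    ultimately show ?thesis by (simp add: null_sets_def)
  qed
  moreover have "emeasure ?N (W - D) = 0" if "wandering ?N T W" for W
  proof -
    have "W \<in> sets M" using that by (simp add: wandering_def)
    then show ?thesis using D em[of "W - D"] by (simp add: Int_commute)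
  qed
  moreover have "emeasure ?N (space ?N - D) = 0" using D em[of "UNIV - D"] sets.top[of M] by (simp add: Int_commute)
  ultimately have "dissipative ?N T"
    unfolding dissipative_def measurable_union_def using D by (intro exI[of _ D]) auto
  with D null that show ?thesis by blast
qed

lemma invariant_probability_Radon_Nikodym:
  assumes "invariant_probability M T \<nu>" "absolutely_continuous M \<nu>"
  obtains f where "f \<in> borel_measurable M" "\<nu> = density M f"
  using Radon_Nikodym[OF assms(2)] assms(1) that by (auto simp: invariant_probability_def)

text \<open>A mixture of countably many absolutely continuous invariant probabilities, whose
  supports exhaust all such supports, is one invariant probability with the largest support. It is
  equivalent to \<open>M\<close> there, and nothing of its kind lives outside.\<close>

lemma type_II_1_part:
  obtains S where "S \<in> sets M" "T -` S = S" "type_II_1 (density M (indicator S)) T"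
    "type_II_infinity (density M (indicator (- S))) T"
proof -
  define \<P> where "\<P> = {f \<in> borel_measurable M. invariant_probability M T (density M f)}"
  have em: "emeasure (density M (indicator D)) B = emeasure M (B \<inter> D)"
    if "B \<in> sets M" "D \<in> sets M" for B D
    using that by (intro emeasure_density_indicator)
  have abs: "absolutely_continuous M (density M (indicator D))" if "D \<in> sets M" for D
    using that by (intro absolutely_continuousI_density) auto
  show ?thesis
  proof (cases "\<P> = {}")
    case True
    have "type_II_infinity M T"
      using True invariant_probability_Radon_Nikodym unfolding type_II_infinity_def \<P>_def
      by (metis (mono_tags, lifting) empty_iff mem_Collect_eq)
    then have "type_II_infinity (density M (indicator (- {}))) T"
      by (rule type_II_infinity_mono) (use sets.top[of M] abs[of "- {}"] in auto)
    \<comment> \<open>The \<open>II_1\<close> part is empty here; the zero measure is of type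
      \<open>II_1\<close> by convention.\<close>
    then show ?thesis by (intro that[of "{}"]) (use em[of UNIV "{}"] sets.top[of M] in \<open>auto simp: type_II_1_def\<close>)
  next
    case False
    define \<A> where "\<A> = (\<lambda>f. {x. f x > (0::ennreal)}) ` \<P>"
    have pos_sets: "{x. f x > (0::ennreal)} \<in> sets M" if "f \<in> borel_measurable M" for f
      using that measurable_sets[OF that, of "{0<..}"] by (simp add: vimage_def)
    then have "\<A> \<subseteq> sets M" by (auto simp: \<A>_def \<P>_def)
    with False obtain A :: "nat \<Rightarrow> 'a set" where A: "range A \<subseteq> \<A>"
      "\<And>B. B \<in> \<A> \<Longrightarrow> emeasure M (B - (\<Union>i. A i)) = 0"
      using countable_exhaustion[of \<A>] by (auto simp: \<A>_def)
    then have "\<forall>i. \<exists>f\<in>\<P>. A i = {x. f x > 0}"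
      by (simp add: \<A>_def image_subset_iff image_iff)
    then obtain g where g: "\<And>i. g i \<in> \<P>" "\<And>i. A i = {x. g i x > 0}" by metis
    have g_meas [measurable]: "g i \<in> borel_measurable M" for i using g by (auto simp: \<P>_def)
    \<comment> \<open>The weights sum to 1, so the mixture is a probability; they are all positive,
      so its support is the union of the supports.\<close>
    define f where "f x = (\<Sum>i. ennreal ((1 / 2) ^ Suc i) * g i x)" for x
    have f [measurable]: "f \<in> borel_measurable M" unfolding f_def by measurable
    define \<nu> where "\<nu> = density M f"
    have \<nu>: "emeasure \<nu> B = (\<Sum>i. ennreal ((1 / 2) ^ Suc i) * emeasure (density M (g i)) B)"
      if [measurable]: "B \<in> sets M" for B
    proof -
      have "emeasure \<nu> B = (\<integral>\<^sup>+x. (\<Sum>i. ennreal ((1 / 2) ^ Suc i) * (g i x * indicator B x)) \<partial>M)"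
        by (simp add: \<nu>_def emeasure_density f_def mult.assoc flip: ennreal_suminf_multc)
      also have "\<dots> = (\<Sum>i. ennreal ((1 / 2) ^ Suc i) * emeasure (density M (g i)) B)"
        by (subst nn_integral_suminf) (auto simp: nn_integral_cmult emeasure_density)
      finally show ?thesis .
    qed
    have gp: "prob_space (density M (g i))" and gi: "distr (density M (g i)) M T = density M (g i)" for i
      using g(1) by (auto simp: \<P>_def invariant_probability_def)
    have "(\<Sum>i. ennreal ((1 / 2) ^ Suc i)) = ennreal 1"
      by (rule suminf_ennreal_eq) (use power_half_series in auto)
    then have "emeasure \<nu> UNIV = 1"
      using prob_space.emeasure_space_1[OF gp] sets.top[of M] by (simp add: \<nu>)
    then have prob: "prob_space \<nu>" by (intro prob_spaceI) (simp add: \<nu>_def)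
    have setsN [simp, measurable_cong]: "sets \<nu> = sets M" by (simp add: \<nu>_def)
    have T\<nu>: "T \<in> measurable \<nu> M" "T \<in> measurable \<nu> \<nu>" "inv T \<in> measurable \<nu> \<nu>" by measurable
    have vT: "T -` B \<in> sets M" if "B \<in> sets M" for B
      using measurable_sets[OF measurable_T that] by simp
    have inv: "emeasure \<nu> (T -` B) = emeasure \<nu> B" if B: "B \<in> sets M" for B
    proof -
      have "emeasure (density M (g i)) (T -` B) = emeasure (density M (g i)) B" for i
        using arg_cong[OF gi[of i], of "\<lambda>N. emeasure N B"] B
        by (subst (asm) emeasure_distr) auto
      then show ?thesis using B vT by (simp add: \<nu>)
    qed
    have inv': "distr \<nu> M T = \<nu>"
    proof (rule measure_eqI)
      show "emeasure (distr \<nu> M T) A = emeasure \<nu> A" if "A \<in> sets (distr \<nu> M T)" for A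
        using that inv sets_eq_imp_space_eq[OF setsN] by (simp add: emeasure_distr[OF T\<nu>(1)])
    qed simp
    then have "distr \<nu> \<nu> T = \<nu>" using distr_cong[of \<nu> \<nu> \<nu> M T T] by simp
    then interpret \<nu>: invertible_system \<nu> T
      unfolding invertible_system_def invertible_system_axioms_def
      using T\<nu> bij_T prob prob_space_imp_sigma_finite by (auto simp: \<nu>_def)
    define S0 where "S0 = {x. f x > 0}"
    have S0 [measurable]: "S0 \<in> sets M" unfolding S0_def by (rule pos_sets[OF f])
    have S0_eq: "S0 = (\<Union>i. A i)"
    proof -
      have "f x = 0 \<longleftrightarrow> (\<forall>i. g i x = 0)" for x
        unfolding f_def by (subst suminf_eq_zero_iff) auto
      then show ?thesis by (auto simp: S0_def g(2)) (metis not_gr_zero)+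
    qed
    have null\<nu>: "emeasure \<nu> B = 0 \<longleftrightarrow> emeasure M (B \<inter> S0) = 0" if "B \<in> sets M" for B
      using emeasure_density_eq_0_iff[OF f that] by (simp add: \<nu>_def S0_def)
    define S where "S = saturation S0"
    have S: "S \<in> sets M" "T -` S = S" unfolding S_def by (auto simp: saturation_invariant)
    \<comment> \<open>The support \<open>S0\<close> is invariant only modulo null sets:
      \<open>- S0\<close> is null for \<open>\<nu>\<close>, hence so are its translates. Thus
      saturation adds only an \<open>M\<close>-null set.\<close>
    have "emeasure M (zpower T n -` S0 - S0) = 0" for n
    proof -
      have "emeasure \<nu> (zpower T (- n) -` (- S0)) = 0"
        using null\<nu>[of "- S0"] S0 by (subst \<nu>.emeasure_zpower) auto
      then have "emeasure M (zpower T (- n) -` (- S0) \<inter> zpower T 0 -` S0) = 0"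
        using null\<nu>[OF sets_zpower[OF sets_Compl[OF S0], of "- n"]] by simp
      then have "emeasure M (- S0 \<inter> zpower T n -` S0) = 0"
        using S0 by (subst (asm) emeasure_Int_zpower) (auto simp: sets_Compl)
      then show ?thesis by (simp add: Diff_eq Int_commute)
    qed
    then have "(\<Union>n. zpower T n -` S0 - S0) \<in> null_sets M"
      using S0 by (intro null_sets_UN) (auto simp: null_sets_def sets_zpower)
    moreover have "S - S0 = (\<Union>n. zpower T n -` S0 - S0)" by (auto simp: S_def saturation_def)
    ultimately have SS0: "S - S0 \<in> null_sets M" by simp
    have S0S: "S0 \<subseteq> S" unfolding S_def by (rule saturation_superset)
    have nullS: "emeasure M (B \<inter> S) = emeasure M (B \<inter> S0)" if "B \<in> sets M" for B
    proof (rule antisym)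
      have "emeasure M (B \<inter> S) \<le> emeasure M ((B \<inter> S0) \<union> (S - S0))"
        using that S by (intro emeasure_mono) auto
      also have "\<dots> = emeasure M (B \<inter> S0)" using SS0 that by (intro emeasure_Un_null_set) auto
      finally show "emeasure M (B \<inter> S) \<le> emeasure M (B \<inter> S0)" .
    qed (use that S S0S in \<open>auto intro!: emeasure_mono\<close>)
    let ?N = "density M (indicator S)"
    have "invariant_probability ?N T \<nu>"
      using prob inv' distr_cong[of \<nu> \<nu> ?N M T T] by (simp add: invariant_probability_def)
    moreover have "null_sets ?N = null_sets \<nu>"
      using null\<nu> nullS em[OF _ S(1)] by (auto simp: null_sets_def)
    ultimately have II1: "type_II_1 ?N T"
      unfolding type_II_1_def absolutely_continuous_def by blast
    have "type_II_infinity (density M (indicator (- S))) T"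
      unfolding type_II_infinity_def
    proof
      let ?K = "density M (indicator (- S))"
      assume "\<exists>\<kappa>. invariant_probability ?K T \<kappa> \<and> absolutely_continuous ?K \<kappa>"
      then obtain \<kappa> where \<kappa>: "invariant_probability ?K T \<kappa>" "absolutely_continuous ?K \<kappa>" by blast
      have \<kappa>M: "absolutely_continuous M \<kappa>"
        using abs[OF sets_Compl[OF S(1)]] \<kappa>(2) by (auto simp: absolutely_continuous_def)
      have ip: "invariant_probability M T \<kappa>"
        using \<kappa>(1) distr_cong[of \<kappa> \<kappa> M ?K T T] by (simp add: invariant_probability_def)
      obtain h where h [measurable]: "h \<in> borel_measurable M" and \<kappa>h: "\<kappa> = density M h"
        using invariant_probability_Radon_Nikodym[OF ip \<kappa>M] by blast
      \<comment> \<open>The support of \<open>\<kappa>\<close> is covered by the exhausting family,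
        so \<open>\<kappa>\<close> has no mass on \<open>- S\<close>; being absolutely continuous
        with respect to \<open>?K\<close>, it has none on \<open>S\<close> either.\<close>
      have "{x. h x > 0} \<in> \<A>" using ip by (auto simp: \<A>_def \<P>_def \<kappa>h)
      then have "emeasure M ({x. h x > 0} - S0) = 0" using A(2) S0_eq by simp
      moreover have "emeasure M (- S \<inter> {x. h x > 0}) \<le> emeasure M ({x. h x > 0} - S0)"
        using S0S pos_sets[OF h] S0 by (intro emeasure_mono) auto
      ultimately have "emeasure \<kappa> (- S) = 0"
        using S emeasure_density_eq_0_iff[OF h, of "- S"] by (simp add: \<kappa>h sets_Compl)
      moreover have "S \<in> null_sets ?K" using S em[of S "- S"] by (simp add: null_sets_def sets_Compl)
      then have "emeasure \<kappa> S = 0" using \<kappa>(2) by (auto simp: absolutely_continuous_def null_sets_def)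
      moreover have "emeasure \<kappa> (S \<union> - S) \<le> emeasure \<kappa> S + emeasure \<kappa> (- S)"
        using S by (intro emeasure_subadditive) (auto simp: \<kappa>h sets_Compl)
      ultimately have "emeasure \<kappa> (space \<kappa>) = 0" by (simp add: \<kappa>h)
      then show False
        using ip prob_space.emeasure_space_1 by (fastforce simp: invariant_probability_def)
    qed
    with II1 S that show ?thesis by blast
  qed
qed

text \<open>Exhaust the finite-measure sets with vanishing self-correlations and saturate. Inside,
  \<open>mixing_tendsto\<close> lets any finite-measure set inherit the property from the countable
  cover; outside, any set with the property would already have been absorbed.\<close>

lemma zero_type_part:
  obtains Z where "Z \<in> sets M" "T -` Z = Z" "zero_type (density M (indicator Z)) T"
    "positive_type (density M (indicator (- Z))) T"
proof -
  define \<A> where "\<A> = {A \<in> sets M. emeasure M A < \<infinity> \<and>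
    (\<lambda>k. emeasure M (A \<inter> zpower T (int k) -` A)) \<longlonglongrightarrow> 0}"
  have "\<A> \<subseteq> sets M" "{} \<in> \<A>" by (auto simp: \<A>_def)
  then obtain A :: "nat \<Rightarrow> 'a set" where A: "range A \<subseteq> \<A>"
    "\<And>B. B \<in> \<A> \<Longrightarrow> emeasure M (B - (\<Union>i. A i)) = 0"
    using countable_exhaustion[of \<A>] by (metis empty_iff)
  define Z where "Z = saturation (\<Union>i. A i)"
  have Am: "A i \<in> sets M" for i using A by (auto simp: \<A>_def)
  then have Z: "Z \<in> sets M" "T -` Z = Z"
    unfolding Z_def by (auto simp: saturation_invariant intro!: sets_saturation)
  have inv: "zpower T n -` Z = Z" for n by (rule invariant_zpower[OF Z(2)])
  have invC: "zpower T n -` (- Z) = - Z" for n using inv by (auto simp: vimage_Compl)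
  have em: "emeasure (density M (indicator D)) B = emeasure M (B \<inter> D)"
    if "B \<in> sets M" "D \<in> sets M" for B D
    using that by (intro emeasure_density_indicator)
  \<comment> \<open>All translates of all \<open>A i\<close> in one sequence. They belong to
    \<open>\<A>\<close> as well, because correlations are unchanged under translation.\<close>
  define C where "C j = (case from_nat j of (n, i) \<Rightarrow> zpower T n -` A i)" for j
  have C: "C j \<in> \<A>" for j
  proof -
    obtain n i where j: "from_nat j = (n :: int, i :: nat)" by fastforce
    have "A i \<in> \<A>" using A by auto
    then show ?thesis
      using emeasure_Int_zpower[OF Am Am, of n i "n + int _" i]
      by (simp add: \<A>_def C_def j vimage_zpower_add sets_zpower)
  qed
  have Cm [measurable]: "C j \<in> sets M" for j using C by (auto simp: \<A>_def)
  have ZC: "Z = (\<Union>j. C j)"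
  proof -
    have "zpower T n -` A i = C (to_nat (n, i))" for n i by (simp add: C_def)
    then have "Z \<subseteq> (\<Union>j. C j)" unfolding Z_def saturation_def vimage_UN by blast
    moreover have "C j \<subseteq> Z" for j by (auto simp: C_def Z_def saturation_def split: prod.splits)
    ultimately show ?thesis by blast
  qed
  let ?N = "density M (indicator Z)"
  interpret N: invertible_system ?N T by (rule restrict_to_invariant[OF Z])
  have "zero_type ?N T"
    unfolding N.zero_type_iff
  proof (intro ballI impI)
    fix B0 assume B0: "B0 \<in> sets ?N" "emeasure ?N B0 < \<infinity>"
    define B where "B = B0 \<inter> Z"
    have B [measurable]: "B \<in> sets M" and fB: "emeasure M B < \<infinity>" and BZ: "B \<subseteq> Z"
      using B0 Z em by (auto simp: B_def)
    have NB: "emeasure ?N (B0 \<inter> zpower T (int k) -` B0) =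
        emeasure M (B \<inter> zpower T (int k) -` B)" for k
    proof -
      have "B0 \<inter> zpower T (int k) -` B0 \<inter> Z = B \<inter> zpower T (int k) -` B"
        using inv[of "int k"] by (auto simp: B_def)
      then show ?thesis using B0 Z em sets_zpower[of B0 "int k"] by simp
    qed
    define u where "u k = emeasure M (B \<inter> zpower T (int k) -` B)" for k
    define R where "R m = B - (\<Union>j<m. C j)" for m
    have R [measurable]: "R m \<in> sets M" for m unfolding R_def by measurable
    \<comment> \<open>A point counted by \<open>u k\<close> is moved by the \<open>k\<close>-th
      power either into the remainder \<open>R m\<close> or into one of finitely many
      \<open>C j\<close>. The latter terms vanish as \<open>k\<close> grows; afterwards
      \<open>R m\<close> shrinks to the empty set as \<open>m\<close> grows, which uses that
      \<open>B\<close> has finite measure.\<close>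
    have bound: "u k \<le> emeasure M (R m) + (\<Sum>j<m. emeasure M (zpower T (int k) -` C j \<inter> B))" for k m
    proof -
      have "u k \<le> emeasure M (zpower T (int k) -` R m \<union> (\<Union>j<m. zpower T (int k) -` C j \<inter> B))"
        unfolding u_def using R Cm B
        by (intro emeasure_mono) (auto simp: R_def sets_zpower)
      also have "\<dots> \<le> emeasure M (zpower T (int k) -` R m) +
          emeasure M (\<Union>j<m. zpower T (int k) -` C j \<inter> B)"
        using R Cm B by (intro emeasure_subadditive) (auto simp: sets_zpower)
      also have "emeasure M (\<Union>j<m. zpower T (int k) -` C j \<inter> B) \<le>
          (\<Sum>j<m. emeasure M (zpower T (int k) -` C j \<inter> B))"
        using Cm B by (intro emeasure_subadditive_finite) (auto simp: sets_zpower)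
      finally show ?thesis by simp
    qed
    have "limsup u \<le> emeasure M (R m)" for m
    proof -
      have "(\<lambda>k. emeasure M (R m) + (\<Sum>j<m. emeasure M (zpower T (int k) -` C j \<inter> B)))
          \<longlonglongrightarrow> emeasure M (R m) + (\<Sum>j<m. 0)"
        using C fB B by (intro tendsto_add tendsto_const tendsto_sum mixing_tendsto) (auto simp: \<A>_def)
      then have "limsup (\<lambda>k. emeasure M (R m) + (\<Sum>j<m. emeasure M (zpower T (int k) -` C j \<inter> B)))
          = emeasure M (R m)"
        by (intro lim_imp_Limsup) auto
      then show ?thesis
        using Limsup_mono[of u _ sequentially] bound by (metis (no_types, lifting) always_eventually)
    qed
    moreover have "(\<lambda>m. emeasure M (R m)) \<longlonglongrightarrow> emeasure M (\<Inter>m. R m)"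
    proof (rule Lim_emeasure_decseq)
      show "decseq R" by (auto simp: decseq_def R_def)
      show "emeasure M (R m) \<noteq> \<infinity>" for m
        using fB emeasure_mono[of "R m" B M] B by (auto simp: R_def top_unique)
    qed (use R in auto)
    moreover have "(\<Inter>m. R m) = {}" using BZ unfolding ZC R_def by fastforce
    ultimately have "limsup u \<le> 0"
      using LIMSEQ_le_const by (metis (no_types, lifting) emeasure_empty)
    then have "u \<longlonglongrightarrow> 0" by (intro limsup_ennreal_eq_0_imp_tendsto_0) auto
    then show "(\<lambda>k. emeasure ?N (B0 \<inter> zpower T (int k) -` B0)) \<longlonglongrightarrow> 0"
      unfolding NB u_def .
  qed
  let ?K = "density M (indicator (- Z))"
  interpret K: invertible_system ?K T
    using Z by (intro restrict_to_invariant) (auto simp: sets_Compl)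
  have "positive_type ?K T"
    unfolding K.positive_type_iff
  proof (intro ballI impI)
    fix B0 assume B0: "B0 \<in> sets ?K"
      and lim: "(\<lambda>k. emeasure ?K (B0 \<inter> zpower T (int k) -` B0)) \<longlonglongrightarrow> 0"
    define B where "B = B0 - Z"
    have B: "B \<in> sets M" using B0 Z by (auto simp: B_def)
    have NB: "emeasure ?K (B0 \<inter> zpower T (int k) -` B0) =
        emeasure M (B \<inter> zpower T (int k) -` B)" for k
    proof -
      have "B0 \<inter> zpower T (int k) -` B0 \<inter> - Z = B \<inter> zpower T (int k) -` B"
        using invC[of "int k"] by (auto simp: B_def)
      then show ?thesis using B0 Z em sets_zpower[of B0 "int k"] by (simp add: sets_Compl)
    qed
    \<comment> \<open>Positive type concerns sets of infinite measure too, while members of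
      \<open>\<A>\<close> have finite measure. Cutting with \<open>F i\<close> only decreases
      correlations.\<close>
    obtain F :: "nat \<Rightarrow> 'a set" where F: "range F \<subseteq> sets M" "(\<Union>i. F i) = UNIV" "\<And>i. emeasure M (F i) \<noteq> \<infinity>"
      using sigma_finite by auto
    then have Fm: "F i \<in> sets M" for i by auto
    have "emeasure M (B \<inter> F i) = 0" for i
    proof -
      have "(\<lambda>k. emeasure M ((B \<inter> F i) \<inter> zpower T (int k) -` (B \<inter> F i))) \<longlonglongrightarrow> 0"
        using lim unfolding NB
        by (rule tendsto_sandwich[OF _ _ tendsto_const, rotated 2])
           (use B Fm in \<open>auto intro!: always_eventually emeasure_mono sets.Int sets_zpower\<close>)
      moreover have "emeasure M (B \<inter> F i) < \<infinity>"
        using F(3)[of i] emeasure_mono[of "B \<inter> F i" "F i" M] Fm by (auto simp: less_top[symmetric] top_unique)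
      ultimately have "B \<inter> F i \<in> \<A>" using B Fm by (auto simp: \<A>_def)
      then have "emeasure M (B \<inter> F i - (\<Union>i. A i)) = 0" by (rule A(2))
      moreover have "B \<inter> F i - (\<Union>i. A i) = B \<inter> F i"
        using saturation_superset[of "\<Union>i. A i"] by (auto simp: B_def Z_def)
      ultimately show ?thesis by simp
    qed
    then have "(\<Union>i. B \<inter> F i) \<in> null_sets M"
      using B Fm by (intro null_sets_UN) (auto simp: null_sets_def)
    moreover have "(\<Union>i. B \<inter> F i) = B" using F by auto
    ultimately show "emeasure ?K B0 = 0" using em[of B0 "- Z"] B0 Z by (auto simp: B_def Diff_eq sets_Compl)
  qed
  then show ?thesis by (rule that[OF Z \<open>zero_type ?N T\<close>])
qed

text \<open>The order of the cuts supplies the second property of each middle part. Wandering sets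
  lie in \<open>D\<close> up to null sets, which makes the zero-type part conservative; removing the
  \<open>II_1\<close> part before the zero-type part leaves \<open>w\<close> inside a system of type
  \<open>II_\<infinity>\<close>. The partition is stated by indicators, ready for splitting
  integrals.\<close>

theorem four_part_decomposition:
  obtains B m w n where
    "{B, m, w, n} \<subseteq> sets M" "T -` B = B" "T -` m = m" "T -` w = w" "T -` n = n"
    "\<And>x. indicator B x + indicator m x + indicator w x + indicator n x = (1 :: ennreal)"
    "dissipative (density M (indicator B)) T"
    "conservative (density M (indicator m)) T" "zero_type (density M (indicator m)) T"
    "type_II_infinity (density M (indicator w)) T" "positive_type (density M (indicator w)) T"
    "type_II_1 (density M (indicator n)) T"
proof -
  obtain D where D: "D \<in> sets M" "T -` D = D" "dissipative (density M (indicator D)) T"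
    "\<And>W. wandering M T W \<Longrightarrow> emeasure M (W - D) = 0"
    using dissipative_part by blast
  have D': "- D \<in> sets M" "T -` (- D) = - D" using D by (auto simp: sets_Compl)
  interpret C: invertible_system "density M (indicator (- D))" T
    by (rule restrict_to_invariant[OF D'])
  have dd: "density (density M (indicator A)) (indicator B) = density M (indicator (A \<inter> B))"
    if "A \<in> sets M" "B \<in> sets M" for A B
    using that by (subst density_density_eq) (auto simp flip: indicator_inter_arith)
  obtain S where S: "S \<in> sets M" "T -` S = S"
    "type_II_1 (density M (indicator (- D \<inter> S))) T"
    "type_II_infinity (density M (indicator (- D \<inter> - S))) T"
    using C.type_II_1_part D'(1) by (auto simp: dd sets_Compl)
  have R: "- D \<inter> - S \<in> sets M" "T -` (- D \<inter> - S) = - D \<inter> - S" using D S by (auto simp: sets_Compl)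
  interpret R: invertible_system "density M (indicator (- D \<inter> - S))" T
    by (rule restrict_to_invariant[OF R])
  obtain Z where Z: "Z \<in> sets M" "T -` Z = Z"
    "zero_type (density M (indicator (- D \<inter> - S \<inter> Z))) T"
    "positive_type (density M (indicator (- D \<inter> - S \<inter> - Z))) T"
    using R.zero_type_part R(1) by (auto simp: dd sets_Compl)
  define m where "m = - D \<inter> - S \<inter> Z"
  define w where "w = - D \<inter> - S \<inter> - Z"
  have m: "m \<in> sets M" "T -` m = m" and w: "w \<in> sets M" "T -` w = w"
    unfolding m_def w_def vimage_Int vimage_Compl
    using D(1) S(1) Z(1) by (auto simp: sets_Compl D(2) S(2) Z(2))
  interpret m: invertible_system "density M (indicator m)" T
    by (rule restrict_to_invariant[OF m])
  have "conservative (density M (indicator m)) T"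
  proof (rule m.conservativeI)
    fix W assume "wandering (density M (indicator m)) T W"
    then have W: "wandering M T W" by (simp add: wandering_iff m.wandering_iff)
    then have Wm: "W \<in> sets M" by (simp add: wandering_def)
    have "emeasure (density M (indicator m)) W \<le> emeasure M (W - D)"
      using m Wm D by (subst emeasure_density_indicator) (auto intro!: emeasure_mono simp: m_def)
    then show "emeasure (density M (indicator m)) W = 0" using D(4)[OF W] by simp
  qed
  moreover have "type_II_infinity (density M (indicator w)) T"
  proof (rule type_II_infinity_mono[OF S(4)])
    have "density M (indicator w) = density (density M (indicator (- D \<inter> - S))) (indicator (- Z))"
      using R Z by (subst dd) (auto simp: w_def sets_Compl)
    then show "absolutely_continuous (density M (indicator (- D \<inter> - S))) (density M (indicator w))"
      using Z by (auto intro!: absolutely_continuousI_density simp: sets_Compl)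
  qed simp
  moreover have "indicator D x + indicator m x + indicator w x + indicator (- D \<inter> S) x = (1 :: ennreal)" for x
    by (auto simp: indicator_def m_def w_def)
  ultimately show ?thesis
    using D S Z m w by (intro that[of D m w "- D \<inter> S"]) (auto simp: sets_Compl m_def w_def)
qed

end

section \<open>Characteristic functionals\<close>

lemma space_seq_space [simp]: "space seq_space = UNIV"
  by (simp add: space_PiM)

lemma sets_zero_seq: "{\<lambda>_. 0 :: real} \<in> sets seq_space"
proof -
  have "{\<lambda>_. 0 :: real} = {x \<in> space seq_space. \<forall>i::int. x i = 0}" by auto
  also have "\<dots> \<in> sets seq_space" by measurable
  finally show ?thesis .
qed

lemma pairing_eq_sum:
  assumes "finite S" "{i. a i \<noteq> 0} \<subseteq> S"
  shows "pairing a x = (\<Sum>i\<in>S. a i * x i)"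
  unfolding pairing_def using assms by (intro sum.mono_neutral_left) auto

lemma finite_seqs_add [intro]: "a \<in> finite_seqs \<Longrightarrow> b \<in> finite_seqs \<Longrightarrow> (\<lambda>i. a i + b i) \<in> finite_seqs"
  by (auto simp: finite_seqs_def intro: finite_subset[of _ "{i. a i \<noteq> 0} \<union> {i. b i \<noteq> 0}"])

lemma finite_seqs_scale [intro]: "a \<in> finite_seqs \<Longrightarrow> (\<lambda>i. c * a i) \<in> finite_seqs"
  by (auto simp: finite_seqs_def intro: finite_subset[of _ "{i. a i \<noteq> 0}"])

lemma finite_seqs_single [intro]: "(\<lambda>i. if i = j then t else 0) \<in> finite_seqs"
  by (auto simp: finite_seqs_def intro: finite_subset[of _ "{j}"])

lemma finite_seqs_zero [intro, simp]: "(\<lambda>_. 0) \<in> finite_seqs"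
  by (simp add: finite_seqs_def)

lemma pairing_zero [simp]: "pairing (\<lambda>_. 0) x = 0"
  by (simp add: pairing_def)

lemma pairing_zero_right [simp]: "pairing a (\<lambda>_. 0) = 0"
  by (simp add: pairing_def)

lemma pairing_single [simp]: "pairing (\<lambda>i. if i = j then t else 0) x = t * x j"
  by (subst pairing_eq_sum[of "{j}"]) auto

lemma pairing_add_left:
  assumes "a \<in> finite_seqs" "b \<in> finite_seqs"
  shows "pairing (\<lambda>i. a i + b i) x = pairing a x + pairing b x"
proof -
  let ?S = "{i. a i \<noteq> 0} \<union> {i. b i \<noteq> 0}"
  have "finite ?S" using assms by (simp add: finite_seqs_def)
  then show ?thesis
    by (subst (1 2 3) pairing_eq_sum[of ?S]) (auto simp: sum.distrib distrib_right)
qed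

lemma pairing_scale_left: "pairing (\<lambda>i. c * a i) x = c * pairing a x"
  by (cases "c = 0") (auto simp: pairing_def sum_distrib_left mult.assoc)

lemma pairing_add_right: "pairing a (\<lambda>i. x i + y i) = pairing a x + pairing a y"
  by (simp add: pairing_def sum.distrib distrib_left)

lemma pairing_minus_right: "pairing a (\<lambda>i. x i - y i) = pairing a x - pairing a y"
  by (simp add: pairing_def sum_subtractf right_diff_distrib)

lemma measurable_pairing [measurable]: "pairing a \<in> borel_measurable seq_space"
  unfolding pairing_def by measurable

lemma measurable_add_seq [measurable]:
  "(\<lambda>(x, y) i. x i + y i) \<in> measurable (seq_space \<Otimes>\<^sub>M seq_space) seq_space"
  unfolding case_prod_beta by (rule measurable_PiM_single') auto

definition seq_char :: "(int \<Rightarrow> real) measure \<Rightarrow> (int \<Rightarrow> real) \<Rightarrow> complex"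
  where "seq_char P a = (CLINT x|P. iexp (pairing a x))"

lemma integrable_iexp_mult:
  assumes "finite_measure M" "f \<in> borel_measurable M" "g \<in> borel_measurable M"
    and "\<And>x. cmod (g x) \<le> B"
  shows "integrable M (\<lambda>x. g x * iexp (f x))"
proof -
  interpret finite_measure M by fact
  have "(\<lambda>x. g x * iexp (f x)) \<in> borel_measurable M" using assms(2,3) by measurable
  then show ?thesis
    using assms(4) by (intro integrable_const_bound[of _ B]) (auto simp: norm_mult)
qed

text \<open>Evaluation at \<open>t = 0\<close> shows equal total masses; dividing by a positive mass
  reduces the claim to \<open>Levy_uniqueness\<close> for probabilities.\<close>

lemma finite_measure_eqI_iexp:
  fixes M N :: "real measure"
  assumes "finite_measure M" "finite_measure N" "sets M = sets borel" "sets N = sets borel"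
    and eq: "\<And>t. (CLINT x|M. iexp (t * x)) = (CLINT x|N. iexp (t * x))"
  shows "M = N"
proof -
  interpret M: finite_measure M by fact
  interpret N: finite_measure N by fact
  have spM: "space M = UNIV" and spN: "space N = UNIV"
    using assms sets_eq_imp_space_eq[of M borel] sets_eq_imp_space_eq[of N borel] by auto
  define c where "c = measure M UNIV"
  have c: "measure N UNIV = c"
    using eq[of 0] spM spN by (simp add: c_def scaleR_conv_of_real)
  show ?thesis
  proof (cases "c = 0")
    case True
    then have "emeasure M UNIV = 0" "emeasure N UNIV = 0"
      using c by (auto simp: M.emeasure_eq_measure N.emeasure_eq_measure c_def)
    then have "emeasure M A = 0" "emeasure N A = 0" for A
      using emeasure_space[of M A] emeasure_space[of N A] spM spN by auto
    then show ?thesis using assms by (intro measure_eqI) auto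
  next
    case False
    then have c0: "c > 0" using zero_less_measure_iff[of M UNIV] by (simp add: c_def)
    define K where "K L = scale_measure (ennreal (1 / c)) L" for L :: "real measure"
    have K: "real_distribution (K L)" "char (K L) t = (CLINT x|L. iexp (t * x)) / c"
      if L: "finite_measure L" "sets L = sets borel" "measure L UNIV = c" for L t
    proof -
      interpret L: finite_measure L by fact
      have sp: "space L = UNIV" using sets_eq_imp_space_eq[OF L(2)] by simp
      have "emeasure (K L) UNIV = 1"
        using c0 L(3) by (simp add: K_def L.emeasure_eq_measure flip: ennreal_mult)
      then have "prob_space (K L)"
        by (intro prob_spaceI) (simp add: K_def space_scale_measure sp)
      then show "real_distribution (K L)"
        using L(2) by (simp add: real_distribution_def real_distribution_axioms_def K_def space_scale_measure sp)
      have "K L = density L (\<lambda>_. ennreal (1 / c))"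
        unfolding K_def by (rule measure_eqI) (auto simp: emeasure_density nn_integral_cmult)
      then have "char (K L) t = (CLINT x|L. (1 / c) *\<^sub>R iexp (t * x))"
        unfolding char_def using c0 by (subst integral_density[symmetric]) (auto simp: L(2) measurable_cong_sets[OF L(2)])
      then show "char (K L) t = (CLINT x|L. iexp (t * x)) / c"
        by (simp add: scaleR_conv_of_real)
    qed
    have "K M = K N"
      using assms c by (intro Levy_uniqueness K) (auto simp: K c_def fun_eq_iff)
    then have "emeasure (K M) A = emeasure (K N) A" for A by simp
    then have "ennreal (1 / c) * emeasure M A = ennreal (1 / c) * emeasure N A" for A
      by (simp add: K_def)
    then have "emeasure M A = emeasure N A" for A
      using c0 by (metis ennreal_eq_0_iff ennreal_mult_cancel_left ennreal_neq_top not_less zero_less_divide_1_iff)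
    then show ?thesis using assms by (intro measure_eqI) auto
  qed
qed

text \<open>Induction over the coordinates: integrating against the nonnegative weights \<open>1\<close>,
  \<open>1 + cos \<langle>a, x\<rangle>\<close> and \<open>1 + sin \<langle>a, x\<rangle>\<close> reduces the step to one-dimensional uniqueness.\<close>

lemma seq_char_indicator_eq:
  assumes "finite_measure M" "finite_measure N"
    and [measurable_cong]: "sets M = sets seq_space" "sets N = sets seq_space"
    and eq: "\<And>a. a \<in> finite_seqs \<Longrightarrow> seq_char M a = seq_char N a"
    and "finite J" and A: "\<And>j. j \<in> J \<Longrightarrow> A j \<in> sets borel"
    and "a \<in> finite_seqs"
  shows "(CLINT x|M. complex_of_real (\<Prod>j\<in>J. indicator (A j) (x j)) * iexp (pairing a x)) =
    (CLINT x|N. complex_of_real (\<Prod>j\<in>J. indicator (A j) (x j)) * iexp (pairing a x))"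
  using assms(6,7,8)
proof (induction J arbitrary: a rule: finite_induct)
  case empty
  then show ?case using eq by (simp add: seq_char_def)
next
  case (insert i J)
  have [measurable]: "A j \<in> sets borel" if "j \<in> insert i J" for j using insert.prems that by auto
  define H where "H x = (\<Prod>j\<in>J. indicator (A j) (x j) :: real)" for x :: "int \<Rightarrow> real"
  have H01: "0 \<le> H x" "H x \<le> 1" for x unfolding H_def by (auto intro: prod_nonneg prod_le_1)
  have [measurable]: "H \<in> borel_measurable seq_space" unfolding H_def by measurable
  define E where "E L b = (CLINT x|L. complex_of_real (H x) * iexp (pairing b x))" for L b
  have IH: "E M b = E N b" if "b \<in> finite_seqs" for b
    using insert.IH[OF _ that] insert.prems by (simp add: E_def H_def)
  let ?e = "\<lambda>t j. if j = i then t else (0 :: real)"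
  have weighted: "(\<integral>x. H x * g x * indicator (A i) (x i) \<partial>M) = (\<integral>x. H x * g x * indicator (A i) (x i) \<partial>N)"
    if g [measurable]: "g \<in> borel_measurable seq_space" and g0: "\<And>x. 0 \<le> g x" and g2: "\<And>x. g x \<le> 2"
      and geq: "\<And>t. (CLINT x|M. complex_of_real (H x * g x) * iexp (t * x i)) =
        (CLINT x|N. complex_of_real (H x * g x) * iexp (t * x i))" for g
  proof -
    define K where "K L = distr (density L (\<lambda>x. ennreal (H x * g x))) borel (\<lambda>x. x i)" for L
    have Hg: "0 \<le> H x * g x" "H x * g x \<le> 2" for x
      using H01[of x] g0[of x] g2[of x] mult_mono[of "H x" 1 "g x" 2] by auto
    have K: "finite_measure (K L)" "(CLINT y|K L. iexp (t * y)) = (CLINT x|L. complex_of_real (H x * g x) * iexp (t * x i))"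
      "measure (K L) B = (\<integral>x. H x * g x * indicator B (x i) \<partial>L)"
      if L: "finite_measure L" and [measurable_cong]: "sets L = sets seq_space" and [measurable]: "B \<in> sets borel" for L t B
    proof -
      interpret L: finite_measure L by fact
      have "ennreal (H x * g x) \<le> 2" for x using Hg[of x] ennreal_leI[of "H x * g x" 2] by simp
      then have "emeasure (density L (\<lambda>x. ennreal (H x * g x))) (space L) \<le> (\<integral>\<^sup>+x. 2 \<partial>L)"
        by (subst emeasure_density) (auto intro!: nn_integral_mono simp: indicator_def simp del: nn_integral_const)
      also have "\<dots> < \<infinity>"
        using L.emeasure_eq_measure[of "space L"] by (simp add: ennreal_mult_less_top)
      finally have fin: "finite_measure (density L (\<lambda>x. ennreal (H x * g x)))"
        by (intro finite_measureI) auto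
      then show "finite_measure (K L)"
        unfolding K_def by (rule finite_measure.finite_measure_distr) measurable
      show "(CLINT y|K L. iexp (t * y)) = (CLINT x|L. complex_of_real (H x * g x) * iexp (t * x i))"
        unfolding K_def using Hg
        by (subst integral_distr, measurable, subst integral_density) (auto simp: scaleR_conv_of_real)
      have "measure (K L) B = (\<integral>y. indicator B y \<partial>K L)"
        by (simp add: K_def)
      also have "\<dots> = (\<integral>x. H x * g x * indicator B (x i) \<partial>L)"
        unfolding K_def using Hg
        by (subst integral_distr, measurable, subst integral_density) auto
      finally show "measure (K L) B = (\<integral>x. H x * g x * indicator B (x i) \<partial>L)" .
    qed
    have "K M = K N"
    proof (rule finite_measure_eqI_iexp)
      show "finite_measure (K M)" by (rule K(1)[OF assms(1,3) sets.empty_sets])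
      show "finite_measure (K N)" by (rule K(1)[OF assms(2,4) sets.empty_sets])
      show "(CLINT y|K M. iexp (t * y)) = (CLINT y|K N. iexp (t * y))" for t
        unfolding K(2)[OF assms(1,3) sets.empty_sets] K(2)[OF assms(2,4) sets.empty_sets] by (rule geq)
    qed (simp_all add: K_def)
    then show ?thesis using K(3)[OF assms(1,3), of "A i"] K(3)[OF assms(2,4), of "A i"] by simp
  qed
  have shift: "E L (\<lambda>j. b j + ?e t j) = (CLINT x|L. complex_of_real (H x) * iexp (pairing b x) * iexp (t * x i))"
    if "b \<in> finite_seqs" for L b t
    unfolding E_def using that
    by (simp add: pairing_add_left[OF that finite_seqs_single] exp_add distrib_left mult.assoc)
  have fs: "(\<lambda>j. b j + ?e t j) \<in> finite_seqs" if "b \<in> finite_seqs" for b t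
    using that by (intro finite_seqs_add finite_seqs_single)
  define ma where "ma = (\<lambda>j. - 1 * a j)"
  have a: "a \<in> finite_seqs" "ma \<in> finite_seqs" "(\<lambda>_. 0) \<in> finite_seqs"
    using insert.prems finite_seqs_scale[of a "- 1"] by (auto simp: ma_def)
  have pairing_ma: "pairing ma x = - pairing a x" for x
    unfolding ma_def pairing_scale_left by simp
  have int: "integrable L (\<lambda>x. complex_of_real (H x) * iexp (pairing b x) * iexp (t * x i))"
    if "finite_measure L" and [measurable_cong]: "sets L = sets seq_space" for L b t
    using that H01 by (intro integrable_iexp_mult[where B=1]) (auto simp: norm_mult)
  have base: "(CLINT x|M. complex_of_real (H x) * iexp (pairing b x) * iexp (t * x i)) =
      (CLINT x|N. complex_of_real (H x) * iexp (pairing b x) * iexp (t * x i))" if "b \<in> finite_seqs" for b t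
    using IH[OF fs[OF that]] shift[OF that] by simp
  \<comment> \<open>Each weight is a combination of \<open>iexp\<close> at the vectors
    \<open>0\<close>, \<open>a\<close> and \<open>ma\<close>, the negative of \<open>a\<close>. The
    extra factor in \<open>x i\<close> shifts these vectors in coordinate \<open>i\<close>, where
    the induction hypothesis is available.\<close>
  have combo: "(CLINT x|M. complex_of_real (H x * g x) * iexp (t * x i)) =
        (CLINT x|N. complex_of_real (H x * g x) * iexp (t * x i))"
    if g: "\<And>x. complex_of_real (g x) = 1 + u * iexp (pairing a x) + v * iexp (pairing ma x)" for g t u v
  proof -
    let ?f = "\<lambda>b x. complex_of_real (H x) * iexp (pairing b x) * iexp (t * x i)"
    have "(CLINT x|L. complex_of_real (H x * g x) * iexp (t * x i)) =
        (CLINT x|L. ?f (\<lambda>_. 0) x) + u * (CLINT x|L. ?f a x) + v * (CLINT x|L. ?f ma x)"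
      if L: "finite_measure L" "sets L = sets seq_space" for L
    proof -
      have "(CLINT x|L. complex_of_real (H x * g x) * iexp (t * x i)) =
          (CLINT x|L. ?f (\<lambda>_. 0) x + u * ?f a x + v * ?f ma x)"
        by (intro Bochner_Integration.integral_cong refl) (simp add: g algebra_simps)
      also have "\<dots> = (CLINT x|L. ?f (\<lambda>_. 0) x) + u * (CLINT x|L. ?f a x) + v * (CLINT x|L. ?f ma x)"
        using int[OF L, of "\<lambda>_. 0" t] int[OF L, of a t] int[OF L, of ma t]
        by (subst Bochner_Integration.integral_add, simp, simp)+ simp
      finally show ?thesis .
    qed
    then show ?thesis using assms a by (simp only: base)
  qed
  have e: "iexp (pairing ma x) = cis (- pairing a x)" "iexp (pairing a x) = cis (pairing a x)" for x
    by (simp_all add: pairing_ma cis_conv_exp)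
  have c1: "complex_of_real (1 + cos (pairing a x)) = 1 + (1/2) * iexp (pairing a x) + (1/2) * iexp (pairing ma x)" for x
    unfolding e by (simp add: complex_eq_iff)
  have c2: "complex_of_real (1 + sin (pairing a x)) = 1 + (- \<i>/2) * iexp (pairing a x) + (\<i>/2) * iexp (pairing ma x)" for x
    unfolding e by (simp add: complex_eq_iff)
  have c0: "complex_of_real 1 = 1 + 0 * iexp (pairing a x) + 0 * iexp (pairing ma x)" for x by simp
  let ?I = "\<lambda>x. indicator (A i) (x i) :: real"
  have w0: "(\<integral>x. H x * ?I x \<partial>M) = (\<integral>x. H x * ?I x \<partial>N)"
    using weighted[of "\<lambda>_. 1"] combo[OF c0] by simp
  have w1: "(\<integral>x. H x * (1 + cos (pairing a x)) * ?I x \<partial>M) = (\<integral>x. H x * (1 + cos (pairing a x)) * ?I x \<partial>N)"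
    using combo[OF c1] by (intro weighted) (auto simp: cos_ge_minus_one[of "pairing a _", THEN add_mono[OF order_refl[of 1]], simplified])
  have w2: "(\<integral>x. H x * (1 + sin (pairing a x)) * ?I x \<partial>M) = (\<integral>x. H x * (1 + sin (pairing a x)) * ?I x \<partial>N)"
    using combo[OF c2] by (intro weighted) (auto simp: sin_ge_minus_one[of "pairing a _", THEN add_mono[OF order_refl[of 1]], simplified])
  \<comment> \<open>The summand 1 had made the weights nonnegative; subtracting its contribution
    recovers the real and imaginary parts of the wanted integral.\<close>
  have key: "(CLINT x|L. complex_of_real (\<Prod>j\<in>insert i J. indicator (A j) (x j)) * iexp (pairing a x)) =
      complex_of_real ((\<integral>x. H x * (1 + cos (pairing a x)) * ?I x \<partial>L) - (\<integral>x. H x * ?I x \<partial>L))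
      + \<i> * complex_of_real ((\<integral>x. H x * (1 + sin (pairing a x)) * ?I x \<partial>L) - (\<integral>x. H x * ?I x \<partial>L))"
    if L: "finite_measure L" and [measurable_cong]: "sets L = sets seq_space" for L
  proof -
    interpret L: finite_measure L by fact
    have [measurable]: "?I \<in> borel_measurable seq_space" by measurable
    have b: "\<bar>H x * g * ?I x\<bar> \<le> 1" if "\<bar>g\<bar> \<le> 1" for x g
      using H01[of x] that mult_mono[of "H x" 1 "\<bar>g\<bar>" 1] by (auto simp: abs_mult indicator_def)
    have i0: "integrable L (\<lambda>x. H x * ?I x)"
      using b[of 1] by (intro L.integrable_const_bound[of _ 1]) auto
    have i1: "integrable L (\<lambda>x. H x * cos (pairing a x) * ?I x)"
      using b by (intro L.integrable_const_bound[of _ 1]) auto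
    have i2: "integrable L (\<lambda>x. H x * sin (pairing a x) * ?I x)"
      using b by (intro L.integrable_const_bound[of _ 1]) auto
    have d: "(\<integral>x. H x * (1 + g x) * ?I x \<partial>L) - (\<integral>x. H x * ?I x \<partial>L) = (\<integral>x. H x * g x * ?I x \<partial>L)"
      if "integrable L (\<lambda>x. H x * g x * ?I x)" for g
      using Bochner_Integration.integral_add[OF i0 that] by (simp add: algebra_simps)
    have "(CLINT x|L. complex_of_real (\<Prod>j\<in>insert i J. indicator (A j) (x j)) * iexp (pairing a x)) =
        (CLINT x|L. complex_of_real (H x * cos (pairing a x) * ?I x) + \<i> * complex_of_real (H x * sin (pairing a x) * ?I x))"
      using insert.hyps unfolding e
      by (intro Bochner_Integration.integral_cong refl) (simp add: H_def complex_eq_iff)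
    also have "\<dots> = complex_of_real (\<integral>x. H x * cos (pairing a x) * ?I x \<partial>L) + \<i> * complex_of_real (\<integral>x. H x * sin (pairing a x) * ?I x \<partial>L)"
      using i1 i2 by (subst Bochner_Integration.integral_add) (auto simp del: of_real_mult)
    finally show ?thesis unfolding d[OF i1] d[OF i2] .
  qed
  show ?case using key[of M] key[of N] assms w0 w1 w2 by simp
qed

text \<open>At the zero vector, \<open>seq_char_indicator_eq\<close> compares the two measures on
  cylinder sets, which determine a finite measure.\<close>

theorem finite_measure_eqI_seq_char:
  assumes "finite_measure M" "finite_measure N" "sets M = sets seq_space" "sets N = sets seq_space"
    and eq: "\<And>a. a \<in> finite_seqs \<Longrightarrow> seq_char M a = seq_char N a"
  shows "M = N"
proof (rule measure_eqI_PiM_infinite[OF assms(3,4)])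
  fix A :: "int \<Rightarrow> real set" and J :: "int set"
  assume J: "finite J" "J \<subseteq> UNIV" and A: "\<And>i. i \<in> J \<Longrightarrow> A i \<in> sets borel"
  let ?E = "prod_emb UNIV (\<lambda>_. borel) J (Pi\<^sub>E J A)"
  have E: "?E \<in> sets seq_space" using J A by (intro sets_PiM_I) auto
  have meas: "complex_of_real (measure L ?E) =
      (CLINT x|L. complex_of_real (\<Prod>j\<in>J. indicator (A j) (x j)) * iexp (pairing (\<lambda>_. 0) x))"
    if L: "finite_measure L" "sets L = sets seq_space" for L
  proof -
    have ind: "(\<Prod>j\<in>J. indicator (A j) (x j)) = (indicator ?E x :: real)" for x
      using J(1) by (auto simp: prod_emb_def indicator_def PiE_iff prod_zero_iff extensional_def restrict_def)
    have "(CLINT x|L. complex_of_real (indicator ?E x)) = complex_of_real (measure L ?E)"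
      using E L(2) by (simp add: Int_absorb1 sets_eq_imp_space_eq[OF L(2)])
    then show ?thesis by (simp add: ind)
  qed
  have "complex_of_real (measure M ?E) = complex_of_real (measure N ?E)"
    unfolding meas[OF assms(1,3)] meas[OF assms(2,4)]
    by (rule seq_char_indicator_eq[OF assms J(1) A finite_seqs_zero])
  then have "measure M ?E = measure N ?E" by simp
  then show "emeasure M ?E = emeasure N ?E"
    using assms by (simp add: finite_measure.emeasure_eq_measure)
qed fact

lemma seq_char_convolution:
  assumes "seq_law P" "seq_law P'"
  shows "seq_law (P \<^bold>* P')" "seq_char (P \<^bold>* P') a = seq_char P a * seq_char P' a"
proof -
  have [measurable_cong]: "sets P = sets seq_space" "sets P' = sets seq_space"
    using assms by (auto simp: seq_law_def)
  interpret p1: prob_space P using assms by (simp add: seq_law_def)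
  interpret p2: prob_space P' using assms by (simp add: seq_law_def)
  interpret pair_prob_space P P' ..
  show "seq_law (P \<^bold>* P')"
    unfolding seq_law_def seq_convolution_def by (auto intro!: prob_space_distr)
  have "seq_char (P \<^bold>* P') a = (CLINT z|P \<Otimes>\<^sub>M P'. iexp (pairing a (fst z)) * iexp (pairing a (snd z)))"
    unfolding seq_char_def seq_convolution_def
    by (subst integral_distr, measurable)
       (simp add: case_prod_beta pairing_add_right distrib_left exp_add)
  also have "\<dots> = (CLINT x|P. CLINT y|P'. iexp (pairing a x) * iexp (pairing a y))"
  proof -
    have "integrable (P \<Otimes>\<^sub>M P') (\<lambda>z. iexp (pairing a (fst z)) * iexp (pairing a (snd z)))"
      by (intro P.integrable_const_bound[of _ 1]) (auto simp: norm_mult)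
    then show ?thesis by (subst integral_fst'[symmetric]) auto
  qed
  also have "\<dots> = seq_char P a * seq_char P' a"
    by (simp add: seq_char_def)
  finally show "seq_char (P \<^bold>* P') a = seq_char P a * seq_char P' a" .
qed

lemma seq_char_convolution_power:
  assumes "seq_law P"
  shows "seq_law (convolution_power P k)" "seq_char (convolution_power P k) a = seq_char P a ^ k"
proof -
  have "seq_law (convolution_power P k) \<and> seq_char (convolution_power P k) a = seq_char P a ^ k"
  proof (induction k)
    case 0
    have "seq_law (return seq_space (\<lambda>_. 0))" by (simp add: seq_law_def prob_space_return)
    moreover have "seq_char (return seq_space (\<lambda>_. 0)) a = 1"
      unfolding seq_char_def by (subst integral_return) auto
    ultimately show ?case by simp
  next
    case (Suc k)
    then show ?case using seq_char_convolution assms by simp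
  qed
  then show "seq_law (convolution_power P k)" "seq_char (convolution_power P k) a = seq_char P a ^ k"
    by auto
qed

lemma seq_law_eqI:
  assumes "seq_law P" "seq_law P'" "\<And>a. a \<in> finite_seqs \<Longrightarrow> seq_char P a = seq_char P' a"
  shows "P = P'"
proof (rule finite_measure_eqI_seq_char)
  show "finite_measure P" "finite_measure P'"
    using assms by (auto simp: seq_law_def intro: prob_space.axioms(1))
qed (use assms in \<open>auto simp: seq_law_def\<close>)

section \<open>Levy exponents\<close>

definition levy_kernel :: "(int \<Rightarrow> real) \<Rightarrow> (int \<Rightarrow> real) \<Rightarrow> complex"
  where "levy_kernel a x = iexp (pairing a x) - 1 - \<i> * complex_of_real (pairing a (clip x))"

definition levy_exponent :: "(int \<Rightarrow> real) measure \<Rightarrow> (int \<Rightarrow> real) \<Rightarrow> complex"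
  where "levy_exponent Q a = (CLINT x|Q. levy_kernel a x)"

definition trunc_sq :: "int \<Rightarrow> (int \<Rightarrow> real) \<Rightarrow> real"
  where "trunc_sq i x = min ((x i)\<^sup>2) 1"

text \<open>Omits shift invariance, which is lost when \<open>Q\<close> is cut into finite pieces in
  \<open>exists_law_of_levy\<close>. Without it, integrability has to be demanded at every
  coordinate.\<close>

definition levy_integrable :: "(int \<Rightarrow> real) measure \<Rightarrow> bool"
  where "levy_integrable Q \<longleftrightarrow> sets Q = sets seq_space \<and>
    (\<forall>i. (\<integral>\<^sup>+x. ennreal (trunc_sq i x) \<partial>Q) < \<infinity>)"

lemma trunc_sq_bounds: "0 \<le> trunc_sq i x" "trunc_sq i x \<le> 1"
  by (auto simp: trunc_sq_def)

lemma measurable_trunc_sq [measurable]: "trunc_sq i \<in> borel_measurable seq_space"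
  unfolding trunc_sq_def by measurable

lemma clip_bound: "\<bar>clip x i\<bar> \<le> 1"
  by (auto simp: clip_def)

lemma clip_eq: "\<bar>x i\<bar> \<le> 1 \<Longrightarrow> clip x i = x i"
  by (auto simp: clip_def)

lemma measurable_clip [measurable]: "clip \<in> measurable seq_space seq_space"
proof (rule measurable_PiM_single')
  show "(\<lambda>x. clip x i) \<in> borel_measurable seq_space" for i
    unfolding clip_def by measurable
qed (auto simp: clip_def)

lemma measurable_levy_kernel [measurable]: "levy_kernel a \<in> borel_measurable seq_space"
  unfolding levy_kernel_def by measurable

lemma levy_kernel_zero [simp]: "levy_kernel (\<lambda>_. 0) x = 0"
  by (simp add: levy_kernel_def)

lemma abs_pairing_le:
  assumes "\<And>i. a i \<noteq> 0 \<Longrightarrow> \<bar>x i\<bar> \<le> c"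
  shows "\<bar>pairing a x\<bar> \<le> (\<Sum>i | a i \<noteq> 0. \<bar>a i\<bar>) * c"
proof -
  have "\<bar>pairing a x\<bar> \<le> (\<Sum>i | a i \<noteq> 0. \<bar>a i\<bar> * \<bar>x i\<bar>)"
    unfolding pairing_def by (rule order_trans[OF sum_abs]) (simp add: abs_mult)
  also have "\<dots> \<le> (\<Sum>i | a i \<noteq> 0. \<bar>a i\<bar> * c)"
    using assms by (intro sum_mono mult_left_mono) auto
  finally show ?thesis by (simp add: sum_distrib_right)
qed

text \<open>If all coordinates in the support of \<open>a\<close> have modulus at most 1, clipping
  does nothing there and the second-order Taylor bound applies. Otherwise the sum of truncated
  squares is at least 1 and the kernel is at most \<open>2 + A\<close>, where \<open>A\<close> is
  the sum of the \<open>\<bar>a i\<bar>\<close>. The factor \<open>(2 + A)^2\<close> covers both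
  cases.\<close>

lemma levy_kernel_bound:
  assumes "a \<in> finite_seqs"
  shows "cmod (levy_kernel a x) \<le>
    (2 + (\<Sum>i | a i \<noteq> 0. \<bar>a i\<bar>))\<^sup>2 * (\<Sum>i | a i \<noteq> 0. trunc_sq i x)"
proof -
  define A where "A = (\<Sum>i | a i \<noteq> 0. \<bar>a i\<bar>)"
  define s where "s = (\<Sum>i | a i \<noteq> 0. trunc_sq i x)"
  have fin: "finite {i. a i \<noteq> 0}" using assms by (simp add: finite_seqs_def)
  have A0: "0 \<le> A" unfolding A_def by (intro sum_nonneg) auto
  have s0: "0 \<le> s" unfolding s_def by (intro sum_nonneg trunc_sq_bounds)
  have si: "trunc_sq i x \<le> s" if "a i \<noteq> 0" for i
    unfolding s_def using fin that by (intro member_le_sum trunc_sq_bounds) auto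
  show ?thesis
  proof (cases "\<forall>i. a i \<noteq> 0 \<longrightarrow> \<bar>x i\<bar> \<le> 1")
    case True
    define u where "u = pairing a x"
    have "pairing a (clip x) = u"
      unfolding u_def pairing_def using True by (intro sum.cong) (auto simp: clip_eq)
    then have k: "levy_kernel a x = iexp u - (\<Sum>k\<le>1. (\<i> * u) ^ k / fact k)"
      by (simp add: levy_kernel_def u_def)
    have "\<bar>x i\<bar> \<le> sqrt s" if "a i \<noteq> 0" for i
    proof -
      have "(x i)\<^sup>2 \<le> 1" using True that by (simp add: abs_square_le_1)
      then have "(x i)\<^sup>2 \<le> s" using si[OF that] by (simp add: trunc_sq_def)
      then show ?thesis using real_le_rsqrt[of "\<bar>x i\<bar>" s] by simp
    qed
    then have "\<bar>u\<bar> \<le> A * sqrt s" unfolding u_def A_def by (rule abs_pairing_le)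
    then have "\<bar>u\<bar>\<^sup>2 \<le> (A * sqrt s)\<^sup>2" by (intro power_mono) auto
    then have u2: "\<bar>u\<bar>\<^sup>2 \<le> A\<^sup>2 * s" using s0 by (simp add: power_mult_distrib)
    have "cmod (levy_kernel a x) \<le> \<bar>u\<bar> ^ Suc 1 / fact (Suc 1)"
      unfolding k by (rule iexp_approx1)
    also have "\<dots> \<le> \<bar>u\<bar>\<^sup>2" by (simp add: power2_eq_square)
    also have "\<dots> \<le> (2 + A)\<^sup>2 * s"
      using u2 A0 s0 mult_right_mono[of "A\<^sup>2" "(2 + A)\<^sup>2" s] power_mono[of A "2 + A" 2] by linarith
    finally show ?thesis by (simp add: A_def s_def)
  next
    case False
    then obtain i where i: "a i \<noteq> 0" "\<bar>x i\<bar> > 1" by auto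
    then have "trunc_sq i x = 1"
      using abs_square_le_1[of "x i"] by (auto simp: trunc_sq_def min_def)
    then have s1: "1 \<le> s" using si[OF i(1)] by simp
    have "cmod (levy_kernel a x) \<le> cmod (iexp (pairing a x)) + 1 + \<bar>pairing a (clip x)\<bar>"
      unfolding levy_kernel_def by (rule order_trans[OF norm_triangle_ineq4] add_mono norm_triangle_ineq4)+ (auto simp: norm_mult intro: norm_triangle_ineq4[of _ 1, simplified])
    also have "\<dots> \<le> 2 + A"
      using abs_pairing_le[of a "clip x" 1] clip_bound by (simp add: A_def)
    also have "\<dots> \<le> (2 + A)\<^sup>2 * 1"
      using A0 by (simp add: power2_eq_square mult_le_cancel_left1 algebra_simps)
    also have "\<dots> \<le> (2 + A)\<^sup>2 * s" using s1 by (intro mult_left_mono) auto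
    finally show ?thesis by (simp add: A_def s_def)
  qed
qed

lemma integrable_trunc_sq:
  assumes "levy_integrable Q"
  shows "integrable Q (trunc_sq i)"
proof -
  have [measurable_cong]: "sets Q = sets seq_space" using assms by (simp add: levy_integrable_def)
  show ?thesis
    using assms trunc_sq_bounds(1) unfolding integrable_iff_bounded
    by (auto simp: levy_integrable_def)
qed

lemma integrable_levy_kernel:
  assumes "levy_integrable Q" "a \<in> finite_seqs"
  shows "integrable Q (levy_kernel a)"
proof -
  have [measurable_cong]: "sets Q = sets seq_space" using assms by (simp add: levy_integrable_def)
  let ?b = "\<lambda>x. (2 + (\<Sum>i | a i \<noteq> 0. \<bar>a i\<bar>))\<^sup>2 * (\<Sum>i | a i \<noteq> 0. trunc_sq i x)"
  have "integrable Q ?b"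
    using assms(1) by (intro integrable_mult_right Bochner_Integration.integrable_sum integrable_trunc_sq)
  then show ?thesis
  proof (rule Bochner_Integration.integrable_bound)
    show "AE x in Q. cmod (levy_kernel a x) \<le> norm (?b x)"
      using levy_kernel_bound[OF assms(2)]
      by (intro AE_I2) (simp add: abs_mult sum_nonneg trunc_sq_bounds)
  qed measurable
qed

lemma measurable_shift [measurable]: "shift \<in> measurable seq_space seq_space"
  unfolding shift_def by (rule measurable_PiM_single') auto

lemma levy_measure_integrable:
  assumes "levy_measure Q"
  shows "levy_integrable Q"
proof -
  have sets [measurable_cong]: "sets Q = sets seq_space" and inv: "distr Q seq_space shift = Q"
    using assms by (auto simp: levy_measure_def shift_invariant_def)
  have step: "(\<integral>\<^sup>+x. ennreal (trunc_sq (i + 1) x) \<partial>Q) = (\<integral>\<^sup>+x. ennreal (trunc_sq i x) \<partial>Q)" for i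
  proof -
    have "(\<integral>\<^sup>+x. ennreal (trunc_sq i x) \<partial>distr Q seq_space shift) =
        (\<integral>\<^sup>+x. ennreal (trunc_sq i (shift x)) \<partial>Q)"
      by (rule nn_integral_distr) measurable
    then show ?thesis unfolding inv by (simp add: trunc_sq_def shift_def)
  qed
  have "(\<integral>\<^sup>+x. ennreal (trunc_sq i x) \<partial>Q) < \<infinity>" for i
  proof (induction i rule: int_induct[where k=0])
    case base
    then show ?case using assms by (simp add: levy_measure_def trunc_sq_def)
  next
    case (step2 i)
    then show ?case using step[of "i - 1"] by simp
  qed (simp add: step)
  with sets show ?thesis by (simp add: levy_integrable_def)
qed

text \<open>Markov's inequality makes the sets \<open>1 / (n + 1) \<le> trunc_sq i x\<close> finite
  in measure; together with the zero sequence they cover the space.\<close>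

lemma levy_integrable_sigma_finite:
  assumes "levy_integrable Q" "emeasure Q {\<lambda>_. 0} = 0"
  shows "sigma_finite_measure Q"
proof
  have sets [measurable_cong]: "sets Q = sets seq_space" using assms by (simp add: levy_integrable_def)
  have sp [simp]: "space Q = UNIV" using sets_eq_imp_space_eq[OF sets] by simp
  define B where "B i n = {x. 1 / real (Suc n) \<le> trunc_sq i x}" for i :: int and n
  have "{x \<in> space seq_space. 1 / real (Suc n) \<le> trunc_sq i x} \<in> sets seq_space" for i n
    by measurable
  then have Bm: "B i n \<in> sets Q" for i n by (simp add: B_def sets)
  have Bf: "emeasure Q (B i n) \<noteq> \<infinity>" for i n
  proof -
    have "emeasure Q (B i n) = (\<integral>\<^sup>+x. indicator (B i n) x \<partial>Q)" using Bm by simp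
    also have "\<dots> \<le> (\<integral>\<^sup>+x. ennreal (real (Suc n)) * ennreal (trunc_sq i x) \<partial>Q)"
    proof (intro nn_integral_mono)
      fix x
      have "1 \<le> real (Suc n) * trunc_sq i x" if "x \<in> B i n"
        using that by (simp add: B_def field_simps)
      then show "indicator (B i n) x \<le> ennreal (real (Suc n)) * ennreal (trunc_sq i x)"
        using ennreal_leI[of 1 "real (Suc n) * trunc_sq i x"]
        by (auto simp: indicator_def ennreal_mult'[symmetric] trunc_sq_bounds simp del: of_nat_Suc)
    qed
    also have "\<dots> = ennreal (real (Suc n)) * (\<integral>\<^sup>+x. ennreal (trunc_sq i x) \<partial>Q)"
      by (rule nn_integral_cmult) measurable
    also have "\<dots> < \<infinity>" using assms(1) by (auto simp: levy_integrable_def ennreal_mult_less_top)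
    finally show ?thesis by simp
  qed
  let ?A = "insert {\<lambda>_. 0} (\<Union>i. range (B i))"
  have "x = (\<lambda>_. 0) \<or> (\<exists>i n. x \<in> B i n)" for x
  proof (cases "x = (\<lambda>_. 0)")
    case False
    then obtain i where "x i \<noteq> 0" by auto
    then have "0 < trunc_sq i x" by (simp add: trunc_sq_def)
    then obtain n where "inverse (real (Suc n)) < trunc_sq i x" using reals_Archimedean by blast
    then show ?thesis by (auto simp: B_def inverse_eq_divide intro: less_imp_le)
  qed simp
  note cover = this
  have "x \<in> \<Union>?A" for x
    using cover[of x]
  proof (elim disjE exE)
    fix i n assume "x \<in> B i n"
    moreover have "B i n \<in> ?A" by blast
    ultimately show ?thesis by (rule UnionI[rotated])
  qed simp
  then have UN: "\<Union>?A = UNIV" by blast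
  show "\<exists>A. countable A \<and> A \<subseteq> sets Q \<and> \<Union>A = space Q \<and> (\<forall>a\<in>A. emeasure Q a \<noteq> \<infinity>)"
  proof (intro exI[of _ ?A] conjI)
    show "?A \<subseteq> sets Q" using Bm sets_zero_seq sets by blast
    show "\<forall>a\<in>?A. emeasure Q a \<noteq> \<infinity>" using Bf assms(2) by auto
    show "countable ?A" by (intro countable_insert countable_UN countable_image) auto
  qed (simp only: UN sp)
qed

text \<open>Dominated convergence: factors in \<open>{0..1}\<close> only shrink the coefficients, so
  the kernel bound for \<open>a\<close> serves on the whole segment.\<close>

lemma levy_exponent_segment_continuous:
  assumes "levy_integrable Q" "a \<in> finite_seqs"
  shows "continuous_on {0..1} (\<lambda>t. levy_exponent Q (\<lambda>i. t * a i))"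
  unfolding continuous_on_sequentially
proof (intro allI ballI impI, unfold o_def)
  fix u :: "nat \<Rightarrow> real" and t assume t: "t \<in> {0..1}" and u: "(\<forall>n. u n \<in> {0..1}) \<and> u \<longlonglongrightarrow> t"
  have [measurable_cong]: "sets Q = sets seq_space" using assms by (simp add: levy_integrable_def)
  let ?b = "\<lambda>x. (2 + (\<Sum>i | a i \<noteq> 0. \<bar>a i\<bar>))\<^sup>2 * (\<Sum>i | a i \<noteq> 0. trunc_sq i x)"
  show "(\<lambda>n. levy_exponent Q (\<lambda>i. u n * a i)) \<longlonglongrightarrow> levy_exponent Q (\<lambda>i. t * a i)"
    unfolding levy_exponent_def
  proof (rule integral_dominated_convergence[where w="?b"])
    show "integrable Q ?b"
      using assms(1) by (intro integrable_mult_right Bochner_Integration.integrable_sum integrable_trunc_sq)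
    show "AE x in Q. (\<lambda>n. levy_kernel (\<lambda>i. u n * a i) x) \<longlonglongrightarrow> levy_kernel (\<lambda>i. t * a i) x"
      using u unfolding levy_kernel_def pairing_scale_left
      by (intro AE_I2 tendsto_intros) auto
    fix n
    have un: "0 \<le> u n" "u n \<le> 1" using u by auto
    show "AE x in Q. cmod (levy_kernel (\<lambda>i. u n * a i) x) \<le> ?b x"
    proof (intro AE_I2)
      fix x
      have sub: "{i. u n * a i \<noteq> 0} \<subseteq> {i. a i \<noteq> 0}" by auto
      have fin: "finite {i. a i \<noteq> 0}" using assms(2) by (simp add: finite_seqs_def)
      have "(\<Sum>i | u n * a i \<noteq> 0. \<bar>u n * a i\<bar>) \<le> (\<Sum>i | a i \<noteq> 0. \<bar>u n * a i\<bar>)"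
        by (rule sum_mono2[OF fin sub]) auto
      also have "\<dots> \<le> (\<Sum>i | a i \<noteq> 0. \<bar>a i\<bar>)"
        using un by (intro sum_mono) (simp add: abs_mult mult_left_le_one_le)
      finally have 1: "(\<Sum>i | u n * a i \<noteq> 0. \<bar>u n * a i\<bar>) \<le> (\<Sum>i | a i \<noteq> 0. \<bar>a i\<bar>)" .
      have 2: "(\<Sum>i | u n * a i \<noteq> 0. trunc_sq i x) \<le> (\<Sum>i | a i \<noteq> 0. trunc_sq i x)"
        by (rule sum_mono2[OF fin sub]) (rule trunc_sq_bounds)
      have "cmod (levy_kernel (\<lambda>i. u n * a i) x) \<le>
          (2 + (\<Sum>i | u n * a i \<noteq> 0. \<bar>u n * a i\<bar>))\<^sup>2 * (\<Sum>i | u n * a i \<noteq> 0. trunc_sq i x)"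
        by (rule levy_kernel_bound[OF finite_seqs_scale[OF assms(2)]])
      also have "\<dots> \<le> ?b x"
        using 1 2 by (intro mult_mono power_mono) (auto intro!: sum_nonneg add_nonneg_nonneg trunc_sq_bounds)
      finally show "cmod (levy_kernel (\<lambda>i. u n * a i) x) \<le> ?b x" .
    qed
  qed measurable
qed

text \<open>The exponents have no a priori preferred branch of the logarithm; continuity along the
  segment from \<open>0\<close> to \<open>a\<close> fixes it.\<close>

lemma levy_exponent_eqI:
  assumes "levy_integrable Q" "levy_integrable Q'" "a \<in> finite_seqs"
    and eq: "\<And>a. a \<in> finite_seqs \<Longrightarrow> exp (levy_exponent Q a) = exp (levy_exponent Q' a)"
  shows "levy_exponent Q a = levy_exponent Q' a"
proof -
  define D where "D t = levy_exponent Q (\<lambda>i. t * a i) - levy_exponent Q' (\<lambda>i. t * a i)" for t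
  have cont: "continuous_on {0..1} D"
    unfolding D_def using assms by (intro continuous_on_diff levy_exponent_segment_continuous)
  have exp1: "exp (D t) = 1" for t
    using eq[OF finite_seqs_scale[OF assms(3)], of t] by (simp add: D_def exp_diff)
  have "D constant_on {0..1}"
  proof (rule continuous_discrete_range_constant[OF _ cont])
    fix t :: real assume "t \<in> {0..1}"
    show "\<exists>e>0. \<forall>y. y \<in> {0..1} \<and> D y \<noteq> D t \<longrightarrow> e \<le> norm (D y - D t)"
    \<comment> \<open>Two values of \<open>D\<close> with the same exponential differ by an integer
      multiple of \<open>2 * pi * \<i>\<close>, so distinct values are at least this far
      apart.\<close>
    proof (intro exI[of _ "2 * pi"] conjI allI impI)
      fix y assume y: "y \<in> {0..1} \<and> D y \<noteq> D t"
      have "exp (D y - D t) = 1" using exp1 by (simp add: exp_diff)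
      then obtain n :: int where n: "Re (D y - D t) = 0" "Im (D y - D t) = of_int (2 * n) * pi"
        unfolding exp_eq_1 by auto
      have "n \<noteq> 0"
      proof
        assume "n = 0"
        with n have "D y - D t = 0" by (intro complex_eqI) auto
        with y show False by simp
      qed
      then have "1 \<le> \<bar>real_of_int n\<bar>" by linarith
      then have "2 * pi \<le> \<bar>Im (D y - D t)\<bar>" unfolding n by (simp add: abs_mult)
      also have "\<dots> \<le> norm (D y - D t)" by (rule abs_Im_le_cmod)
      finally show "2 * pi \<le> norm (D y - D t)" .
    qed simp
  qed simp
  then obtain c where "\<And>t. t \<in> {0..1} \<Longrightarrow> D t = c" unfolding constant_on_def by blast
  then have "D 1 = D 0" by simp
  then show ?thesis by (simp add: D_def levy_exponent_def)
qed

section \<open>Recovering a Levy measure from its exponent\<close>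

text \<open>Makes the weighted measure of \<open>levy_density_eqI\<close> finite. Small
  \<open>u\<close> are handled by the half-angle formula, large ones by the trivial bound 2.\<close>

lemma one_minus_cos_le: "1 - cos (s * u) \<le> (2 + s\<^sup>2) * min (u\<^sup>2) 1" for s u :: real
proof -
  have e: "2 * (s * u / 2) = s * u" by simp
  have c: "cos (s * u) = 1 - 2 * (sin (s * u / 2))\<^sup>2"
    using cos_double_sin[of "s * u / 2"] unfolding e .
  have "\<bar>sin (s * u / 2)\<bar>\<^sup>2 \<le> \<bar>s * u / 2\<bar>\<^sup>2"
    by (intro power_mono abs_sin_x_le_abs_x) auto
  also have "\<dots> = s\<^sup>2 * u\<^sup>2 / 4" by (simp add: power_mult_distrib power_divide)
  finally have "4 * (sin (s * u / 2))\<^sup>2 \<le> s\<^sup>2 * u\<^sup>2" by simp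
  moreover have "0 \<le> (sin (s * u / 2))\<^sup>2" by simp
  ultimately have 1: "1 - cos (s * u) \<le> s\<^sup>2 * u\<^sup>2" unfolding c by linarith
  have 2: "1 - cos (s * u) \<le> 2" using cos_ge_minus_one[of "s * u"] by linarith
  show ?thesis
  proof (cases "u\<^sup>2 \<le> 1")
    case True
    then show ?thesis using 1 mult_right_mono[of "s\<^sup>2" "2 + s\<^sup>2" "u\<^sup>2"] by (simp add: min_def)
  next
    case False
    then show ?thesis using 2 by (simp add: min_def add_increasing2)
  qed
qed

text \<open>Second differences of the exponent annihilate the compensator.\<close>

lemma levy_kernel_second_difference:
  assumes "a \<in> finite_seqs"
  shows "levy_kernel (\<lambda>i. a i + (if i = j then s else 0)) x
    + levy_kernel (\<lambda>i. a i + (if i = j then - s else 0)) x - 2 * levy_kernel a x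
    = - 2 * (complex_of_real (1 - cos (s * x j)) * iexp (pairing a x))"
proof -
  have e: "iexp (pairing a x + t * x j) = iexp (pairing a x) * cis (t * x j)" for t
    by (simp add: cis_conv_exp distrib_left exp_add)
  have c: "cis (s * x j) + cis (- s * x j) = complex_of_real (2 * cos (s * x j))"
    by (simp add: complex_eq_iff)
  define w where "w = iexp (pairing a x)"
  define v where "v = complex_of_real (pairing a (clip x))"
  have k1: "levy_kernel (\<lambda>i. a i + (if i = j then t else 0)) x =
      w * cis (t * x j) - 1 - \<i> * (v + complex_of_real t * complex_of_real (clip x j))" for t
    unfolding levy_kernel_def pairing_add_left[OF assms finite_seqs_single] pairing_single e
    by (simp add: w_def v_def)
  have k2: "levy_kernel a x = w - 1 - \<i> * v" by (simp add: levy_kernel_def w_def v_def)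
  have "levy_kernel (\<lambda>i. a i + (if i = j then s else 0)) x
      + levy_kernel (\<lambda>i. a i + (if i = j then - s else 0)) x - 2 * levy_kernel a x
      = w * (cis (s * x j) + cis (- s * x j)) - 2 * w"
    unfolding k1 k2 by (simp add: algebra_simps)
  also have "\<dots> = - 2 * (complex_of_real (1 - cos (s * x j)) * w)"
    unfolding c by (simp add: algebra_simps)
  finally show ?thesis unfolding w_def .
qed

lemma levy_density_eqI:
  assumes "levy_integrable Q" "levy_integrable Q'"
    and eq: "\<And>a. a \<in> finite_seqs \<Longrightarrow> levy_exponent Q a = levy_exponent Q' a"
  shows "density Q (\<lambda>x. ennreal (1 - cos (s * x j))) = density Q' (\<lambda>x. ennreal (1 - cos (s * x j)))"
proof -
  let ?K = "\<lambda>L. density L (\<lambda>x. ennreal (1 - cos (s * x j)))"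
  have K: "finite_measure (?K L)" "sets (?K L) = sets seq_space"
    "a \<in> finite_seqs \<Longrightarrow> seq_char (?K L) a = - (1 / 2) *
      (levy_exponent L (\<lambda>i. a i + (if i = j then s else 0)) +
       levy_exponent L (\<lambda>i. a i + (if i = j then - s else 0)) - 2 * levy_exponent L a)"
    if L: "levy_integrable L" for L a
  proof -
    have sets [measurable_cong]: "sets L = sets seq_space" using L by (simp add: levy_integrable_def)
    then show "sets (?K L) = sets seq_space" by simp
    have "emeasure (?K L) (space L) = (\<integral>\<^sup>+x. ennreal (1 - cos (s * x j)) \<partial>L)"
      by (subst emeasure_density) (auto intro!: nn_integral_cong)
    also have "\<dots> \<le> (\<integral>\<^sup>+x. ennreal (2 + s\<^sup>2) * ennreal (trunc_sq j x) \<partial>L)"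
    proof (intro nn_integral_mono)
      fix x
      have "ennreal (1 - cos (s * x j)) \<le> ennreal ((2 + s\<^sup>2) * trunc_sq j x)"
        unfolding trunc_sq_def by (intro ennreal_leI one_minus_cos_le)
      also have "\<dots> = ennreal (2 + s\<^sup>2) * ennreal (trunc_sq j x)"
        by (intro ennreal_mult trunc_sq_bounds) auto
      finally show "ennreal (1 - cos (s * x j)) \<le> ennreal (2 + s\<^sup>2) * ennreal (trunc_sq j x)" .
    qed
    also have "\<dots> = ennreal (2 + s\<^sup>2) * (\<integral>\<^sup>+x. ennreal (trunc_sq j x) \<partial>L)"
      by (rule nn_integral_cmult) measurable
    also have "\<dots> < \<infinity>" using L by (auto simp: levy_integrable_def ennreal_mult_less_top)
    finally show "finite_measure (?K L)" by (intro finite_measureI) auto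
    assume a: "a \<in> finite_seqs"
    let ?p = "\<lambda>i. a i + (if i = j then s else 0)" and ?m = "\<lambda>i. a i + (if i = j then - s else 0)"
    have i: "integrable L (levy_kernel ?p)" "integrable L (levy_kernel ?m)" "integrable L (levy_kernel a)"
      using L a by (auto intro!: integrable_levy_kernel finite_seqs_add[OF _ finite_seqs_single])
    have "seq_char (?K L) a = (CLINT x|L. complex_of_real (1 - cos (s * x j)) * iexp (pairing a x))"
      unfolding seq_char_def by (subst integral_density) (auto simp: scaleR_conv_of_real)
    also have "\<dots> = (CLINT x|L. - (1 / 2) * (levy_kernel ?p x + levy_kernel ?m x - 2 * levy_kernel a x))"
      unfolding levy_kernel_second_difference[OF a] by simp
    also have "\<dots> = - (1 / 2) * (levy_exponent L ?p + levy_exponent L ?m - 2 * levy_exponent L a)"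
      using i by (simp add: levy_exponent_def)
    finally show "seq_char (?K L) a = - (1 / 2) * (levy_exponent L ?p + levy_exponent L ?m - 2 * levy_exponent L a)" .
  qed
  show ?thesis
  proof (rule finite_measure_eqI_seq_char)
    fix a :: "int \<Rightarrow> real" assume a: "a \<in> finite_seqs"
    show "seq_char (?K Q) a = seq_char (?K Q') a"
      unfolding K(3)[OF assms(1) a] K(3)[OF assms(2) a]
        eq[OF a] eq[OF finite_seqs_add[OF a finite_seqs_single]] ..
  qed (rule K assms)+
qed

lemma cos_less_one: "0 < \<bar>u\<bar> \<Longrightarrow> \<bar>u\<bar> \<le> 1 \<Longrightarrow> cos u < 1" for u :: real
proof (rule ccontr)
  assume u: "0 < \<bar>u\<bar>" "\<bar>u\<bar> \<le> 1" "\<not> cos u < 1"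
  then have "cos u = 1" using cos_le_one[of u] by linarith
  then obtain n :: int where n: "u = real_of_int n * 2 * pi" using cos_one_2pi_int[of u] by blast
  with u have "n \<noteq> 0" by auto
  then have "1 \<le> \<bar>real_of_int n\<bar>" by linarith
  then have "2 * pi \<le> \<bar>u\<bar>" unfolding n by (simp add: abs_mult)
  then show False using u pi_gt3 by linarith
qed

text \<open>The weights \<open>1 - cos (s * x j)\<close> can be divided out where they are positive,
  which over all \<open>j\<close> and suitable \<open>s\<close> reaches everything except the zero
  sequence. The kernel vanishes at that sequence, so its mass has to be prescribed.\<close>

theorem levy_measure_eqI:
  assumes "levy_integrable Q" "levy_integrable Q'"
    and zero: "emeasure Q {\<lambda>_. 0} = 0" "emeasure Q' {\<lambda>_. 0} = 0"
    and eq: "\<And>a. a \<in> finite_seqs \<Longrightarrow> exp (levy_exponent Q a) = exp (levy_exponent Q' a)"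
  shows "Q = Q'"
proof -
  have sets [measurable_cong]: "sets Q = sets seq_space" "sets Q' = sets seq_space"
    using assms by (auto simp: levy_integrable_def)
  define E where "E j n = {x :: int \<Rightarrow> real. 0 < \<bar>x j\<bar> \<and> \<bar>x j\<bar> \<le> real (Suc n)}" for j n
  have "{x \<in> space seq_space. 0 < \<bar>x j\<bar> \<and> \<bar>x j\<bar> \<le> real (Suc n)} \<in> sets seq_space" for j n
    by measurable
  then have E [measurable]: "E j n \<in> sets seq_space" for j n by (simp add: E_def)
  have on_E: "emeasure Q (A \<inter> E j n) = emeasure Q' (A \<inter> E j n)"
    if [measurable]: "A \<in> sets seq_space" for A j n
  proof -
    \<comment> \<open>Scales \<open>x j\<close> into the unit interval on \<open>E j n\<close>,
      where \<open>cos\<close> equals 1 only at 0.\<close>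
    define s where "s = 1 / real (Suc n)"
    define g where "g x = 1 - cos (s * x j)" for x :: "int \<Rightarrow> real"
    have [measurable]: "g \<in> borel_measurable seq_space" unfolding g_def by measurable
    have gpos: "g x > 0" if "x \<in> E j n" for x
      using that cos_less_one[of "s * x j"] by (auto simp: g_def E_def s_def field_simps)
    define h where "h x = ennreal (1 / g x) * indicator (A \<inter> E j n) x" for x
    have h [measurable]: "h \<in> borel_measurable seq_space" unfolding h_def by measurable
    have gh: "ennreal (g x) * h x = indicator (A \<inter> E j n) x" for x
      using gpos[of x] by (auto simp: h_def indicator_def ennreal_mult'[symmetric])
    have "emeasure L (A \<inter> E j n) = (\<integral>\<^sup>+x. h x \<partial>density L (\<lambda>x. ennreal (g x)))"
      if [measurable_cong]: "sets L = sets seq_space" for L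
      by (subst nn_integral_density) (auto simp: gh)
    then show ?thesis
      using levy_density_eqI[OF assms(1,2) levy_exponent_eqI[OF assms(1,2) _ eq], of s j] sets
      by (simp add: g_def)
  qed
  \<comment> \<open>One enumeration of all pairs of a coordinate and a bound; made disjoint below so
    that the measures add up.\<close>
  define F where "F k = (case prod_decode k of (i, n) \<Rightarrow> E (int_decode i) n)" for k
  have F [measurable]: "F k \<in> sets seq_space" for k by (auto simp: F_def split: prod.split)
  have on_F: "emeasure Q (A \<inter> F k) = emeasure Q' (A \<inter> F k)" if "A \<in> sets seq_space" for A k
    using that by (auto simp: F_def on_E split: prod.split)
  have cover: "- {\<lambda>_. 0} \<subseteq> (\<Union>k. F k)"
  proof
    fix x :: "int \<Rightarrow> real" assume "x \<in> - {\<lambda>_. 0}"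
    then obtain j where j: "x j \<noteq> 0" by auto
    obtain n where "\<bar>x j\<bar> < real n" using reals_Archimedean2 by blast
    with j have "x \<in> E j n" by (simp add: E_def)
    then have "x \<in> F (prod_encode (int_encode j, n))" by (simp add: F_def)
    then show "x \<in> (\<Union>k. F k)" by blast
  qed
  show ?thesis
  proof (rule measure_eqI)
    fix A assume "A \<in> sets Q"
    then have A [measurable]: "A \<in> sets seq_space" by (simp add: sets)
    have dF [measurable]: "disjointed F k \<in> sets seq_space" for k
      using sets.range_disjointed_sets[of F seq_space] F by (auto simp: image_subset_iff)
    have "emeasure L A = (\<Sum>k. emeasure L (A \<inter> disjointed F k))"
      if L: "sets L = sets seq_space" "emeasure L {\<lambda>_. 0} = 0" for L
    proof -
      let ?U = "\<Union>k. A \<inter> disjointed F k"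
      have U: "?U = A \<inter> (\<Union>k. F k)" using UN_disjointed_eq[of F] by auto
      have z: "{\<lambda>_. 0} \<in> null_sets L" using L sets_zero_seq by (simp add: null_sets_def)
      have Um: "?U \<in> sets L" unfolding L(1) by measurable
      have "A \<subseteq> ?U \<union> {\<lambda>_. 0}" unfolding U using cover by blast
      then have "emeasure L A \<le> emeasure L (?U \<union> {\<lambda>_. 0})"
        using Um z by (intro emeasure_mono sets.Un) auto
      also have "\<dots> = emeasure L ?U"
        using Um z by (intro emeasure_Un_null_set)
      finally have "emeasure L A \<le> emeasure L ?U" .
      moreover have "emeasure L ?U \<le> emeasure L A"
        using A L(1) by (intro emeasure_mono) auto
      ultimately have "emeasure L A = emeasure L ?U" by (rule antisym)
      also have "\<dots> = (\<Sum>k. emeasure L (A \<inter> disjointed F k))"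
        using L disjoint_family_disjointed[of F]
        by (intro suminf_emeasure[symmetric]) (auto simp: disjoint_family_on_def)
      finally show ?thesis .
    qed
    moreover have "emeasure Q (A \<inter> disjointed F k) = emeasure Q' (A \<inter> disjointed F k)" for k
    proof -
      have "A \<inter> disjointed F k = (A \<inter> disjointed F k) \<inter> F k" by (auto simp: disjointed_def)
      then show ?thesis using on_F[of "A \<inter> disjointed F k" k] by simp
    qed
    ultimately show "emeasure Q A = emeasure Q' A" using sets zero by simp
  qed (simp add: sets)
qed

section \<open>Sums of measures and additivity of exponents\<close>

definition sum_measure :: "'a measure \<Rightarrow> 'a measure \<Rightarrow> 'a measure"
  where "sum_measure M N = measure_of (space M) (sets M) (\<lambda>A. emeasure M A + emeasure N A)"

lemma sets_sum_measure [simp, measurable_cong]: "sets (sum_measure M N) = sets M"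
  by (simp add: sum_measure_def)

lemma space_sum_measure [simp]: "space (sum_measure M N) = space M"
  by (simp add: sum_measure_def)

lemma emeasure_sum_measure:
  assumes "sets N = sets M" "A \<in> sets M"
  shows "emeasure (sum_measure M N) A = emeasure M A + emeasure N A"
proof (rule emeasure_measure_of[OF sum_measure_def])
  show "countably_additive (sets (sum_measure M N)) (\<lambda>A. emeasure M A + emeasure N A)"
  proof (rule countably_additiveI)
    fix A :: "nat \<Rightarrow> 'a set" assume "range A \<subseteq> sets (sum_measure M N)" "disjoint_family A"
    then show "(\<Sum>i. emeasure M (A i) + emeasure N (A i)) = emeasure M (\<Union>i. A i) + emeasure N (\<Union>i. A i)"
      using assms(1) by (simp add: suminf_add[symmetric] suminf_emeasure)
  qed
qed (use assms sets.sets_into_space in \<open>auto simp: positive_def\<close>)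

lemma nn_integral_sum_measure:
  assumes "sets N = sets M" "f \<in> borel_measurable M"
  shows "(\<integral>\<^sup>+x. f x \<partial>sum_measure M N) = (\<integral>\<^sup>+x. f x \<partial>M) + (\<integral>\<^sup>+x. f x \<partial>N)"
  using assms(2)
proof (induction f rule: borel_measurable_induct)
  case (cong f g)
  have sp: "space N = space M" by (rule sets_eq_imp_space_eq[OF assms(1)])
  have "integral\<^sup>N L f = integral\<^sup>N L g" if "space L = space M" for L
    using cong(3) that by (intro nn_integral_cong) simp
  then show ?case using cong(4) sp by simp
next
  case (set A)
  then show ?case using assms(1) by (simp add: emeasure_sum_measure)
next
  case (mult u c)
  then have [measurable]: "u \<in> borel_measurable N" using measurable_cong_sets[OF assms(1) refl] by blast
  from mult show ?case by (simp add: nn_integral_cmult distrib_left)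
next
  case (add u v)
  then have [measurable]: "u \<in> borel_measurable N" "v \<in> borel_measurable N"
    using measurable_cong_sets[OF assms(1) refl] by blast+
  from add show ?case by (simp add: nn_integral_add ac_simps)
next
  case (seq U)
  then have [measurable]: "U i \<in> borel_measurable N" for i
    using measurable_cong_sets[OF assms(1) refl] by blast
  have inc: "incseq (\<lambda>i. integral\<^sup>N L (U i))" for L
    using seq(3) by (auto simp: incseq_def le_fun_def intro!: nn_integral_mono)
  have "integral\<^sup>N L (\<Squnion> range U) = (SUP i. integral\<^sup>N L (U i))" if "\<And>i. U i \<in> borel_measurable L" for L
  proof -
    have "\<Squnion> range U = (\<lambda>x. SUP i. U i x)" by (auto simp: fun_eq_iff image_comp)
    then show ?thesis using nn_integral_monotone_convergence_SUP[OF seq(3) that] by simp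
  qed
  note lim = this
  have "integral\<^sup>N (sum_measure M N) (\<Squnion> range U) = (SUP i. integral\<^sup>N (sum_measure M N) (U i))"
    using seq(1) by (intro lim) auto
  also have "\<dots> = (SUP i. integral\<^sup>N M (U i)) + (SUP i. integral\<^sup>N N (U i))"
    by (subst ennreal_SUP_add[OF inc inc, symmetric]) (simp add: seq)
  also have "\<dots> = integral\<^sup>N M (\<Squnion> range U) + integral\<^sup>N N (\<Squnion> range U)"
    using seq(1) by (simp add: lim)
  finally show ?case .
qed

lemma integral_sum_measure:
  fixes f :: "'a \<Rightarrow> 'b :: {banach, second_countable_topology}"
  assumes sets: "sets N = sets M" and f: "integrable M f" "integrable N f"
  shows "(\<integral>x. f x \<partial>sum_measure M N) = (\<integral>x. f x \<partial>M) + (\<integral>x. f x \<partial>N)"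
proof -
  have meas: "f \<in> borel_measurable N \<longleftrightarrow> f \<in> borel_measurable M" for f :: "'a \<Rightarrow> 'b"
    using measurable_cong_sets[OF sets refl] by blast
  have int: "integrable (sum_measure M N) f \<longleftrightarrow> integrable M f \<and> integrable N f" for f :: "'a \<Rightarrow> 'b"
  proof (cases "f \<in> borel_measurable M")
    case True
    then have "(\<lambda>x. ennreal (norm (f x))) \<in> borel_measurable M" by measurable
    then show ?thesis
      using nn_integral_sum_measure[OF sets, of "\<lambda>x. ennreal (norm (f x))"] True meas
      by (auto simp: integrable_iff_bounded)
  next
    case False
    then show ?thesis using borel_measurable_integrable[of M f] borel_measurable_integrable[of "sum_measure M N" f] by auto
  qed
  have sp: "space N = space M" by (rule sets_eq_imp_space_eq[OF sets])
  have "integrable (sum_measure M N) f" using f int by blast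
  then show ?thesis
  proof (induction rule: integrable_induct)
    case (base A c)
    then have A: "A \<in> sets M" by simp
    then have "emeasure M A < \<infinity>" "emeasure N A < \<infinity>"
      using base(2) by (auto simp: emeasure_sum_measure[OF sets])
    then have "measure (sum_measure M N) A = measure M A + measure N A"
      by (simp add: measure_def emeasure_sum_measure[OF sets A] enn2real_plus)
    then show ?case
      using A sets.sets_into_space[OF A] sp base(2) sets \<open>emeasure M A < \<infinity>\<close> \<open>emeasure N A < \<infinity>\<close>
      by (simp add: Int_absorb2 scaleR_left_distrib)
  next
    case (add f g)
    then show ?case using int by simp
  next
    case (lim f s)
    have L: "(\<lambda>i. integral\<^sup>L L (s i)) \<longlonglongrightarrow> integral\<^sup>L L f"
      if "integrable L f" "\<And>i. integrable L (s i)" "space L = space M" for L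
      using that lim(2,3)
      \<comment> \<open>The factor 2 is the one with which \<open>integrable_induct\<close> bounds
        its approximating functions.\<close>
      by (intro integral_dominated_convergence[where w="\<lambda>x. 2 * norm (f x)"])
         (auto intro!: AE_I2 borel_measurable_integrable)
    have "(\<lambda>i. integral\<^sup>L (sum_measure M N) (s i)) \<longlonglongrightarrow> integral\<^sup>L M f + integral\<^sup>L N f"
      using lim int sp unfolding lim(5) by (intro tendsto_add L) auto
    moreover have "(\<lambda>i. integral\<^sup>L (sum_measure M N) (s i)) \<longlonglongrightarrow> integral\<^sup>L (sum_measure M N) f"
      using lim by (intro L) auto
    ultimately show ?case using LIMSEQ_unique by blast
  qed
qed

lemma levy_sum_measure:
  assumes "levy_integrable Q" "levy_integrable Q'"
  shows "levy_integrable (sum_measure Q Q')"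
    and "a \<in> finite_seqs \<Longrightarrow> levy_exponent (sum_measure Q Q') a = levy_exponent Q a + levy_exponent Q' a"
proof -
  have sets: "sets Q' = sets Q" "sets Q = sets seq_space" using assms by (auto simp: levy_integrable_def)
  have "(\<lambda>x. ennreal (trunc_sq i x)) \<in> borel_measurable Q" for i
    unfolding measurable_cong_sets[OF sets(2) refl] by measurable
  then show "levy_integrable (sum_measure Q Q')"
    using assms by (auto simp: levy_integrable_def nn_integral_sum_measure[OF sets(1)])
  show "levy_exponent (sum_measure Q Q') a = levy_exponent Q a + levy_exponent Q' a" if "a \<in> finite_seqs"
    unfolding levy_exponent_def using assms that
    by (intro integral_sum_measure[OF sets(1)] integrable_levy_kernel)
qed

section \<open>Existence of laws with a given Levy measure\<close>

lemma seq_char_finite_mass: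
  assumes "finite_measure \<kappa>" and sets [measurable_cong]: "sets \<kappa> = sets seq_space"
  shows "(CLINT x|\<kappa>. iexp (pairing a x) - 1) = seq_char \<kappa> a - measure \<kappa> UNIV"
proof -
  interpret finite_measure \<kappa> by fact
  have sp: "space \<kappa> = UNIV" using sets_eq_imp_space_eq[OF sets] by simp
  have "integrable \<kappa> (\<lambda>x. iexp (pairing a x))"
    by (intro integrable_const_bound[of _ 1]) auto
  then show ?thesis by (simp add: seq_char_def sp scaleR_conv_of_real)
qed

text \<open>The law of a sum of a Poisson number, with mean the total mass \<open>r\<close>, of
  independent jumps of law \<open>\<kappa>\<close> divided by \<open>r\<close>. It is built as a
  Poisson mixture of convolution powers, whose characteristic functional is an exponential
  series.\<close>

lemma exists_compound_poisson:
  assumes fin: "finite_measure \<kappa>" and sets [measurable_cong]: "sets \<kappa> = sets seq_space"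
  obtains P where "seq_law P" "\<And>a. seq_char P a = exp (CLINT x|\<kappa>. iexp (pairing a x) - 1)"
proof -
  interpret finite_measure \<kappa> by fact
  have sp: "space \<kappa> = UNIV" using sets_eq_imp_space_eq[OF sets] by simp
  define r where "r = measure \<kappa> UNIV"
  show thesis
  proof (cases "r = 0")
    \<comment> \<open>Without mass there is no jump law to normalize; the process is identically
      zero.\<close>
    case True
    then have "emeasure \<kappa> (space \<kappa>) = 0" by (simp add: emeasure_eq_measure sp r_def)
    then have "AE x in \<kappa>. iexp (pairing a x) - 1 = 0" for a
      by (intro AE_I[of _ _ "space \<kappa>"]) auto
    then have "(CLINT x|\<kappa>. iexp (pairing a x) - 1) = 0" for a
      by (rule integral_eq_zero_AE)
    then show thesis
      using that[of "return seq_space (\<lambda>_. 0)"]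
      by (auto simp: seq_law_def prob_space_return seq_char_def integral_return)
  next
    case False
    then have r: "0 < r" using zero_less_measure_iff[of \<kappa> UNIV] by (simp add: r_def)
    define R where "R = density \<kappa> (\<lambda>_. ennreal (1 / r))"
    have "emeasure R UNIV = 1"
      using r sp by (simp add: R_def emeasure_density emeasure_eq_measure sets.top[of \<kappa>, simplified sp] flip: r_def ennreal_mult)
    then have R: "seq_law R"
      unfolding seq_law_def by (auto intro!: prob_spaceI simp: R_def sp sets)
    have charR: "seq_char R a = seq_char \<kappa> a / r" for a
      unfolding seq_char_def R_def using r
      by (subst integral_density) (auto simp: scaleR_conv_of_real)
    let ?p = "poisson_pmf r"
    let ?C = "convolution_power R"
    have C: "seq_law (?C n)" "seq_char (?C n) a = seq_char R a ^ n" for n a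
      using seq_char_convolution_power[OF R] by auto
    have Cmeas: "?C \<in> measurable (measure_pmf ?p) (subprob_algebra seq_space)"
    proof -
      have "?C n \<in> space (subprob_algebra seq_space)" for n
        using C(1)[of n] by (auto simp: seq_law_def space_subprob_algebra prob_space_imp_subprob_space)
      then show ?thesis by (simp add: measurable_def)
    qed
    define P where "P = measure_pmf ?p \<bind> ?C"
    have setsP [measurable_cong]: "sets P = sets seq_space"
      unfolding P_def by (rule sets_bind) (use C(1) in \<open>auto simp: seq_law_def\<close>)
    have "prob_space P"
      unfolding P_def by (rule measure_pmf.prob_space_bind[OF _ Cmeas]) (use C(1) in \<open>auto simp: seq_law_def\<close>)
    then have P: "seq_law P" using setsP by (simp add: seq_law_def)
    \<comment> \<open>The mixture formula \<open>mix\<close> is for bounded real functions, so real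
      and imaginary parts are computed separately.\<close>
    have parts: "Re (seq_char L a) = (\<integral>x. cos (pairing a x) \<partial>L)" "Im (seq_char L a) = (\<integral>x. sin (pairing a x) \<partial>L)"
      if L: "seq_law L" for L a
    proof -
      interpret L: prob_space L using L by (simp add: seq_law_def)
      have [measurable_cong]: "sets L = sets seq_space" using L by (simp add: seq_law_def)
      have "integrable L (\<lambda>x. iexp (pairing a x))"
        by (intro L.integrable_const_bound[of _ 1]) auto
      from integral_Re[OF this] integral_Im[OF this]
      show "Re (seq_char L a) = (\<integral>x. cos (pairing a x) \<partial>L)" "Im (seq_char L a) = (\<integral>x. sin (pairing a x) \<partial>L)"
        by (simp_all add: seq_char_def Re_exp Im_exp)
    qed
    have mix: "(\<integral>x. f x \<partial>P) = (\<integral>n. (\<integral>x. f x \<partial>?C n) \<partial>measure_pmf ?p)"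
      if "f \<in> borel_measurable seq_space" "\<And>x. \<bar>f x\<bar> \<le> 1" for f :: "(int \<Rightarrow> real) \<Rightarrow> real"
      unfolding P_def
    proof (rule integral_bind[where B=1 and B'=1])
      show "AE n in measure_pmf ?p. emeasure (?C n) (space (?C n)) \<le> ennreal 1"
        using C(1) by (auto simp: seq_law_def prob_space.emeasure_space_1)
    qed (use that Cmeas in \<open>auto simp: measure_pmf.finite_measure_axioms\<close>)
    have bound: "cmod (seq_char R a) \<le> 1" for a
    proof -
      interpret L: prob_space R using R by (simp add: seq_law_def)
      have "cmod (seq_char R a) \<le> (\<integral>x. cmod (iexp (pairing a x)) \<partial>R)"
        unfolding seq_char_def by (rule integral_norm_bound)
      then show ?thesis by (simp add: L.prob_space)
    qed
    have char: "seq_char P a = exp (CLINT x|\<kappa>. iexp (pairing a x) - 1)" for a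
    proof -
      let ?\<phi> = "seq_char R a"
      have int: "integrable (measure_pmf ?p) (\<lambda>n. ?\<phi> ^ n)"
        using bound[of a] by (intro measure_pmf.integrable_const_bound[of _ 1]) (auto simp: norm_power power_le_one)
      have "seq_char P a = (\<integral>n. ?\<phi> ^ n \<partial>measure_pmf ?p)"
      proof (rule complex_eqI)
        show "Re (seq_char P a) = Re (\<integral>n. ?\<phi> ^ n \<partial>measure_pmf ?p)"
          unfolding parts(1)[OF P] integral_Re[OF int, symmetric]
          by (subst mix) (auto simp: parts(1)[OF C(1), symmetric] C(2))
        show "Im (seq_char P a) = Im (\<integral>n. ?\<phi> ^ n \<partial>measure_pmf ?p)"
          unfolding parts(2)[OF P] integral_Im[OF int, symmetric]
          by (subst mix) (auto simp: parts(2)[OF C(1), symmetric] C(2))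
      qed
      also have "\<dots> = (\<integral>n. pmf ?p n *\<^sub>R ?\<phi> ^ n \<partial>count_space UNIV)"
        unfolding measure_pmf_eq_density by (subst integral_density) auto
      also have "\<dots> = exp (of_real r * (?\<phi> - 1))"
      proof -
        have "integrable (count_space UNIV) (\<lambda>n. pmf ?p n *\<^sub>R ?\<phi> ^ n)"
          using int unfolding measure_pmf_eq_density by (subst (asm) integrable_density) auto
        then have "(\<lambda>n. pmf ?p n *\<^sub>R ?\<phi> ^ n) sums (\<integral>n. pmf ?p n *\<^sub>R ?\<phi> ^ n \<partial>count_space UNIV)"
          by (rule sums_integral_count_space_nat)
        moreover have "(\<lambda>n. of_real (exp (- r)) * ((of_real r * ?\<phi>) ^ n /\<^sub>R fact n)) sums
            (of_real (exp (- r)) * exp (of_real r * ?\<phi>))"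
          by (intro sums_mult exp_converges)
        moreover have "pmf ?p n *\<^sub>R ?\<phi> ^ n = of_real (exp (- r)) * ((of_real r * ?\<phi>) ^ n /\<^sub>R fact n)" for n
          using r by (simp add: scaleR_conv_of_real power_mult_distrib field_simps)
        ultimately have "(\<integral>n. pmf ?p n *\<^sub>R ?\<phi> ^ n \<partial>count_space UNIV) = of_real (exp (- r)) * exp (of_real r * ?\<phi>)"
          using sums_unique2 by (metis (no_types, lifting) sums_cong)
        also have "\<dots> = exp (of_real r * (?\<phi> - 1))"
          by (simp add: exp_of_real[symmetric] exp_add[symmetric] algebra_simps)
        finally show ?thesis .
      qed
      also have "of_real r * (?\<phi> - 1) = (CLINT x|\<kappa>. iexp (pairing a x) - 1)"
        using r unfolding charR seq_char_finite_mass[OF fin sets] by (simp add: r_def[symmetric] field_simps)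
      finally show ?thesis .
    qed
    from P char show thesis by (rule that)
  qed
qed

lemma seq_law_translate:
  assumes "seq_law P"
  shows "seq_law (distr P seq_space (\<lambda>x i. x i - v i))" (is "seq_law ?P")
    and "seq_char (distr P seq_space (\<lambda>x i. x i - v i)) a = seq_char P a * iexp (- pairing a v)"
proof -
  interpret prob_space P using assms by (simp add: seq_law_def)
  have [measurable_cong]: "sets P = sets seq_space" using assms by (simp add: seq_law_def)
  have [measurable]: "(\<lambda>x i. x i - v i) \<in> measurable P seq_space"
    by (rule measurable_PiM_single') auto
  show "seq_law ?P" by (auto simp: seq_law_def intro: prob_space_distr)
  have "seq_char ?P a = (CLINT x|P. iexp (pairing a x) * iexp (- pairing a v))"
    unfolding seq_char_def
    by (subst integral_distr, measurable) (simp add: pairing_minus_right right_diff_distrib exp_diff exp_minus field_simps)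
  then show "seq_char ?P a = seq_char P a * iexp (- pairing a v)" by (simp add: seq_char_def)
qed

text \<open>For finite mass the compensator is integrable by itself and linear in \<open>a\<close>,
  so it amounts to translating the compound Poisson law by the mean of the clipped jumps.\<close>

lemma exists_law_of_finite_levy:
  assumes fin: "finite_measure \<kappa>" and sets [measurable_cong]: "sets \<kappa> = sets seq_space"
  obtains P where "seq_law P" "\<And>a. a \<in> finite_seqs \<Longrightarrow> seq_char P a = exp (levy_exponent \<kappa> a)"
proof -
  interpret finite_measure \<kappa> by fact
  obtain P0 where P0: "seq_law P0" "\<And>a. seq_char P0 a = exp (CLINT x|\<kappa>. iexp (pairing a x) - 1)"
    using exists_compound_poisson[OF fin sets] by blast
  define v where "v i = (\<integral>x. clip x i \<partial>\<kappa>)" for i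
  let ?P = "distr P0 seq_space (\<lambda>x i. x i - v i)"
  have int: "integrable \<kappa> (\<lambda>x. clip x i)" for i
  proof (rule integrable_const_bound[of _ 1])
    have "(\<lambda>x. clip x i) \<in> borel_measurable seq_space" by measurable
    then show "(\<lambda>x. clip x i) \<in> borel_measurable \<kappa>" by measurable
  qed (use clip_bound in auto)
  have v: "(\<integral>x. pairing a (clip x) \<partial>\<kappa>) = pairing a v" for a
    unfolding pairing_def v_def using int by (subst Bochner_Integration.integral_sum) auto
  have "seq_char ?P a = exp (levy_exponent \<kappa> a)" for a
  proof -
    have "integrable \<kappa> (\<lambda>x. pairing a (clip x))"
      unfolding pairing_def using int by (intro Bochner_Integration.integrable_sum integrable_mult_right)
    then have i2: "integrable \<kappa> (\<lambda>x. \<i> * complex_of_real (pairing a (clip x)))" by simp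
    have i1: "integrable \<kappa> (\<lambda>x. iexp (pairing a x) - 1)"
      by (intro integrable_const_bound[of _ 2] AE_I2 order_trans[OF norm_triangle_ineq4]) auto
    have "levy_exponent \<kappa> a = (CLINT x|\<kappa>. iexp (pairing a x) - 1) - \<i> * complex_of_real (pairing a v)"
      unfolding levy_exponent_def levy_kernel_def Bochner_Integration.integral_diff[OF i1 i2]
      by (simp add: v[symmetric])
    then have "levy_exponent \<kappa> a = (CLINT x|\<kappa>. iexp (pairing a x) - 1) + \<i> * complex_of_real (- pairing a v)"
      by simp
    then have "exp (levy_exponent \<kappa> a) = seq_char P0 a * iexp (- pairing a v)"
      unfolding P0 by (simp only: exp_add)
    then show ?thesis using seq_law_translate(2)[OF P0(1)] by simp
  qed
  then show thesis using that[of ?P] seq_law_translate(1)[OF P0(1)] by blast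
qed

section \<open>Tail bounds for the coordinates\<close>

text \<open>Mean value inequality on a convex half-plane where the derivative of \<open>exp\<close>
  has modulus at most 1.\<close>

lemma norm_exp_minus_one_le:
  fixes z :: complex
  assumes "Re z \<le> 0"
  shows "cmod (exp z - 1) \<le> cmod z"
proof -
  have "cmod (exp z - exp 0) \<le> 1 * cmod (z - 0)"
  proof (rule field_differentiable_bound[where S="{z. Re z \<le> 0}" and f'=exp])
    show "convex {z. Re z \<le> 0}" by (rule convex_halfspace_Re_le)
  qed (use assms in \<open>auto intro!: derivative_eq_intros\<close>)
  then show ?thesis by simp
qed

text \<open>Averaging \<open>1 - cos (t x)\<close> over a standard normal \<open>t\<close> gives \<open>1 - exp (- x\<^sup>2 / 2)\<close>.\<close>

lemma gaussian_tail_bound: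
  assumes P: "seq_law P" and Q: "levy_integrable Q"
    and char: "\<And>a. a \<in> finite_seqs \<Longrightarrow> seq_char P a = exp (levy_exponent Q a)"
  shows "(\<integral>x. 1 - exp (- (x i)\<^sup>2 / 2) \<partial>P) \<le> 10 * (\<integral>x. trunc_sq i x \<partial>Q)"
proof -
  interpret P: prob_space P using P by (simp add: seq_law_def)
  have [measurable_cong]: "sets P = sets seq_space" "sets Q = sets seq_space"
    using P Q by (auto simp: seq_law_def levy_integrable_def)
  have xi [measurable]: "(\<lambda>x. x i) \<in> borel_measurable P" by measurable
  define Y where "Y = distr P borel (\<lambda>x. x i)"
  interpret Y: real_distribution Y unfolding Y_def by (rule P.real_distribution_distr) fact
  interpret N: real_distribution std_normal_distribution by (rule real_dist_normal_dist)
  interpret pair_sigma_finite Y std_normal_distribution ..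
  interpret YN: pair_prob_space Y std_normal_distribution ..
  define \<eta> where "\<eta> = (\<integral>x. trunc_sq i x \<partial>Q)"
  have \<eta>0: "0 \<le> \<eta>" unfolding \<eta>_def by (intro integral_nonneg_AE AE_I2 trunc_sq_bounds)
  have charY: "char Y t = exp (levy_exponent Q (\<lambda>j. if j = i then t else 0))" for t
    unfolding char_def Y_def char[OF finite_seqs_single, symmetric] seq_char_def
    by (subst integral_distr) auto
  \<comment> \<open>The kernel bound at a single coordinate has the factor
    \<open>(2 + \<bar>t\<bar>)^2\<close>, at most \<open>8 + 2 * t^2\<close>. Integrated against the
    standard normal, this becomes \<open>8 + 2 = 10\<close>.\<close>
  have bound: "1 - Re (char Y t) \<le> (8 + 2 * t\<^sup>2) * \<eta>" for t
  proof -
    let ?a = "\<lambda>j. if j = i then t else 0"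
    let ?z = "levy_exponent Q ?a"
    \<comment> \<open>A characteristic function has modulus at most 1, so the exponent lies in the
      left half-plane.\<close>
    have "exp (Re ?z) \<le> 1" using Y.cmod_char_le_1[of t] by (simp add: charY)
    then have "cmod (exp ?z - 1) \<le> cmod ?z" by (intro norm_exp_minus_one_le) simp
    moreover have "1 - Re (char Y t) \<le> cmod (exp ?z - 1)"
      using abs_Re_le_cmod[of "exp ?z - 1"] by (simp add: charY)
    moreover have "cmod ?z \<le> (\<integral>x. (2 + \<bar>t\<bar>)\<^sup>2 * trunc_sq i x \<partial>Q)"
      unfolding levy_exponent_def
    proof (rule order_trans[OF integral_norm_bound integral_mono])
      show "integrable Q (\<lambda>x. cmod (levy_kernel ?a x))"
        by (intro integrable_norm integrable_levy_kernel[OF Q finite_seqs_single])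
      show "integrable Q (\<lambda>x. (2 + \<bar>t\<bar>)\<^sup>2 * trunc_sq i x)"
        by (intro integrable_mult_right integrable_trunc_sq Q)
      fix x
      have "{j. ?a j \<noteq> 0} = (if t = 0 then {} else {i})" by auto
      then show "cmod (levy_kernel ?a x) \<le> (2 + \<bar>t\<bar>)\<^sup>2 * trunc_sq i x"
        using levy_kernel_bound[OF finite_seqs_single, of i t x] trunc_sq_bounds(1)[of i x]
        by (cases "t = 0") auto
    qed
    moreover have "(2 + \<bar>t\<bar>)\<^sup>2 \<le> 8 + 2 * t\<^sup>2"
      using zero_le_power2[of "\<bar>t\<bar> - 2"] by (simp add: power2_eq_square algebra_simps)
    then have "(2 + \<bar>t\<bar>)\<^sup>2 * \<eta> \<le> (8 + 2 * t\<^sup>2) * \<eta>" using \<eta>0 by (rule mult_right_mono)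
    ultimately show ?thesis by (simp add: \<eta>_def)
  qed
  have fub: "(CLINT t|std_normal_distribution. char Y t) = (CLINT y|Y. char std_normal_distribution y)"
  proof -
    have "integrable (Y \<Otimes>\<^sub>M std_normal_distribution) (case_prod (\<lambda>y t. iexp (t * y)))"
      by (intro YN.P.integrable_const_bound[of _ 1]) (auto simp: case_prod_beta)
    from Fubini_integral[OF this] show ?thesis
      unfolding char_def by (simp add: mult.commute)
  qed
  have intY: "integrable Y (\<lambda>y. complex_of_real (exp (- y\<^sup>2 / 2)))"
    by (intro Y.integrable_const_bound[of _ 1]) auto
  have intN: "integrable std_normal_distribution (char Y)"
    by (intro N.integrable_const_bound[of _ 1]) (auto intro: Y.cmod_char_le_1)
  have "(\<integral>y. exp (- y\<^sup>2 / 2) \<partial>Y) = Re (CLINT y|Y. char std_normal_distribution y)"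
    unfolding char_std_normal_distribution integral_Re[OF intY, symmetric] by simp
  also have "\<dots> = (\<integral>t. Re (char Y t) \<partial>std_normal_distribution)"
    unfolding fub[symmetric] integral_Re[OF intN] ..
  finally have eq: "(\<integral>y. exp (- y\<^sup>2 / 2) \<partial>Y) = (\<integral>t. Re (char Y t) \<partial>std_normal_distribution)" .
  have intY': "integrable Y (\<lambda>y. exp (- y\<^sup>2 / 2))"
    by (intro Y.integrable_const_bound[of _ 1]) auto
  have intN': "integrable std_normal_distribution (\<lambda>t. Re (char Y t))"
    using intN by (rule integrable_Re)
  have "(\<integral>x. 1 - exp (- (x i)\<^sup>2 / 2) \<partial>P) = (\<integral>y. 1 - exp (- y\<^sup>2 / 2) \<partial>Y)"
    unfolding Y_def by (subst integral_distr) auto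
  also have "\<dots> = (\<integral>t. 1 - Re (char Y t) \<partial>std_normal_distribution)"
    using intY' intN' eq Y.prob_space N.prob_space by simp
  also have "\<dots> \<le> (\<integral>t. (8 + 2 * t\<^sup>2) * \<eta> \<partial>std_normal_distribution)"
    using intN' integrable_std_normal_distribution_moment[of 2] bound
    by (intro integral_mono) auto
  also have "\<dots> = 10 * \<eta>"
    using integrable_std_normal_distribution_moment[of 2] std_normal_distribution_even_moments(1)[of 1] N.prob_space
    by simp
  finally show ?thesis by (simp add: \<eta>_def)
qed

lemma one_minus_exp_ge:
  fixes u :: real
  assumes "0 \<le> u" "u \<le> 1"
  shows "u / 2 \<le> 1 - exp (- u)"
proof -
  have "exp (- u) = 1 / exp u" by (simp add: exp_minus inverse_eq_divide)
  also have "\<dots> \<le> 1 / (1 + u)" using assms exp_ge_add_one_self[of u] by (intro divide_left_mono) auto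
  also have "\<dots> \<le> 1 - u / 2"
  proof -
    have "u * u \<le> u * 1" using assms by (intro mult_left_mono) auto
    then show ?thesis using assms by (simp add: field_simps)
  qed
  finally show ?thesis by simp
qed

text \<open>Markov's inequality for \<open>1 - exp (- (x i)^2 / 2)\<close>, which is at least
  \<open>d^2 / 4\<close> when \<open>d < \<bar>x i\<bar>\<close> and \<open>d \<le> 1\<close>. The
  constant is \<open>40 = 4 * 10\<close>.\<close>

lemma coordinate_tail_bound:
  assumes "seq_law P" "levy_integrable Q"
    and "\<And>a. a \<in> finite_seqs \<Longrightarrow> seq_char P a = exp (levy_exponent Q a)"
    and d: "0 < d" "d \<le> 1"
  shows "measure P {x. d < \<bar>x i\<bar>} \<le> 40 / d\<^sup>2 * (\<integral>x. trunc_sq i x \<partial>Q)"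
proof -
  interpret P: prob_space P using assms by (simp add: seq_law_def)
  have sets [measurable_cong]: "sets P = sets seq_space" using assms by (simp add: seq_law_def)
  have "{x \<in> space seq_space. d < \<bar>x i\<bar>} \<in> sets seq_space" by measurable
  then have A: "{x. d < \<bar>x i\<bar>} \<in> sets P" by (simp add: sets)
  have "d\<^sup>2 / 4 * measure P {x. d < \<bar>x i\<bar>} = (\<integral>x. d\<^sup>2 / 4 * indicator {x. d < \<bar>x i\<bar>} x \<partial>P)"
    using A by simp
  also have "\<dots> \<le> (\<integral>x. 1 - exp (- (x i)\<^sup>2 / 2) \<partial>P)"
  proof (rule integral_mono)
    show "integrable P (\<lambda>x. d\<^sup>2 / 4 * indicator {x. d < \<bar>x i\<bar>} x)"
      by (intro integrable_mult_right) (use A in \<open>simp add: less_top[symmetric]\<close>)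
    show "integrable P (\<lambda>x. 1 - exp (- (x i)\<^sup>2 / 2))"
      by (intro P.integrable_const_bound[of _ 1]) auto
    fix x :: "int \<Rightarrow> real"
    show "d\<^sup>2 / 4 * indicator {x. d < \<bar>x i\<bar>} x \<le> 1 - exp (- (x i)\<^sup>2 / 2)"
    proof (cases "d < \<bar>x i\<bar>")
      case True
      then have le: "d\<^sup>2 \<le> (x i)\<^sup>2" using d by (intro abs_le_square_iff[THEN iffD1]) auto
      have "d\<^sup>2 \<le> 1" using d by (simp add: power_le_one)
      then have "d\<^sup>2 / 2 / 2 \<le> 1 - exp (- (d\<^sup>2 / 2))" by (intro one_minus_exp_ge) auto
      also have "\<dots> \<le> 1 - exp (- (x i)\<^sup>2 / 2)" using le by simp
      finally show ?thesis using True by simp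
    qed simp
  qed
  also have "\<dots> \<le> 10 * (\<integral>x. trunc_sq i x \<partial>Q)"
    using assms by (intro gaussian_tail_bound)
  finally have "4 / d\<^sup>2 * (d\<^sup>2 / 4 * measure P {x. d < \<bar>x i\<bar>}) \<le>
      4 / d\<^sup>2 * (10 * (\<integral>x. trunc_sq i x \<partial>Q))"
    by (rule mult_left_mono) simp
  then show ?thesis using d by simp
qed

text \<open>Cut \<open>Q\<close> into disjoint finite pieces and add independent variables with the
  corresponding laws. With fast enough pieces, Borel-Cantelli gives absolute convergence at each
  coordinate, and both the characteristic functionals and the exponents of the partial sums pass to
  the limit.\<close>

theorem exists_law_of_levy:
  assumes Q: "levy_integrable Q" and zero: "emeasure Q {\<lambda>_. 0} = 0"
  obtains P where "seq_law P" "\<And>a. a \<in> finite_seqs \<Longrightarrow> seq_char P a = exp (levy_exponent Q a)"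
proof -
  have sets [measurable_cong]: "sets Q = sets seq_space" using Q by (simp add: levy_integrable_def)
  have sp: "space Q = UNIV" using sets_eq_imp_space_eq[OF sets] by simp
  interpret Q: sigma_finite_measure Q by (rule levy_integrable_sigma_finite[OF Q zero])
  obtain F :: "nat \<Rightarrow> (int \<Rightarrow> real) set" where F: "range F \<subseteq> sets Q" "(\<Union>i. F i) = space Q"
    "\<And>i. emeasure Q (F i) \<noteq> \<infinity>" "incseq F"
    using Q.sigma_finite_incseq by blast
  have Fm [measurable]: "F m \<in> sets seq_space" for m using F(1) sets by auto
  define r where "r i m = (\<integral>x. trunc_sq i x * indicator (- F m) x \<partial>Q)" for i m
  have intF: "integrable Q (\<lambda>x. trunc_sq i x * indicator A x)" if [measurable]: "A \<in> sets seq_space" for i A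
    using integrable_trunc_sq[OF Q, of i]
    by (rule Bochner_Integration.integrable_bound) (auto simp: indicator_def)
  have cF [measurable]: "- F m \<in> sets seq_space" for m
    using sets.compl_sets[OF Fm[of m]] by (simp add: Compl_eq_Diff_UNIV)
  have r0: "r i \<longlonglongrightarrow> 0" for i
  proof -
    have "(\<lambda>m. \<integral>x. trunc_sq i x * indicator (- F m) x \<partial>Q) \<longlonglongrightarrow> (\<integral>x. 0 \<partial>Q)"
    proof (rule integral_dominated_convergence[where w="trunc_sq i"])
      show "AE x in Q. (\<lambda>m. trunc_sq i x * indicator (- F m) x) \<longlonglongrightarrow> 0"
      proof (rule AE_I2)
        fix x
        obtain k where "x \<in> F k" using F(2) sp by blast
        then have "x \<in> F m" if "k \<le> m" for m using F(4) that by (auto simp: incseq_def)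
        then have "\<forall>\<^sub>F m in sequentially. trunc_sq i x * indicator (- F m) x = 0"
          unfolding eventually_sequentially by (intro exI[of _ k]) auto
        then show "(\<lambda>m. trunc_sq i x * indicator (- F m) x) \<longlonglongrightarrow> 0" by (rule tendsto_eventually)
      qed
      show "AE x in Q. norm (trunc_sq i x * indicator (- F m) x) \<le> trunc_sq i x" for m
        using trunc_sq_bounds(1)[of i] by (intro AE_I2) (auto simp: indicator_def)
    qed (use integrable_trunc_sq[OF Q] in auto)
    then show ?thesis by (simp add: r_def[abs_def])
  qed
  \<comment> \<open>The ratio 1/8 beats the loss \<open>4^n\<close> of
    \<open>coordinate_tail_bound\<close> at threshold \<open>(1 / 2) ^ n\<close>. Only the first
    coordinates of the enumeration are controlled at stage \<open>n\<close>, so each one is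
    controlled eventually; \<open>m \<ge> n\<close> keeps the sets exhausting.\<close>
  have "\<exists>m\<ge>n. \<forall>j\<in>{..n}. r (int_decode j) m < (1 / 8) ^ n" for n
  proof -
    have "\<forall>\<^sub>F m in sequentially. \<forall>j\<in>{..n}. r (int_decode j) m < (1 / 8) ^ n"
      by (intro eventually_ball_finite ballI order_tendstoD(2)[OF r0]) auto
    with eventually_ge_at_top[of n]
    have "\<forall>\<^sub>F m in sequentially. n \<le> m \<and> (\<forall>j\<in>{..n}. r (int_decode j) m < (1 / 8) ^ n)"
      by (rule eventually_conj)
    then show ?thesis by (auto simp: eventually_sequentially)
  qed
  then obtain m where m: "\<And>n. n \<le> m n" "\<And>n j. j \<le> n \<Longrightarrow> r (int_decode j) (m n) < (1 / 8) ^ n"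
    by (metis atMost_iff)
  define G where "G n = F (m n)" for n
  have Gm [measurable]: "G n \<in> sets seq_space" for n by (simp add: G_def)
  have UG: "(\<Union>n. G n) = UNIV"
  proof -
    have "F n \<subseteq> G n" for n using F(4) m(1)[of n] by (auto simp: G_def incseq_def)
    then have "(\<Union>n. F n) \<subseteq> (\<Union>n. G n)" by blast
    moreover have "(\<Union>n. F n) = UNIV" using F(2) sp by simp
    ultimately show ?thesis by (simp only: top.extremum_unique)
  qed
  define B where "B = disjointed G"
  have Bm [measurable]: "B n \<in> sets seq_space" for n
    using sets.range_disjointed_sets[of G seq_space] Gm by (auto simp: B_def image_subset_iff)
  have BG: "B n \<subseteq> G n" for n by (auto simp: B_def disjointed_def)
  \<comment> \<open>A piece is small because it avoids the preceding set \<open>G n\<close>; hence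
    the index shift in the estimate \<open>small\<close> and in the series below. The first piece
    carries no smallness bound.\<close>
  have BS: "B (Suc n) \<subseteq> - G n" for n by (auto simp: B_def disjointed_def)
  have UB: "(\<Union>n. B n) = UNIV" using UN_disjointed_eq[of G] UG by (simp add: B_def)
  have disjB: "disjoint_family B" unfolding B_def by (rule disjoint_family_disjointed)
  define \<kappa> where "\<kappa> n = density Q (indicator (B n))" for n
  have sets\<kappa> [simp]: "sets (\<kappa> n) = sets seq_space" for n by (simp add: \<kappa>_def sets)
  have fin\<kappa>: "finite_measure (\<kappa> n)" for n
  proof
    have "emeasure (\<kappa> n) (space (\<kappa> n)) = emeasure Q (B n)"
      using emeasure_density_indicator[of "B n" Q UNIV] Bm[of n] sets.top[of Q] by (simp add: \<kappa>_def sp sets)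
    also have "\<dots> \<le> emeasure Q (G n)" using BG by (intro emeasure_mono) (auto simp: sets)
    finally show "emeasure (\<kappa> n) (space (\<kappa> n)) \<noteq> \<infinity>" using F(3)[of "m n"] by (auto simp: G_def top_unique)
  qed
  have int\<kappa>: "(\<integral>x. f x \<partial>\<kappa> n) = (\<integral>x. indicator (B n) x *\<^sub>R f x \<partial>Q)"
    if [measurable]: "f \<in> borel_measurable seq_space" for f :: "(int \<Rightarrow> real) \<Rightarrow> 'b :: {banach, second_countable_topology}" and n
    unfolding \<kappa>_def ennreal_indicator[symmetric] by (subst integral_density) auto
  have Q\<kappa>: "levy_integrable (\<kappa> n)" for n
  proof -
    interpret finite_measure "\<kappa> n" by (rule fin\<kappa>)
    have "(\<integral>\<^sup>+x. ennreal (trunc_sq i x) \<partial>\<kappa> n) \<le> (\<integral>\<^sup>+x. 1 \<partial>\<kappa> n)" for i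
      using trunc_sq_bounds by (intro nn_integral_mono) auto
    also have "\<dots> < \<infinity>" using emeasure_eq_measure by simp
    finally show ?thesis by (simp add: levy_integrable_def)
  qed
  have small: "(\<integral>x. trunc_sq i x \<partial>\<kappa> (Suc n)) \<le> (1 / 8) ^ n" if "int_encode i \<le> n" for i n
  proof -
    have "(\<integral>x. trunc_sq i x \<partial>\<kappa> (Suc n)) = (\<integral>x. trunc_sq i x * indicator (B (Suc n)) x \<partial>Q)"
      by (subst int\<kappa>) (auto simp: mult.commute)
    also have "\<dots> \<le> r i (m n)"
      unfolding r_def using BS[of n] trunc_sq_bounds(1)[of i]
      by (intro integral_mono intF) (auto simp: G_def indicator_def)
    also have "\<dots> \<le> (1 / 8) ^ n" using m(2)[OF that] by simp
    finally show ?thesis .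
  qed
  have "\<exists>P. seq_law P \<and> (\<forall>a\<in>finite_seqs. seq_char P a = exp (levy_exponent (\<kappa> n) a))" for n
    using exists_law_of_finite_levy[OF fin\<kappa> sets\<kappa>] by metis
  then obtain P where P: "\<And>n. seq_law (P n)"
    "\<And>n a. a \<in> finite_seqs \<Longrightarrow> seq_char (P n) a = exp (levy_exponent (\<kappa> n) a)" by metis
  have setsP [measurable_cong]: "sets (P n) = sets seq_space" for n using P by (simp add: seq_law_def)
  interpret PP: product_prob_space P "UNIV :: nat set"
    using P unfolding product_prob_space_def product_prob_space_axioms_def product_sigma_finite_def
    by (auto simp: seq_law_def prob_space_imp_sigma_finite)
  define \<Omega> where "\<Omega> = PiM (UNIV :: nat set) P"
  interpret \<Omega>: prob_space \<Omega> unfolding \<Omega>_def by (rule prob_space_PiM) (use P in \<open>simp add: seq_law_def\<close>)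
  have comp: "(\<lambda>\<omega>. \<omega> n) \<in> measurable \<Omega> (P n)" for n
    unfolding \<Omega>_def by (rule measurable_component_singleton) simp
  then have comp' [measurable]: "(\<lambda>\<omega>. \<omega> n) \<in> measurable \<Omega> seq_space" for n
    using measurable_cong_sets[OF refl setsP, of \<Omega> n] by blast
  have coord [measurable]: "(\<lambda>\<omega>. \<omega> n i) \<in> borel_measurable \<Omega>" for n i
    by (rule measurable_compose[OF comp']) simp
  have AE_summable: "AE \<omega> in \<Omega>. summable (\<lambda>n. \<omega> n i)" for i
  proof -
    define A where "A n = {\<omega> \<in> space \<Omega>. (1 / 2) ^ n < \<bar>\<omega> (Suc n) i\<bar>}" for n
    have A [measurable]: "A n \<in> sets \<Omega>" for n unfolding A_def by measurable
    have meas: "measure \<Omega> (A n) \<le> 40 * (1 / 2) ^ n" if n: "int_encode i \<le> n" for n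
    proof -
      let ?E = "{x :: int \<Rightarrow> real. (1 / 2) ^ n < \<bar>x i\<bar>}"
      have "{x \<in> space seq_space. (1 / 2) ^ n < \<bar>x i\<bar>} \<in> sets seq_space" by measurable
      then have E: "?E \<in> sets (P (Suc n))" by (simp add: setsP)
      have "A n = (\<lambda>\<omega>. \<omega> (Suc n)) -` ?E \<inter> space \<Omega>" by (auto simp: A_def)
      then have "measure \<Omega> (A n) = measure (distr \<Omega> (P (Suc n)) (\<lambda>\<omega>. \<omega> (Suc n))) ?E"
        using E comp by (simp add: measure_distr)
      also have "\<dots> = measure (P (Suc n)) ?E" using PP.PiM_component[of "Suc n"] by (simp add: \<Omega>_def)
      also have "\<dots> \<le> 40 / ((1 / 2) ^ n)\<^sup>2 * (\<integral>x. trunc_sq i x \<partial>\<kappa> (Suc n))"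
        by (rule coordinate_tail_bound[OF P(1) Q\<kappa> P(2)]) (auto simp: power_le_one)
      also have "\<dots> \<le> 40 / ((1 / 2) ^ n)\<^sup>2 * (1 / 8) ^ n"
        using small[OF n] by (intro mult_left_mono) auto
      also have "\<dots> = 40 * (1 / 2) ^ n"
      proof -
        have "(8 :: real) ^ n = 2 ^ n * (2 ^ n * 2 ^ n)"
          by (simp flip: power_mult_distrib)
        then show ?thesis by (simp add: power_divide power2_eq_square field_simps)
      qed
      finally show ?thesis .
    qed
    have "AE \<omega> in \<Omega>. eventually (\<lambda>n. \<omega> \<in> space \<Omega> - A n) sequentially"
    proof (rule borel_cantelli_AE1)
      show "emeasure \<Omega> (A n) < \<infinity>" for n by (simp add: less_top[symmetric])
      have "summable (\<lambda>n. 40 * (1 / 2 :: real) ^ n)" by (intro summable_mult summable_geometric) simp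
      then show "summable (\<lambda>n. measure \<Omega> (A n))"
        by (rule summable_comparison_test'[where N="int_encode i"]) (use meas in auto)
    qed (rule A)
    then show ?thesis
    proof eventually_elim
      case (elim \<omega>)
      then have "\<forall>\<^sub>F n in sequentially. norm (\<omega> (Suc n) i) \<le> (1 / 2) ^ n"
        by eventually_elim (auto simp: A_def)
      then have "summable (\<lambda>n. \<omega> (Suc n) i)"
        by (rule summable_comparison_test_ev) (intro summable_geometric, simp)
      then show ?case by (subst (asm) summable_Suc_iff)
    qed
  qed
  \<comment> \<open>Where the series diverges, \<open>suminf\<close> has an unspecified value; this
    happens on a null set only.\<close>
  define S where "S \<omega> = (\<lambda>i. \<Sum>n. \<omega> n i)" for \<omega> :: "nat \<Rightarrow> int \<Rightarrow> real"
  have S [measurable]: "S \<in> measurable \<Omega> seq_space"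
    unfolding S_def by (rule measurable_PiM_single') auto
  define L where "L = distr \<Omega> seq_space S"
  have L: "seq_law L" unfolding L_def seq_law_def by (auto intro: \<Omega>.prob_space_distr)
  have char: "seq_char L a = exp (levy_exponent Q a)" if a: "a \<in> finite_seqs" for a
  proof -
    have pa: "pairing a \<in> borel_measurable seq_space" by measurable
    have pm [measurable]: "(\<lambda>\<omega>. pairing a (\<omega> n)) \<in> borel_measurable \<Omega>" for n
      by (rule measurable_compose[OF comp' pa])
    have pS [measurable]: "(\<lambda>\<omega>. pairing a (S \<omega>)) \<in> borel_measurable \<Omega>"
      by (rule measurable_compose[OF S pa])
    have "AE \<omega> in \<Omega>. \<forall>i. summable (\<lambda>n. \<omega> n i)" using AE_summable by (simp add: AE_all_countable)
    then have lim: "AE \<omega> in \<Omega>. (\<lambda>N. \<Prod>n<N. iexp (pairing a (\<omega> n))) \<longlonglongrightarrow> iexp (pairing a (S \<omega>))"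
    proof eventually_elim
      case (elim \<omega>)
      have "(\<lambda>n. pairing a (\<omega> n)) sums pairing a (S \<omega>)"
        unfolding pairing_def S_def using elim by (intro sums_sum sums_mult summable_sums) auto
      then have "(\<lambda>N. iexp (\<Sum>n<N. pairing a (\<omega> n))) \<longlonglongrightarrow> iexp (pairing a (S \<omega>))"
        unfolding sums_def by (intro tendsto_intros)
      moreover have "iexp (\<Sum>n<N. pairing a (\<omega> n)) = (\<Prod>n<N. iexp (pairing a (\<omega> n)))" for N
        by (simp add: exp_sum sum_distrib_left)
      ultimately show ?case by simp
    qed
    have "(\<lambda>N. CLINT \<omega>|\<Omega>. (\<Prod>n<N. iexp (pairing a (\<omega> n)))) \<longlonglongrightarrow> (CLINT \<omega>|\<Omega>. iexp (pairing a (S \<omega>)))"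
    proof (rule integral_dominated_convergence[where w="\<lambda>_. 1"])
      show "(\<lambda>\<omega>. \<Prod>n<N. iexp (pairing a (\<omega> n))) \<in> borel_measurable \<Omega>" for N by measurable
      show "AE \<omega> in \<Omega>. norm (\<Prod>n<N. iexp (pairing a (\<omega> n))) \<le> 1" for N
        by (simp add: prod_norm[symmetric])
    qed (use lim in auto)
    moreover have "(CLINT \<omega>|\<Omega>. iexp (pairing a (S \<omega>))) = seq_char L a"
      unfolding seq_char_def L_def by (subst integral_distr) auto
    moreover have "(CLINT \<omega>|\<Omega>. (\<Prod>n<N. iexp (pairing a (\<omega> n)))) = exp (\<Sum>n<N. levy_exponent (\<kappa> n) a)" for N
    proof -
      let ?J = "{..<N}"
      have rm: "(\<lambda>x. restrict x ?J) \<in> measurable \<Omega> (PiM ?J P)"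
        unfolding \<Omega>_def by (rule measurable_restrict_subset) simp
      have fm: "(\<lambda>y. \<Prod>n<N. iexp (pairing a (y n))) \<in> borel_measurable (PiM ?J P)"
      proof (intro borel_measurable_prod)
        fix n assume "n \<in> ?J"
        then have "(\<lambda>y. y n) \<in> measurable (PiM ?J P) (P n)" by (rule measurable_component_singleton)
        then have [measurable]: "(\<lambda>y. y n) \<in> measurable (PiM ?J P) seq_space"
          using measurable_cong_sets[OF refl setsP, of "PiM ?J P" n] by blast
        have [measurable]: "(\<lambda>y. pairing a (y n)) \<in> borel_measurable (PiM ?J P)"
          by (rule measurable_compose[OF _ pa]) measurable
        show "(\<lambda>y. iexp (pairing a (y n))) \<in> borel_measurable (PiM ?J P)" by measurable
      qed
      have "(CLINT \<omega>|\<Omega>. (\<Prod>n<N. iexp (pairing a (\<omega> n)))) = (CLINT \<omega>|\<Omega>. (\<Prod>n<N. iexp (pairing a (restrict \<omega> ?J n))))"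
        by (intro Bochner_Integration.integral_cong refl prod.cong) auto
      also have "\<dots> = (CLINT y|distr \<Omega> (PiM ?J P) (\<lambda>x. restrict x ?J). (\<Prod>n<N. iexp (pairing a (y n))))"
        by (rule integral_distr[OF rm fm, symmetric])
      also have "distr \<Omega> (PiM ?J P) (\<lambda>x. restrict x ?J) = PiM ?J P"
        unfolding \<Omega>_def by (rule PP.distr_PiM_restrict_finite) auto
      also have "(CLINT y|PiM ?J P. (\<Prod>n<N. iexp (pairing a (y n)))) = (\<Prod>n<N. seq_char (P n) a)"
        unfolding seq_char_def
      proof (rule PP.product_integral_prod)
        fix n
        have "finite_measure (P n)" using P(1)[of n] by (auto simp: seq_law_def intro: prob_space.axioms(1))
        moreover have [measurable]: "pairing a \<in> borel_measurable (P n)"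
          using pa measurable_cong_sets[OF setsP refl, of n borel] by blast
        ultimately show "integrable (P n) (\<lambda>x. iexp (pairing a x))"
          by (intro finite_measure.integrable_const_bound[where B=1]) auto
      qed simp
      also have "\<dots> = exp (\<Sum>n<N. levy_exponent (\<kappa> n) a)" using P(2)[OF a] by (simp add: exp_sum)
      finally show ?thesis .
    qed
    ultimately have lim1: "(\<lambda>N. exp (\<Sum>n<N. levy_exponent (\<kappa> n) a)) \<longlonglongrightarrow> seq_char L a" by simp
    have ik: "integrable Q (levy_kernel a)" by (rule integrable_levy_kernel[OF Q a])
    \<comment> \<open>The exponents of the partial sums converge even when \<open>Q\<close> has
      infinite mass, because the compensated kernel is integrable and dominates its
      restrictions.\<close>
    have "(\<lambda>N. CLINT x|Q. indicator (\<Union>n<N. B n) x *\<^sub>R levy_kernel a x) \<longlonglongrightarrow> (CLINT x|Q. levy_kernel a x)"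
    proof (rule integral_dominated_convergence[where w="\<lambda>x. cmod (levy_kernel a x)"])
      show "AE x in Q. (\<lambda>N. indicator (\<Union>n<N. B n) x *\<^sub>R levy_kernel a x) \<longlonglongrightarrow> levy_kernel a x"
      proof (rule AE_I2)
        fix x
        obtain k where "x \<in> B k" using UB by blast
        then have "\<forall>\<^sub>F N in sequentially. indicator (\<Union>n<N. B n) x *\<^sub>R levy_kernel a x = levy_kernel a x"
          unfolding eventually_sequentially by (intro exI[of _ "Suc k"]) (auto simp: indicator_def Suc_le_eq)
        then show "(\<lambda>N. indicator (\<Union>n<N. B n) x *\<^sub>R levy_kernel a x) \<longlonglongrightarrow> levy_kernel a x"
          by (rule tendsto_eventually)
      qed
      show "AE x in Q. cmod (indicator (\<Union>n<N. B n) x *\<^sub>R levy_kernel a x) \<le> cmod (levy_kernel a x)" for N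
        by (intro AE_I2) (auto simp: indicator_def)
      show "(\<lambda>x. indicator (\<Union>n<N. B n) x *\<^sub>R levy_kernel a x) \<in> borel_measurable Q" for N
        by (intro borel_measurable_scaleR borel_measurable_indicator borel_measurable_integrable[OF ik])
           (auto simp: sets)
      show "levy_kernel a \<in> borel_measurable Q" by (rule borel_measurable_integrable[OF ik])
      show "integrable Q (\<lambda>x. cmod (levy_kernel a x))" by (rule integrable_norm[OF ik])
    qed
    moreover have "(CLINT x|Q. indicator (\<Union>n<N. B n) x *\<^sub>R levy_kernel a x) = (\<Sum>n<N. levy_exponent (\<kappa> n) a)" for N
    proof -
      have "indicator (\<Union>n<N. B n) x = (\<Sum>n<N. indicator (B n) x :: real)" for x
        using disjB by (intro indicator_UN_disjoint) (auto simp: disjoint_family_on_def)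
      then have e: "indicator (\<Union>n<N. B n) x *\<^sub>R levy_kernel a x = (\<Sum>n<N. indicator (B n) x *\<^sub>R levy_kernel a x)" for x
        by (simp only: scaleR_sum_left)
      have i: "integrable Q (\<lambda>x. indicator (B n) x *\<^sub>R levy_kernel a x)" for n
        by (rule integrable_mult_indicator[OF _ ik]) (simp add: sets)
      show ?thesis
        unfolding e levy_exponent_def int\<kappa>[OF measurable_levy_kernel]
        by (rule Bochner_Integration.integral_sum) (rule i)
    qed
    ultimately have "(\<lambda>N. \<Sum>n<N. levy_exponent (\<kappa> n) a) \<longlonglongrightarrow> levy_exponent Q a"
      by (simp add: levy_exponent_def)
    then have "(\<lambda>N. exp (\<Sum>n<N. levy_exponent (\<kappa> n) a)) \<longlonglongrightarrow> exp (levy_exponent Q a)"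
      by (intro tendsto_exp)
    then show ?thesis using lim1 by (rule LIMSEQ_unique[rotated])
  qed
  from L char show thesis by (rule that)
qed

section \<open>Stationary IDp processes\<close>

text \<open>The point mass at the zero sequence is a degenerate Gaussian law, which the definition
  admits.\<close>

lemma stationary_gaussian_covariance_zero: "stationary_gaussian_covariance (\<lambda>_. 0)"
proof -
  let ?G = "return seq_space (\<lambda>_. 0)"
  have "shift_invariant ?G"
    unfolding shift_invariant_def
    by (subst distr_return) (auto simp: shift_def)
  moreover have "seq_law ?G" by (simp add: seq_law_def prob_space_return)
  moreover have "AE x in ?G. pairing a x = 0" for a
  proof -
    have "{x \<in> space seq_space. pairing a x = 0} \<in> sets seq_space" by measurable
    then have "Measurable.pred seq_space (\<lambda>x. pairing a x = 0)" by (simp add: pred_def)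
    then show ?thesis by (subst AE_return) auto
  qed
  moreover have "(\<integral>x. x 0 * x k \<partial>?G) = 0" for k
    by (subst integral_return) auto
  ultimately show ?thesis
    unfolding stationary_gaussian_covariance_def by (intro exI[of _ ?G]) auto
qed

lemma covariance_operator_zero [simp]: "covariance_operator (\<lambda>_. 0) a = (\<lambda>_. 0)"
  by (simp add: covariance_operator_def)

lemma has_generating_triplet_zero_iff:
  "has_generating_triplet P (\<lambda>_. 0) 0 Q \<longleftrightarrow>
    levy_measure Q \<and> (\<forall>a\<in>finite_seqs. seq_char P a = exp (levy_exponent Q a))"
  by (simp add: has_generating_triplet_def stationary_gaussian_covariance_zero seq_char_def
      levy_exponent_def levy_kernel_def)

lemma levy_measureI:
  assumes "levy_integrable Q" "shift_invariant Q" "emeasure Q {\<lambda>_. 0} = 0"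
  shows "levy_measure Q"
proof -
  have "(\<integral>\<^sup>+x. ennreal (min ((x 0)\<^sup>2) 1) \<partial>Q) < \<infinity>"
    using assms(1) unfolding levy_integrable_def trunc_sq_def by blast
  then show ?thesis
    unfolding levy_measure_def
    using assms levy_integrable_sigma_finite by (simp add: levy_integrable_def)
qed

text \<open>With \<open>c = 1 / k\<close> this is the Levy measure of the \<open>k\<close>-th
  convolution root.\<close>

lemma levy_measure_scale:
  assumes "levy_measure Q" "0 < c"
  shows "levy_measure (scale_measure (ennreal c) Q)"
    and "a \<in> finite_seqs \<Longrightarrow> levy_exponent (scale_measure (ennreal c) Q) a = c * levy_exponent Q a"
proof -
  have sets [measurable_cong]: "sets Q = sets seq_space" and inv: "distr Q seq_space shift = Q"
    using assms by (auto simp: levy_measure_def shift_invariant_def)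
  let ?Q = "scale_measure (ennreal c) Q"
  have dens: "?Q = density Q (\<lambda>_. ennreal c)"
    by (rule measure_eqI) (auto simp: emeasure_density nn_integral_cmult)
  have "(\<integral>\<^sup>+x. ennreal (trunc_sq i x) \<partial>?Q) < \<infinity>" for i
    using levy_measure_integrable[OF assms(1)] unfolding dens
    by (subst nn_integral_density) (auto simp: levy_integrable_def nn_integral_cmult ennreal_mult_less_top)
  then have "levy_integrable ?Q" by (simp add: levy_integrable_def sets)
  moreover have "shift_invariant ?Q"
    unfolding shift_invariant_def
  proof (rule measure_eqI)
    fix A assume "A \<in> sets (distr ?Q seq_space shift)"
    then have A: "A \<in> sets seq_space" by simp
    have sh: "shift \<in> measurable ?Q seq_space" "shift \<in> measurable Q seq_space"
      using measurable_shift measurable_cong_sets[of ?Q seq_space seq_space seq_space]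
        measurable_cong_sets[of Q seq_space seq_space seq_space] sets by auto
    have "emeasure Q (shift -` A \<inter> space Q) = emeasure Q A"
      using emeasure_distr[OF sh(2) A] inv by simp
    then show "emeasure (distr ?Q seq_space shift) A = emeasure ?Q A"
      using emeasure_distr[OF sh(1) A] by (simp add: space_scale_measure)
  qed (simp add: sets)
  moreover have "emeasure ?Q {\<lambda>_. 0} = 0" using assms by (simp add: levy_measure_def)
  ultimately show "levy_measure ?Q" by (rule levy_measureI)
  show "levy_exponent ?Q a = c * levy_exponent Q a" if "a \<in> finite_seqs"
    unfolding levy_exponent_def dens using assms(2)
    by (subst integral_density) (auto simp: scaleR_conv_of_real)
qed

lemma pairing_shift: "pairing a (shift x) = pairing (\<lambda>i. a (i - 1)) x"
  unfolding pairing_def shift_def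
  by (rule sum.reindex_bij_witness[of _ "\<lambda>i. i - 1" "\<lambda>i. i + 1"]) auto

lemma finite_seqs_shift: "a \<in> finite_seqs \<Longrightarrow> (\<lambda>i. a (i - 1)) \<in> finite_seqs"
proof -
  assume "a \<in> finite_seqs"
  then have "finite ((\<lambda>i. i + 1) ` {i. a i \<noteq> 0})" by (simp add: finite_seqs_def)
  moreover have "{i. a (i - 1) \<noteq> 0} \<subseteq> (\<lambda>i. i + 1) ` {i. a i \<noteq> 0}"
    by (auto intro!: image_eqI[of _ _ "_ - 1"])
  ultimately show ?thesis by (auto simp: finite_seqs_def intro: finite_subset)
qed

lemma levy_exponent_shift:
  assumes "levy_measure Q"
  shows "levy_exponent Q (\<lambda>i. a (i - 1)) = levy_exponent Q a"
proof -
  have sets [measurable_cong]: "sets Q = sets seq_space" and inv: "distr Q seq_space shift = Q"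
    using assms by (auto simp: levy_measure_def shift_invariant_def)
  have "clip (shift x) = shift (clip x)" for x by (simp add: clip_def shift_def)
  then have "levy_kernel (\<lambda>i. a (i - 1)) = (\<lambda>x. levy_kernel a (shift x))"
    by (intro ext) (simp add: levy_kernel_def pairing_shift[symmetric])
  then have "levy_exponent Q (\<lambda>i. a (i - 1)) = (CLINT x|distr Q seq_space shift. levy_kernel a x)"
    unfolding levy_exponent_def by (subst integral_distr) auto
  then show ?thesis by (simp add: inv levy_exponent_def)
qed

lemma seq_char_shift:
  assumes "seq_law P"
  shows "seq_law (distr P seq_space shift)"
    and "seq_char (distr P seq_space shift) a = seq_char P (\<lambda>i. a (i - 1))"
proof -
  have [measurable_cong]: "sets P = sets seq_space" using assms by (simp add: seq_law_def)
  interpret prob_space P using assms by (simp add: seq_law_def)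
  show "seq_law (distr P seq_space shift)" by (auto simp: seq_law_def intro: prob_space_distr)
  show "seq_char (distr P seq_space shift) a = seq_char P (\<lambda>i. a (i - 1))"
    unfolding seq_char_def by (subst integral_distr, measurable) (simp add: pairing_shift)
qed

text \<open>The exponent is shift invariant and scales linearly in \<open>Q\<close>. Since laws are
  determined by characteristic functionals, the first fact gives stationarity and the second
  identifies \<open>P\<close> with the \<open>k\<close>-fold convolution of the law for
  \<open>Q\<close> divided by \<open>k\<close>.\<close>

theorem exists_stationary_IDp:
  assumes "levy_measure Q"
  obtains P where "stationary_IDp P Q"
proof -
  have ex: "\<exists>P. seq_law P \<and> (\<forall>a\<in>finite_seqs. seq_char P a = exp (levy_exponent Q a))"
    if "levy_measure Q" for Q
    using exists_law_of_levy[OF levy_measure_integrable[OF that]] that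
    by (metis levy_measure_def)
  obtain P where P: "seq_law P" "\<And>a. a \<in> finite_seqs \<Longrightarrow> seq_char P a = exp (levy_exponent Q a)"
    using ex[OF assms] by blast
  have "distr P seq_space shift = P"
  proof (rule seq_law_eqI)
    fix a :: "int \<Rightarrow> real" assume a: "a \<in> finite_seqs"
    show "seq_char (distr P seq_space shift) a = seq_char P a"
      unfolding seq_char_shift(2)[OF P(1)] P(2)[OF a] P(2)[OF finite_seqs_shift[OF a]]
        levy_exponent_shift[OF assms] ..
  qed (use P seq_char_shift in auto)
  moreover have "infinitely_divisible P"
    unfolding infinitely_divisible_def
  proof (intro allI impI)
    fix k :: nat assume k: "1 \<le> k"
    let ?c = "1 / real k"
    have c: "0 < ?c" using k by simp
    obtain Pk where Pk: "seq_law Pk"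
      "\<And>a. a \<in> finite_seqs \<Longrightarrow> seq_char Pk a = exp (levy_exponent (scale_measure (ennreal ?c) Q) a)"
      using ex[OF levy_measure_scale(1)[OF assms c]] by blast
    have "P = convolution_power Pk k"
    proof (rule seq_law_eqI)
      fix a :: "int \<Rightarrow> real" assume a: "a \<in> finite_seqs"
      have "seq_char (convolution_power Pk k) a = exp (of_nat k * (?c * levy_exponent Q a))"
        unfolding seq_char_convolution_power(2)[OF Pk(1)] Pk(2)[OF a] levy_measure_scale(2)[OF assms c a]
        by (rule exp_of_nat_mult[symmetric])
      also have "of_nat k * (?c * levy_exponent Q a) = levy_exponent Q a" using k by simp
      finally show "seq_char P a = seq_char (convolution_power Pk k) a" by (simp add: P(2)[OF a])
    qed (use P seq_char_convolution_power[OF Pk(1)] in auto)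
    then show "\<exists>Pk. seq_law Pk \<and> P = convolution_power Pk k" using Pk by blast
  qed
  ultimately have "stationary_IDp P Q"
    using P assms by (simp add: stationary_IDp_def shift_invariant_def has_generating_triplet_zero_iff)
  then show thesis by (rule that)
qed

lemma stationary_IDpD:
  assumes "stationary_IDp P Q"
  shows "levy_measure Q" "seq_law P" "a \<in> finite_seqs \<Longrightarrow> seq_char P a = exp (levy_exponent Q a)"
  using assms by (auto simp: stationary_IDp_def has_generating_triplet_zero_iff)

lemma bij_shift: "bij shift" and inv_shift: "inv shift = (\<lambda>x i. x (i - 1))"
proof -
  show "bij shift" by (rule bij_betw_byWitness[where f'="\<lambda>x i. x (i - 1)"]) (auto simp: shift_def)
  show "inv shift = (\<lambda>x i. x (i - 1))" by (rule inv_unique_comp) (auto simp: shift_def fun_eq_iff)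
qed

lemma levy_measure_system:
  assumes "levy_measure Q"
  shows "invertible_system Q shift"
proof -
  have sets: "sets Q = sets seq_space" and inv: "distr Q seq_space shift = Q" and "sigma_finite_measure Q"
    using assms by (auto simp: levy_measure_def shift_invariant_def)
  have m: "measurable Q Q = measurable seq_space seq_space"
    using measurable_cong_sets[OF sets sets] .
  have "(\<lambda>x i. x (i - 1)) \<in> measurable seq_space seq_space"
    by (rule measurable_PiM_single') auto
  moreover have "distr Q Q shift = Q"
    using inv distr_cong[of Q Q Q seq_space shift shift] sets by simp
  ultimately show ?thesis
    unfolding invertible_system_def invertible_system_axioms_def
    using sets_eq_imp_space_eq[OF sets] \<open>sigma_finite_measure Q\<close> bij_shift
    by (simp add: m inv_shift)
qed

lemma levy_measure_restrict:
  assumes Q: "levy_measure Q" and E: "E \<in> sets Q" "shift -` E = E"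
  shows "levy_measure (density Q (indicator E))"
    and "levy_exponent (density Q (indicator E)) a = (CLINT x|Q. indicator E x *\<^sub>R levy_kernel a x)"
proof -
  let ?N = "density Q (indicator E)"
  have sets [measurable_cong]: "sets Q = sets seq_space" using Q by (simp add: levy_measure_def)
  interpret invertible_system Q shift by (rule levy_measure_system[OF Q])
  interpret N: invertible_system ?N shift by (rule restrict_to_invariant[OF E])
  have [measurable]: "E \<in> sets seq_space" using E sets by simp
  have "(\<integral>\<^sup>+x. ennreal (trunc_sq i x) \<partial>?N) \<le> (\<integral>\<^sup>+x. ennreal (trunc_sq i x) \<partial>Q)" for i
    by (subst nn_integral_density) (auto intro!: nn_integral_mono simp: indicator_def)
  then have "levy_integrable ?N"
    using levy_measure_integrable[OF Q] sets unfolding levy_integrable_def by (auto intro: le_less_trans)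
  moreover have "distr ?N seq_space shift = ?N"
    using N.distr_T distr_cong[of ?N ?N ?N seq_space shift shift] sets by simp
  moreover have "{\<lambda>_. 0} \<in> sets Q" using sets_zero_seq by (simp add: sets)
  then have "emeasure ?N {\<lambda>_. 0} \<le> emeasure Q {\<lambda>_. 0}"
    using E(1) by (subst emeasure_density_indicator) (auto intro!: emeasure_mono)
  then have "emeasure ?N {\<lambda>_. 0} = 0" using Q by (simp add: levy_measure_def)
  ultimately show "levy_measure ?N" by (intro levy_measureI) (simp_all add: shift_invariant_def)
  show "levy_exponent ?N a = (CLINT x|Q. indicator E x *\<^sub>R levy_kernel a x)"
    unfolding levy_exponent_def ennreal_indicator[symmetric] by (subst integral_density) auto
qed

text \<open>The four classes of the decomposition, in the order \<open>B\<close>, \<open>m\<close>, \<open>wm\<close>, \<open>ne\<close>.\<close>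

definition ergodic_class :: "nat \<Rightarrow> 'a measure \<Rightarrow> ('a \<Rightarrow> 'a) \<Rightarrow> bool"
  where "ergodic_class k M T \<longleftrightarrow>
    (if k = 0 then dissipative M T
     else if k = 1 then conservative M T \<and> zero_type M T
     else if k = 2 then type_II_infinity M T \<and> positive_type M T
     else type_II_1 M T)"

section \<open>Uniqueness of the decomposition\<close>

text \<open>Numbering the classes lets symmetry reduce the claim to \<open>i < j\<close>. Against
  the dissipative class, it is enough that wandering sets are null for each of the other
  three.\<close>

lemma ergodic_class_singular:
  assumes "invertible_system M T" "invertible_system N T" and sets: "sets M = sets N"
    and "i < 4" "j < 4" "i \<noteq> j" "ergodic_class i M T" "ergodic_class j N T"
  shows "mutually_singular M N"
proof -
  have less: "mutually_singular M N"
    if "invertible_system M T" "invertible_system N T" and sets: "sets N = sets M"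
      and ij: "i < j" "j < 4" and c: "ergodic_class i M T" "ergodic_class j N T" for M N i j
  proof -
    interpret M: invertible_system M T by fact
    interpret N: invertible_system N T by fact
    consider "i = 0" | "i = 1" "j = 2" | "i = 1" "j = 3" | "i = 2" "j = 3" using ij by linarith
    then show ?thesis
    proof cases
      case 1
      have "emeasure N W = 0" if "wandering M T W" for W
      proof -
        have W: "wandering N T W" using that sets by (simp add: M.wandering_iff N.wandering_iff)
        consider "j = 1" | "j = 2" | "j = 3" using ij 1 by linarith
        then show ?thesis
        proof cases
          case 1 then show ?thesis using c(2) N.conservative_wandering_null[OF _ W] by (simp add: ergodic_class_def)
        next
          case 2 then show ?thesis using c(2) N.positive_type_wandering_null[OF _ W] by (simp add: ergodic_class_def)
        next
          case 3 then show ?thesis using c(2) N.type_II_1_wandering_null[OF _ W] by (simp add: ergodic_class_def)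
        qed
      qed
      then show ?thesis using c 1 sets by (intro M.dissipative_singular) (auto simp: ergodic_class_def)
    next
      case 2
      then show ?thesis using c sets that(2)
        by (intro M.zero_type_singular_positive_type) (auto simp: ergodic_class_def)
    next
      case 3
      then show ?thesis using c sets that(2)
        by (intro M.zero_type_singular_type_II_1) (auto simp: ergodic_class_def)
    next
      case 4
      then show ?thesis using c sets that(2)
        by (intro M.type_II_infinity_singular_type_II_1) (auto simp: ergodic_class_def)
    qed
  qed
  show ?thesis
  proof (cases "i < j")
    case True
    then show ?thesis using assms by (intro less[of M N i j]) auto
  next
    case False
    then have "mutually_singular N M" using assms by (intro less[of N M j i]) auto
    then show ?thesis by (rule mutually_singular_sym[OF _ sets[symmetric]])
  qed
qed

text \<open>Off an \<open>M i\<close>-null set all \<open>N j\<close> with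
  \<open>j \<noteq> i\<close> vanish, so there the common sum is \<open>N i\<close> alone and bounds
  \<open>M i\<close>. No term is subtracted, so infinite values do no harm.\<close>

lemma emeasure_le_of_singular:
  fixes M N :: "'i \<Rightarrow> 'a measure"
  assumes "finite I" "i \<in> I" and sets: "\<And>i. i \<in> I \<Longrightarrow> sets (M i) = S" "\<And>i. i \<in> I \<Longrightarrow> sets (N i) = S"
    and sum: "\<And>A. A \<in> S \<Longrightarrow> (\<Sum>i\<in>I. emeasure (M i) A) = (\<Sum>i\<in>I. emeasure (N i) A)"
    and sing: "\<And>j. j \<in> I \<Longrightarrow> j \<noteq> i \<Longrightarrow> mutually_singular (M i) (N j)"
    and A: "A \<in> S"
  shows "emeasure (M i) A \<le> emeasure (N i) A"
proof -
  have "\<forall>j\<in>I - {i}. \<exists>E. E \<in> S \<and> emeasure (M i) (space (M i) - E) = 0 \<and> emeasure (N j) E = 0"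
    using sing sets assms(2) by (fastforce simp: mutually_singular_def)
  then obtain E where E: "\<And>j. j \<in> I - {i} \<Longrightarrow> E j \<in> S"
    "\<And>j. j \<in> I - {i} \<Longrightarrow> emeasure (M i) (space (M i) - E j) = 0"
    "\<And>j. j \<in> I - {i} \<Longrightarrow> emeasure (N j) (E j) = 0" by metis
  \<comment> \<open>Removing the complements of all the separating sets places \<open>A - R\<close>
    in every \<open>E j\<close> at once.\<close>
  define R where "R = (\<Union>j\<in>I - {i}. space (M i) - E j)"
  have R: "R \<in> null_sets (M i)"
    unfolding R_def using E assms(1,2) sets(1)[OF assms(2)]
    by (intro null_sets.finite_UN) (auto simp: null_sets_def)
  have RS: "R \<in> S" using R sets(1)[OF assms(2)] by (auto simp: null_sets_def)
  have AS: "A - R \<in> S" using A RS sets(1)[OF assms(2)] by (metis sets.Diff)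
  have zero: "emeasure (N j) (A - R) = 0" if j: "j \<in> I - {i}" for j
  proof -
    have "A \<subseteq> space (M i)" using A sets(1)[OF assms(2)] sets.sets_into_space by blast
    then have "A - R \<subseteq> E j" using j by (auto simp: R_def)
    then have "emeasure (N j) (A - R) \<le> emeasure (N j) (E j)"
      using E(1)[OF j] sets(2)[of j] j by (intro emeasure_mono) auto
    then show ?thesis using E(3)[OF j] by simp
  qed
  have "emeasure (M i) A = emeasure (M i) (A - R)"
    using R A sets(1)[OF assms(2)] by (intro emeasure_Diff_null_set[symmetric]) auto
  also have "\<dots> \<le> (\<Sum>j\<in>I. emeasure (M j) (A - R))"
    using assms(1,2) by (intro member_le_sum) auto
  also have "\<dots> = (\<Sum>j\<in>I. emeasure (N j) (A - R))" by (rule sum[OF AS])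
  also have "\<dots> = emeasure (N i) (A - R)"
    using zero assms(1,2) by (simp add: sum.remove[of I i])
  also have "\<dots> \<le> emeasure (N i) A"
    using A sets(2)[OF assms(2)] by (intro emeasure_mono) auto
  finally show ?thesis .
qed

lemma singular_decomposition_unique:
  fixes M N :: "'i \<Rightarrow> 'a measure"
  assumes "finite I" and sets: "\<And>i. i \<in> I \<Longrightarrow> sets (M i) = S" "\<And>i. i \<in> I \<Longrightarrow> sets (N i) = S"
    and sum: "\<And>A. A \<in> S \<Longrightarrow> (\<Sum>i\<in>I. emeasure (M i) A) = (\<Sum>i\<in>I. emeasure (N i) A)"
    and sing: "\<And>i j. i \<in> I \<Longrightarrow> j \<in> I \<Longrightarrow> i \<noteq> j \<Longrightarrow> mutually_singular (M i) (N j)"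
    and i: "i \<in> I"
  shows "M i = N i"
proof (rule measure_eqI)
  fix A assume "A \<in> sets (M i)"
  then have A: "A \<in> S" using sets i by simp
  show "emeasure (M i) A = emeasure (N i) A"
  proof (rule antisym)
    show "emeasure (M i) A \<le> emeasure (N i) A"
      by (rule emeasure_le_of_singular[OF assms(1) i sets sum sing[OF i] A]) auto
    show "emeasure (N i) A \<le> emeasure (M i) A"
    proof (rule emeasure_le_of_singular[OF assms(1) i sets(2,1) sum[symmetric] _ A])
      show "mutually_singular (N i) (M j)" if "j \<in> I" "j \<noteq> i" for j
        by (rule mutually_singular_sym[OF sing[OF that(1) i that(2)]]) (simp add: sets i that)
    qed
  qed
qed (simp add: sets i)

lemma IDp_convolution:
  assumes "stationary_IDp P1 Q1" "stationary_IDp P2 Q2" "stationary_IDp P3 Q3" "stationary_IDp P4 Q4"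
  shows "seq_law (P1 \<^bold>* P2 \<^bold>* P3 \<^bold>* P4)"
    and "a \<in> finite_seqs \<Longrightarrow> seq_char (P1 \<^bold>* P2 \<^bold>* P3 \<^bold>* P4) a =
      exp (levy_exponent Q1 a + levy_exponent Q2 a + levy_exponent Q3 a + levy_exponent Q4 a)"
proof -
  note laws = stationary_IDpD(2)[OF assms(1)] stationary_IDpD(2)[OF assms(2)]
    stationary_IDpD(2)[OF assms(3)] stationary_IDpD(2)[OF assms(4)]
  note c12 = seq_char_convolution[OF laws(1,2)]
  note c123 = seq_char_convolution[OF c12(1) laws(3)]
  note c1234 = seq_char_convolution[OF c123(1) laws(4)]
  show "seq_law (P1 \<^bold>* P2 \<^bold>* P3 \<^bold>* P4)" by (rule c1234(1))
  show "seq_char (P1 \<^bold>* P2 \<^bold>* P3 \<^bold>* P4) a =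
      exp (levy_exponent Q1 a + levy_exponent Q2 a + levy_exponent Q3 a + levy_exponent Q4 a)"
    if "a \<in> finite_seqs"
    unfolding c1234(2) c123(2) c12(2) using assms[THEN stationary_IDpD(3)[OF _ that]]
    by (simp add: exp_add)
qed

text \<open>Convolution multiplies characteristic functionals, so exponents add up to a period of
  \<open>exp\<close>; \<open>levy_measure_eqI\<close> turns this into addition of the Levy measures.
  Uniqueness is thereby a question about measures only.\<close>

lemma IDp_decomposition_emeasure:
  assumes P: "stationary_IDp P Q"
    and parts: "stationary_IDp P1 Q1" "stationary_IDp P2 Q2" "stationary_IDp P3 Q3" "stationary_IDp P4 Q4"
    and eq: "P = P1 \<^bold>* P2 \<^bold>* P3 \<^bold>* P4"
    and A: "A \<in> sets seq_space"
  shows "emeasure Q A = emeasure Q1 A + emeasure Q2 A + emeasure Q3 A + emeasure Q4 A"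
proof -
  note levy = parts[THEN stationary_IDpD(1)]
  note int = levy[THEN levy_measure_integrable]
  let ?S = "sum_measure (sum_measure (sum_measure Q1 Q2) Q3) Q4"
  note s12 = levy_sum_measure[OF int(1,2)]
  note s123 = levy_sum_measure[OF s12(1) int(3)]
  note s1234 = levy_sum_measure[OF s123(1) int(4)]
  have sets: "sets Q1 = sets seq_space" "sets Q2 = sets seq_space" "sets Q3 = sets seq_space" "sets Q4 = sets seq_space"
    using levy by (auto simp: levy_measure_def)
  have em: "emeasure ?S B = emeasure Q1 B + emeasure Q2 B + emeasure Q3 B + emeasure Q4 B"
    if "B \<in> sets seq_space" for B
    using that by (simp add: emeasure_sum_measure sets)
  have "Q = ?S"
  proof (rule levy_measure_eqI)
    show "levy_integrable Q" by (rule levy_measure_integrable[OF stationary_IDpD(1)[OF P]])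
    show "levy_integrable ?S" by (rule s1234(1))
    show "emeasure Q {\<lambda>_. 0} = 0" using stationary_IDpD(1)[OF P] by (simp add: levy_measure_def)
    show "emeasure ?S {\<lambda>_. 0} = 0" using levy em[OF sets_zero_seq] by (simp add: levy_measure_def)
    show "exp (levy_exponent Q a) = exp (levy_exponent ?S a)" if a: "a \<in> finite_seqs" for a
      using stationary_IDpD(3)[OF P a] IDp_convolution(2)[OF parts a]
      unfolding eq s1234(2)[OF a] s123(2)[OF a] s12(2)[OF a] by simp
  qed
  then show ?thesis using em[OF A] by simp
qed

lemma IDp_decomposition_unique:
  assumes P: "stationary_IDp P Q"
    and M: "\<And>k. k < 4 \<Longrightarrow> stationary_IDp (PM k) (M k)" "P = PM 0 \<^bold>* PM 1 \<^bold>* PM 2 \<^bold>* PM 3"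
      "\<And>k. k < 4 \<Longrightarrow> ergodic_class k (M k) shift"
    and N: "\<And>k. k < 4 \<Longrightarrow> stationary_IDp (PN k) (N k)" "P = PN 0 \<^bold>* PN 1 \<^bold>* PN 2 \<^bold>* PN 3"
      "\<And>k. k < 4 \<Longrightarrow> ergodic_class k (N k) shift"
    and k: "k < (4 :: nat)"
  shows "M k = N k"
proof -
  have levy: "levy_measure (M k)" "levy_measure (N k)" if "k < 4" for k
    using stationary_IDpD(1) M(1) N(1) that by auto
  then have sets: "sets (M k) = sets seq_space" "sets (N k) = sets seq_space" if "k < 4" for k
    using that by (auto simp: levy_measure_def)
  have four: "{..<4 :: nat} = {0, 1, 2, 3}" by auto
  show ?thesis
  proof (rule singular_decomposition_unique[where I="{..<4}" and S="sets seq_space"])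
    fix A assume A: "A \<in> sets seq_space"
    have "(\<Sum>k\<in>{..<4}. emeasure (M k) A) = emeasure Q A"
      unfolding four using IDp_decomposition_emeasure[OF P M(1) M(1) M(1) M(1) M(2) A] by (simp add: add.assoc)
    moreover have "(\<Sum>k\<in>{..<4}. emeasure (N k) A) = emeasure Q A"
      unfolding four using IDp_decomposition_emeasure[OF P N(1) N(1) N(1) N(1) N(2) A] by (simp add: add.assoc)
    ultimately show "(\<Sum>k\<in>{..<4}. emeasure (M k) A) = (\<Sum>k\<in>{..<4}. emeasure (N k) A)" by simp
  next
    fix i j :: nat assume "i \<in> {..<4}" "j \<in> {..<4}" "i \<noteq> j"
    then show "mutually_singular (M i) (N j)"
      using levy sets M(3) N(3)
      by (intro ergodic_class_singular[of "M i" shift "N j" i j] levy_measure_system) auto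
  qed (use sets k in auto)
qed

section \<open>Existence of the decomposition, and the conclusion\<close>

text \<open>The four indicators sum to 1 under the integral defining the exponent of
  \<open>Q\<close>, so \<open>P\<close> and the convolution have the same characteristic
  functional.\<close>

lemma IDp_decomposition_exists:
  assumes P: "stationary_IDp P Q"
  obtains M PM where "\<And>k. k < (4 :: nat) \<Longrightarrow> stationary_IDp (PM k) (M k)"
    "P = PM 0 \<^bold>* PM 1 \<^bold>* PM 2 \<^bold>* PM 3" "\<And>k. k < 4 \<Longrightarrow> ergodic_class k (M k) shift"
proof -
  have Q: "levy_measure Q" using P by (rule stationary_IDpD)
  interpret invertible_system Q shift by (rule levy_measure_system[OF Q])
  obtain B m w n where parts: "{B, m, w, n} \<subseteq> sets Q"
    "shift -` B = B" "shift -` m = m" "shift -` w = w" "shift -` n = n"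
    and ind: "\<And>x. indicator B x + indicator m x + indicator w x + indicator n x = (1 :: ennreal)"
    and cls: "dissipative (density Q (indicator B)) shift"
      "conservative (density Q (indicator m)) shift" "zero_type (density Q (indicator m)) shift"
      "type_II_infinity (density Q (indicator w)) shift" "positive_type (density Q (indicator w)) shift"
      "type_II_1 (density Q (indicator n)) shift"
    using four_part_decomposition by metis
  define E where "E k = (if k = 0 then B else if k = 1 then m else if k = 2 then w else n)" for k :: nat
  define M where "M k = density Q (indicator (E k))" for k
  have E: "E k \<in> sets Q" "shift -` E k = E k" for k using parts by (auto simp: E_def)
  have levy: "levy_measure (M k)" for k unfolding M_def by (rule levy_measure_restrict(1)[OF Q E])
  have cl: "ergodic_class k (M k) shift" for k
    using cls by (auto simp: ergodic_class_def M_def E_def)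
  have "\<exists>P. stationary_IDp P (M k)" for k using exists_stationary_IDp[OF levy] by metis
  then obtain PM where PM: "\<And>k. stationary_IDp (PM k) (M k)" by metis
  have "P = PM 0 \<^bold>* PM 1 \<^bold>* PM 2 \<^bold>* PM 3"
  proof (rule seq_law_eqI)
    fix a :: "int \<Rightarrow> real" assume a: "a \<in> finite_seqs"
    have ik: "integrable Q (levy_kernel a)"
      by (rule integrable_levy_kernel[OF levy_measure_integrable[OF Q] a])
    have i: "integrable Q (\<lambda>x. indicator (E k) x *\<^sub>R levy_kernel a x)" for k
      using ik by (rule integrable_mult_indicator[OF E(1)])
    have one: "indicator (E 0) x + indicator (E 1) x + indicator (E 2) x + indicator (E 3) x = (1 :: real)" for x
    proof -
      have "ennreal (indicator (E 0) x + indicator (E 1) x + indicator (E 2) x + indicator (E 3) x) = ennreal 1"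
        using ind[of x] by (simp add: E_def ennreal_indicator)
      then show ?thesis by (subst (asm) ennreal_inj) auto
    qed
    have "levy_exponent Q a = (CLINT x|Q. (indicator (E 0) x + indicator (E 1) x + indicator (E 2) x + indicator (E 3) x) *\<^sub>R levy_kernel a x)"
      unfolding one levy_exponent_def by simp
    also have "\<dots> = levy_exponent (M 0) a + levy_exponent (M 1) a + levy_exponent (M 2) a + levy_exponent (M 3) a"
      unfolding M_def levy_measure_restrict(2)[OF Q E] scaleR_add_left using i by simp
    finally show "seq_char P a = seq_char (PM 0 \<^bold>* PM 1 \<^bold>* PM 2 \<^bold>* PM 3) a"
      unfolding stationary_IDpD(3)[OF P a] IDp_convolution(2)[OF PM PM PM PM a] by simp
  qed (rule stationary_IDpD(2)[OF P] IDp_convolution(1)[OF PM PM PM PM])+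
  then show thesis by (rule that[where M=M and PM=PM, rotated]) (rule PM cl)+
qed

theorem theorem5p5:
  fixes P Q :: "(int \<Rightarrow> real) measure"
  assumes "stationary_IDp P Q"
  shows "\<exists>!D. case D of (Q\<^sub>B, Q\<^sub>m, Q\<^sub>w\<^sub>m, Q\<^sub>n\<^sub>e) \<Rightarrow>
    (\<exists>P\<^sub>B P\<^sub>m P\<^sub>w\<^sub>m P\<^sub>n\<^sub>e.
      stationary_IDp P\<^sub>B Q\<^sub>B \<and> stationary_IDp P\<^sub>m Q\<^sub>m \<and>
      stationary_IDp P\<^sub>w\<^sub>m Q\<^sub>w\<^sub>m \<and> stationary_IDp P\<^sub>n\<^sub>e Q\<^sub>n\<^sub>e \<and>
      P = P\<^sub>B \<^bold>* P\<^sub>m \<^bold>* P\<^sub>w\<^sub>m \<^bold>* P\<^sub>n\<^sub>e) \<and>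
    dissipative Q\<^sub>B shift \<and>
    (conservative Q\<^sub>m shift \<and> zero_type Q\<^sub>m shift) \<and>
    (type_II_infinity Q\<^sub>w\<^sub>m shift \<and> positive_type Q\<^sub>w\<^sub>m shift) \<and>
    type_II_1 Q\<^sub>n\<^sub>e shift"
    (is "\<exists>!D. ?R D")
proof -
  \<comment> \<open>Packs four separate objects into the indexed families on which the uniqueness
    lemma works; it is used both for the measures and for their laws.\<close>
  let ?four = "\<lambda>a b c d (k :: nat). if k = 0 then a else if k = 1 then b else if k = 2 then c else d"
  have decompose: "\<exists>PM. (\<forall>k<4. stationary_IDp (PM k) (?four a b c d k)) \<and>
      P = PM 0 \<^bold>* PM 1 \<^bold>* PM 2 \<^bold>* PM 3 \<and> (\<forall>k<4. ergodic_class k (?four a b c d k) shift)"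
    if R: "?R (a, b, c, d)" for a b c d
  proof -
    obtain Pa Pb Pc Pd where "stationary_IDp Pa a" "stationary_IDp Pb b" "stationary_IDp Pc c"
      "stationary_IDp Pd d" "P = Pa \<^bold>* Pb \<^bold>* Pc \<^bold>* Pd"
      using R by auto
    then show ?thesis using R
      by (intro exI[of _ "?four Pa Pb Pc Pd"]) (auto simp: ergodic_class_def)
  qed
  obtain M PM where M: "\<And>k. k < (4 :: nat) \<Longrightarrow> stationary_IDp (PM k) (M k)"
    "P = PM 0 \<^bold>* PM 1 \<^bold>* PM 2 \<^bold>* PM 3" "\<And>k. k < 4 \<Longrightarrow> ergodic_class k (M k) shift"
    using IDp_decomposition_exists[OF assms] by blast
  show ?thesis
  proof (rule ex1I[of _ "(M 0, M 1, M 2, M 3)"])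
    show "?R (M 0, M 1, M 2, M 3)"
      using M(1)[of 0] M(1)[of 1] M(1)[of 2] M(1)[of 3] M(2) M(3)[of 0] M(3)[of 1] M(3)[of 2] M(3)[of 3]
      by (auto simp: ergodic_class_def)
  next
    fix D assume R: "?R D"
    obtain a b c d where D: "D = (a, b, c, d)" by (cases D)
    obtain PN where N: "\<forall>k<4. stationary_IDp (PN k) (?four a b c d k)"
      "P = PN 0 \<^bold>* PN 1 \<^bold>* PN 2 \<^bold>* PN 3" "\<forall>k<4. ergodic_class k (?four a b c d k) shift"
      using decompose[OF R[unfolded D]] by blast
    have eq: "?four a b c d k = M k" if "k < 4" for k
      by (rule IDp_decomposition_unique[OF assms, of PN _ PM]) (use N M that in blast)+
    show "D = (M 0, M 1, M 2, M 3)"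
      using eq[of 0] eq[of 1] eq[of 2] eq[of 3] by (simp add: D)
  qed
qed

end
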